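(* The decomposition matrix $D=(d_{lm})_{1\le l,m\le p}$ of the category $\mathcal{P}_p^\varnothing$ is given by $$d_{lm}:=[W_{l-1}:F_{m-1}]=\begin{cases}1&\text{if }m=l\text{ or }m=l+1,\\0&\text{otherwise.}\end{cases}$$ Moreover, for all $0\le j\le p-1$ there are short exact sequences, with the convention $F_p=0$: $$0\to F_{j+1}\to W_j\to F_j\to0,\qquad 0\to F_j\to S_j\to F_{j+1}\to0.$$
   Context: $k$ is a field of characteristic $p>0$; $\mathcal{P}_e$ is the abelian category of homogeneous strict polynomial functors of degree $e$ over $k$ (Friedlander–Suslin; functors from finite-dimensional $k$-vector spaces to finite-dimensional $k$-vector spaces). For a partition (Young diagram) $\lambda=(\lambda_1,\dots,\lambda_n)$ of $e$ with conjugate $\widetilde\lambda$, put $\Lambda^\lambda=\Lambda^{\lambda_1}\otimes\dots\otimes\Lambda^{\lambda_n}$, $S^\lambda=S^{\lambda_1}\otimes\dots\otimes S^{\lambda_n}$ (tensor products of exterior, resp. symmetric, powers). The Schur functor $S_\lambda$ is the image of the composite $\Lambda^\lambda\hookrightarrow I^{\otimes e}\to I^{\otimes e}\twoheadrightarrow S^{\widetilde\lambda}$ of the natural monomorphism, the permutation of tensor factors that passes from the row reading to the column reading of the boxes of $\lambda$, and the natural epimorphism. The Kuhn dual is $G^\#(V)=G(V^* )^*$; the Weyl functor is $W_\lambda=(S_\lambda)^\#$; the simple functor $F_\lambda$ is the image of the composite $W_\lambda\hookrightarrow\Lambda^\lambda\twoheadrightarrow S_\lambda$. For $0\le i\le p-1$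 put $S_i=S_{(i+1,1^{p-i-1})}$, $W_i=W_{(i+1,1^{p-i-1})}$, $F_i=F_{(i+1,1^{p-i-1})}$ in $\mathcal{P}_p$. $\mathcal{P}_p^\varnothing$ is the block of $\mathcal{P}_p$ corresponding to hooks, whose simple objects are $F_0,\dots,F_{p-1}$. $[W:F]$ denotes the multiplicity of the simple functor $F$ as a composition factor of $W$. *)

theory Defs
  imports
    "HOL-Combinatorics.Multiset_Permutations"
    "HOL-Library.Function_Algebras"
    "HOL-Library.Poly_Mapping"
begin

section \<open>Vector spaces of functions\<close>

text \<open>
  Every vector space below is a subspace of a space \<^typ>\<open>'x \<Rightarrow> 'k\<close> of functions with the pointwise
  operations. Up to isomorphism this covers all finite-dimensional spaces (already for
  \<^typ>\<open>nat \<Rightarrow> 'k\<close>), and it is closed under passing to subspaces and to dual spaces.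
\<close>

definition fscale :: "'k::field \<Rightarrow> ('x \<Rightarrow> 'k) \<Rightarrow> 'x \<Rightarrow> 'k"  (infixr \<open>*\<^sub>f\<close> 75)
  where "c *\<^sub>f v = (\<lambda>x. c * v x)"

interpretation fun_space: vector_space "fscale :: 'k::field \<Rightarrow> ('x \<Rightarrow> 'k) \<Rightarrow> 'x \<Rightarrow> 'k"
  by unfold_locales (auto simp: fscale_def fun_eq_iff algebra_simps)

definition fin_dim :: "('x \<Rightarrow> 'k::field) set \<Rightarrow> bool"
  where "fin_dim V \<longleftrightarrow> (\<exists>B. finite B \<and> V = fun_space.span B)"

definition linear_between ::
    "('x \<Rightarrow> 'k::field) set \<Rightarrow> ('y \<Rightarrow> 'k) set \<Rightarrow> (('x \<Rightarrow> 'k) \<Rightarrow> 'y \<Rightarrow> 'k) \<Rightarrow> bool"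
  where "linear_between V W f \<longleftrightarrow> f ` V \<subseteq> W \<and>
     (\<forall>u\<in>V. \<forall>v\<in>V. f (u + v) = f u + f v) \<and> (\<forall>c. \<forall>v\<in>V. f (c *\<^sub>f v) = c *\<^sub>f f v)"

definition unit_vec :: "'x \<Rightarrow> 'x \<Rightarrow> 'k::field"
  where "unit_vec x = (\<lambda>y. if y = x then 1 else 0)"

section \<open>Strict polynomial functors\<close>

text \<open>
  Monomials and polynomials over \<open>'k\<close> in variables indexed by pairs. A linear map from \<open>k^m\<close> to
  \<open>k^n\<close> is an \<open>n\<close> by \<open>m\<close> matrix, and the variable \<open>(i, j)\<close> is its entry in row \<open>i\<close> and column \<open>j\<close>.
\<close>

type_synonym mono = "(nat \<times> nat) \<Rightarrow>\<^sub>0 nat"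
type_synonym 'k mpoly = "mono \<Rightarrow>\<^sub>0 'k"

definition mono_var :: "nat \<times> nat \<Rightarrow> mono"
  where "mono_var x = Poly_Mapping.single x 1"

definition var :: "nat \<times> nat \<Rightarrow> 'k::comm_ring_1 mpoly"
  where "var x = Poly_Mapping.single (mono_var x) 1"

definition mono_deg :: "mono \<Rightarrow> nat"
  where "mono_deg \<alpha> = (\<Sum>x\<in>Poly_Mapping.keys \<alpha>. Poly_Mapping.lookup \<alpha> x)"

definition monomials :: "nat \<Rightarrow> nat \<Rightarrow> nat \<Rightarrow> mono set"
  where "monomials e n m = {\<alpha>. Poly_Mapping.keys \<alpha> \<subseteq> {..<n} \<times> {..<m} \<and> mono_deg \<alpha> = e}"

definition mono_transpose :: "mono \<Rightarrow> mono"
  where "mono_transpose \<alpha> = Poly_Mapping.map_key prod.swap \<alpha>"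

text \<open>
  A strict polynomial functor \<open>T\<close> is given on the skeleton \<open>k^0, k^1, k^2, \<dots>\<close> of the category of
  finite-dimensional vector spaces. Its value on \<open>k^n\<close> is \<open>val T n\<close>. Its action on morphisms from
  \<open>k^m\<close> to \<open>k^n\<close> is, following Friedlander and Suslin, an element of
  \<open>S\<^sup>*(Hom(k^m, k^n)\<^sup>*) \<otimes> Hom(T(k^m), T(k^n))\<close>, that is, a polynomial in the matrix entries whose
  coefficients are linear maps; \<open>coef T m n \<alpha>\<close> is the coefficient of the monomial \<open>\<alpha>\<close>. (The field
  may be finite, so a polynomial cannot be replaced by the function it defines.)
\<close>

record ('x, 'k) spf =
  val :: "nat \<Rightarrow> ('x \<Rightarrow> 'k) set"
  coef :: "nat \<Rightarrow> nat \<Rightarrow> mono \<Rightarrow> ('x \<Rightarrow> 'k) \<Rightarrow> ('x \<Rightarrow> 'k)"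

text \<open>
  For generic matrices \<open>Y\<close> (with \<open>n\<close> columns) and \<open>X\<close> (with \<open>n\<close> rows), the monomial \<open>\<gamma>\<close> in the entries
  of the product \<open>Y X\<close>, as a polynomial in the entries of \<open>Y\<close> with coefficients that are polynomials
  in the entries of \<open>X\<close>.
\<close>

definition mono_of_product :: "nat \<Rightarrow> mono \<Rightarrow> 'k::field mpoly mpoly"
  where "mono_of_product n \<gamma> =
    (\<Prod>x\<in>Poly_Mapping.keys \<gamma>.
       (\<Sum>l<n. var (fst x, l) * Poly_Mapping.single 0 (var (l, snd x))) ^ Poly_Mapping.lookup \<gamma> x)"

text \<open>
  The objects of the category of homogeneous strict polynomial functors of degree \<open>e\<close>. The last two
  conditions are \<open>T(1) = 1\<close> and the identity of polynomials \<open>T(Y) T(X) = T(Y X)\<close>, the latter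
  compared at the monomial \<open>\<beta>\<close> in \<open>Y\<close> and \<open>\<alpha>\<close> in \<open>X\<close>.
\<close>

definition strict_polynomial :: "nat \<Rightarrow> ('x, 'k::field) spf \<Rightarrow> bool"
  where "strict_polynomial e T \<longleftrightarrow>
    (\<forall>n. fun_space.subspace (val T n) \<and> fin_dim (val T n)) \<and>
    (\<forall>m n \<alpha>. linear_between (val T m) (val T n) (coef T m n \<alpha>)) \<and>
    (\<forall>m n \<alpha>. \<alpha> \<notin> monomials e n m \<longrightarrow> (\<forall>v\<in>val T m. coef T m n \<alpha> v = 0)) \<and>
    (\<forall>n. \<forall>v\<in>val T n.
      (\<Sum>\<alpha>\<in>monomials e n n.
         (\<Prod>x\<in>Poly_Mapping.keys \<alpha>. (if fst x = snd x then 1 else 0) ^ Poly_Mapping.lookup \<alpha> x)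
           *\<^sub>f coef T n n \<alpha> v) = v) \<and>
    (\<forall>m n q \<alpha> \<beta>. \<forall>v\<in>val T m.
      coef T n q \<beta> (coef T m n \<alpha> v) =
      (\<Sum>\<gamma>\<in>monomials e q m.
         Poly_Mapping.lookup (Poly_Mapping.lookup (mono_of_product n \<gamma>) \<beta>) \<alpha> *\<^sub>f coef T m q \<gamma> v))"

text \<open>Morphisms are families of linear maps that commute with the polynomial actions.\<close>

definition spf_hom ::
    "('x, 'k::field) spf \<Rightarrow> ('y, 'k) spf \<Rightarrow> (nat \<Rightarrow> ('x \<Rightarrow> 'k) \<Rightarrow> 'y \<Rightarrow> 'k) \<Rightarrow> bool"
  where "spf_hom T U \<phi> \<longleftrightarrow>
    (\<forall>n. linear_between (val T n) (val U n) (\<phi> n)) \<and>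
    (\<forall>m n \<alpha>. \<forall>v\<in>val T m. \<phi> n (coef T m n \<alpha> v) = coef U m n \<alpha> (\<phi> m v))"

text \<open>The sequence \<open>0 \<rightarrow> A \<rightarrow> B \<rightarrow> C \<rightarrow> 0\<close> in degree \<open>e\<close>; exactness is pointwise.\<close>

definition short_exact :: "nat \<Rightarrow> ('x, 'k::field) spf \<Rightarrow> (nat \<Rightarrow> ('x \<Rightarrow> 'k) \<Rightarrow> 'y \<Rightarrow> 'k) \<Rightarrow>
    ('y, 'k) spf \<Rightarrow> (nat \<Rightarrow> ('y \<Rightarrow> 'k) \<Rightarrow> 'z \<Rightarrow> 'k) \<Rightarrow> ('z, 'k) spf \<Rightarrow> bool"
  where "short_exact e A \<phi> B \<psi> C \<longleftrightarrow>
    strict_polynomial e A \<and> strict_polynomial e B \<and> strict_polynomial e C \<and>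
    spf_hom A B \<phi> \<and> spf_hom B C \<psi> \<and>
    (\<forall>n. inj_on (\<phi> n) (val A n) \<and>
         \<phi> n ` val A n = {v \<in> val B n. \<psi> n v = 0} \<and>
         \<psi> n ` val B n = val C n)"

definition zero_spf :: "('x, 'k::field) spf"
  where "zero_spf = \<lparr>val = (\<lambda>n. {0}), coef = (\<lambda>m n \<alpha> v. 0)\<rparr>"

definition image_spf ::
    "('x, 'k::field) spf \<Rightarrow> (nat \<Rightarrow> ('x \<Rightarrow> 'k) \<Rightarrow> 'y \<Rightarrow> 'k) \<Rightarrow> ('y, 'k) spf \<Rightarrow> ('y, 'k) spf"
  where "image_spf T \<phi> U = \<lparr>val = (\<lambda>n. \<phi> n ` val T n), coef = coef U\<rparr>"

section \<open>Composition multiplicities\<close>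

definition subfunctor :: "('x, 'k::field) spf \<Rightarrow> ('x, 'k) spf \<Rightarrow> bool"
  where "subfunctor U T \<longleftrightarrow> coef U = coef T \<and>
    (\<forall>n. fun_space.subspace (val U n) \<and> val U n \<subseteq> val T n) \<and>
    (\<forall>m n \<alpha>. \<forall>v\<in>val U m. coef T m n \<alpha> v \<in> val U n)"

text \<open>That is, \<open>V / U\<close> is simple.\<close>

definition maximal_subfunctor :: "('x, 'k::field) spf \<Rightarrow> ('x, 'k) spf \<Rightarrow> bool"
  where "maximal_subfunctor U V \<longleftrightarrow> subfunctor U V \<and> U \<noteq> V \<and>
    (\<forall>X. subfunctor U X \<and> subfunctor X V \<longrightarrow> X = U \<or> X = V)"

definition composition_series :: "nat \<Rightarrow> ('x, 'k::field) spf \<Rightarrow> ('x, 'k) spf list \<Rightarrow> bool"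
  where "composition_series e T Ts \<longleftrightarrow> strict_polynomial e T \<and>
    Ts \<noteq> [] \<and> val (hd Ts) = (\<lambda>n. {0}) \<and> last Ts = T \<and> (\<forall>U\<in>set Ts. subfunctor U T) \<and>
    (\<forall>i. Suc i < length Ts \<longrightarrow> maximal_subfunctor (Ts ! i) (Ts ! Suc i))"

text \<open>That is, \<open>V / U\<close> is isomorphic to \<open>F\<close>.\<close>

definition quotient_iso ::
    "nat \<Rightarrow> ('x, 'k::field) spf \<Rightarrow> ('x, 'k) spf \<Rightarrow> ('y, 'k) spf \<Rightarrow> bool"
  where "quotient_iso e U V F \<longleftrightarrow> (\<exists>\<psi>. short_exact e U (\<lambda>n v. v) V \<psi> F)"

text \<open>
  The number \<open>[T : F]\<close>; it is specified only if \<open>T\<close> has a composition series, all of which then give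
  the same number by the Jordan--Hoelder theorem.
\<close>

definition multiplicity_in :: "nat \<Rightarrow> ('x, 'k::field) spf \<Rightarrow> ('y, 'k) spf \<Rightarrow> nat"
  where "multiplicity_in e T F = (THE d. \<exists>Ts. composition_series e T Ts \<and>
    d = card {i. Suc i < length Ts \<and> quotient_iso e (Ts ! i) (Ts ! Suc i) F})"

section \<open>Exterior and symmetric powers and their tensor products\<close>

text \<open>
  A functor with a chosen basis of each value: \<open>idx C n\<close> is the set of labels of the basis of the
  value on \<open>k^n\<close>, and \<open>ent C I J\<close> is the coefficient of the basis vector \<open>I\<close> in the image of the
  basis vector \<open>J\<close> under the generic matrix, whose entries are the variables.
\<close>

record (overloaded) ('x, 'k::zero) based =
  idx :: "nat \<Rightarrow> 'x set"
  ent :: "'x \<Rightarrow> 'x \<Rightarrow> 'k mpoly"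

definition spf_of :: "('x, 'k::field) based \<Rightarrow> ('x, 'k) spf"
  where "spf_of C = \<lparr>
    val = (\<lambda>n. {v. \<forall>I. I \<notin> idx C n \<longrightarrow> v I = 0}),
    coef = (\<lambda>m n \<alpha> v I.
      if I \<in> idx C n then \<Sum>J\<in>idx C m. Poly_Mapping.lookup (ent C I J) \<alpha> * v J else 0)\<rparr>"

definition tensor_based :: "('x, 'k::field) based list \<Rightarrow> ('x list, 'k) based"
  where "tensor_based Cs = \<lparr>
    idx = (\<lambda>n. {Is. list_all2 (\<lambda>I C. I \<in> idx C n) Is Cs}),
    ent = (\<lambda>Is Js. \<Prod>i<length Cs. ent (Cs ! i) (Is ! i) (Js ! i))\<rparr>"

definition word_mono :: "nat list \<Rightarrow> nat list \<Rightarrow> 'k::field mpoly"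
  where "word_mono I J = (\<Prod>i<length I. var (I ! i, J ! i))"

definition word_sign :: "nat list \<Rightarrow> 'k::field"
  where "word_sign I = (-1) ^ card {(i, j). i < j \<and> j < length I \<and> I ! j < I ! i}"

text \<open>
  The exterior power has the basis \<open>e(a\<^sub>1) \<and> \<dots> \<and> e(a\<^sub>r)\<close> with \<open>a\<^sub>1 < \<dots> < a\<^sub>r\<close>, labelled by the set
  \<open>{a\<^sub>1, \<dots>, a\<^sub>r}\<close>; the matrix entries are the minors of the generic matrix. The symmetric power has the
  basis of monomials \<open>e(b\<^sub>1) \<dots> e(b\<^sub>r)\<close>, labelled by the multiset of the \<open>b\<^sub>i\<close>; the matrix entries come from
  expanding \<open>\<Prod>\<^sub>k (\<Sum>\<^sub>i x(i, b\<^sub>k) e(i))\<close>.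
\<close>

definition exterior_power :: "nat \<Rightarrow> (nat set, 'k::field) based"
  where "exterior_power r = \<lparr>
    idx = (\<lambda>n. {A. A \<subseteq> {..<n} \<and> card A = r}),
    ent = (\<lambda>A B. \<Sum>I\<in>permutations_of_set A.
      Poly_Mapping.single 0 (word_sign I) * word_mono I (sorted_list_of_set B))\<rparr>"

definition symmetric_power :: "nat \<Rightarrow> (nat multiset, 'k::field) based"
  where "symmetric_power r = \<lparr>
    idx = (\<lambda>n. {M. set_mset M \<subseteq> {..<n} \<and> size M = r}),
    ent = (\<lambda>M N. \<Sum>I\<in>permutations_of_multiset M. word_mono I (sorted_list_of_multiset N))\<rparr>"

definition ext_tensor :: "nat list \<Rightarrow> (nat set list, 'k::field) based"
  where "ext_tensor \<mu> = tensor_based (map exterior_power \<mu>)"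

definition sym_tensor :: "nat list \<Rightarrow> (nat multiset list, 'k::field) based"
  where "sym_tensor \<mu> = tensor_based (map symmetric_power \<mu>)"

section \<open>Schur functors, Weyl functors and the simple functors\<close>

text \<open>
  A partition is the weakly decreasing list of its positive parts. A vector of the tensor power of
  degree \<open>e\<close> of \<open>k^n\<close> is a function on words of length \<open>e\<close> in the letters \<open>0, \<dots>, n - 1\<close>.
\<close>

definition conjugate :: "nat list \<Rightarrow> nat list"
  where "conjugate \<mu> =
    map (\<lambda>c. length (filter (\<lambda>l. c < l) \<mu>)) [0..<(if \<mu> = [] then 0 else hd \<mu>)]"

definition row_reading :: "nat list \<Rightarrow> (nat \<times> nat) list"
  where "row_reading \<mu> = [(r, c). r \<leftarrow> [0..<length \<mu>], c \<leftarrow> [0..<\<mu> ! r]]"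

definition column_reading :: "nat list \<Rightarrow> (nat \<times> nat) list"
  where "column_reading \<mu> =
    [(r, c). c \<leftarrow> [0..<length (conjugate \<mu>)], r \<leftarrow> [0..<conjugate \<mu> ! c]]"

fun chunks :: "nat list \<Rightarrow> 'a list \<Rightarrow> 'a list list"
  where
    "chunks [] I = []"
  | "chunks (l # ls) I = take l I # chunks ls (drop l I)"

text \<open>
  The monomorphism from the tensor product of exterior powers to the tensor power is the tensor
  product of the antisymmetrizations
  \<open>e(a\<^sub>1) \<and> \<dots> \<and> e(a\<^sub>r) \<mapsto> \<Sum>\<^sub>\<sigma> sgn(\<sigma>) e(\<sigma>(a\<^sub>1)) \<otimes> \<dots> \<otimes> e(\<sigma>(a\<^sub>r))\<close>, over the permutations
  \<open>\<sigma>\<close> of \<open>{a\<^sub>1, \<dots>, a\<^sub>r}\<close>.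
\<close>

definition ext_incl :: "nat list \<Rightarrow> (nat set list \<Rightarrow> 'k::field) \<Rightarrow> nat list \<Rightarrow> 'k"
  where "ext_incl \<mu> v I =
    (if length I = sum_list \<mu> \<and> list_all distinct (chunks \<mu> I)
     then prod_list (map word_sign (chunks \<mu> I)) * v (map set (chunks \<mu> I)) else 0)"

text \<open>
  The permutation of tensor factors that takes the tensor with the factor \<open>v\<^sub>b\<close> at each box \<open>b\<close>, the
  boxes being ordered by rows, to the tensor with the same factors, the boxes being ordered by
  columns. Its effect on coordinates: the value at the word \<open>J\<close> is the value of \<open>t\<close> at the
  row-ordered word of the filling of the diagram whose column-ordered word is \<open>J\<close>.
\<close>

definition row_to_column :: "nat list \<Rightarrow> (nat list \<Rightarrow> 'k::field) \<Rightarrow> nat list \<Rightarrow> 'k"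
  where "row_to_column \<mu> t J =
    (if length J = sum_list \<mu>
     then t (map (\<lambda>b. the (map_of (zip (column_reading \<mu>) J) b)) (row_reading \<mu>)) else 0)"

text \<open>
  The epimorphism from the tensor power to the tensor product of symmetric powers, induced by
  \<open>e(b\<^sub>1) \<otimes> \<dots> \<otimes> e(b\<^sub>r) \<mapsto> e(b\<^sub>1) \<dots> e(b\<^sub>r)\<close>.
\<close>

definition sym_proj :: "nat list \<Rightarrow> (nat list \<Rightarrow> 'k::field) \<Rightarrow> nat multiset list \<Rightarrow> 'k"
  where "sym_proj \<mu> t M =
    (\<Sum>J | length J = sum_list \<mu> \<and> map mset (chunks \<mu> J) = M. t J)"

definition schur_map :: "nat list \<Rightarrow> nat \<Rightarrow> (nat set list \<Rightarrow> 'k::field) \<Rightarrow> nat multiset list \<Rightarrow> 'k"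
  where "schur_map \<mu> n v = sym_proj (conjugate \<mu>) (row_to_column \<mu> (ext_incl \<mu> v))"

definition schur_functor :: "nat list \<Rightarrow> (nat multiset list, 'k::field) spf"
  where "schur_functor \<mu> =
    image_spf (spf_of (ext_tensor \<mu>)) (schur_map \<mu>) (spf_of (sym_tensor (conjugate \<mu>)))"

text \<open>
  The Kuhn dual. The dual space of \<open>val T n\<close> consists of the linear forms on \<open>val T n\<close>, extended by
  \<open>0\<close> to a function on the whole ambient type. The dual of \<open>k^n\<close> is identified with \<open>k^n\<close> by the dual
  basis; the dual of a matrix is then its transpose.
\<close>

definition dual_space :: "('x \<Rightarrow> 'k::field) set \<Rightarrow> (('x \<Rightarrow> 'k) \<Rightarrow> 'k) set"
  where "dual_space V = {f. (\<forall>u\<in>V. \<forall>v\<in>V. f (u + v) = f u + f v) \<and>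
    (\<forall>c. \<forall>v\<in>V. f (c *\<^sub>f v) = c * f v) \<and> (\<forall>v. v \<notin> V \<longrightarrow> f v = 0)}"

definition kuhn_dual :: "('x, 'k::field) spf \<Rightarrow> ('x \<Rightarrow> 'k, 'k) spf"
  where "kuhn_dual T = \<lparr>
    val = (\<lambda>n. dual_space (val T n)),
    coef = (\<lambda>m n \<alpha> f v. if v \<in> val T n then f (coef T n m (mono_transpose \<alpha>) v) else 0)\<rparr>"

definition kuhn_dual_map :: "('x, 'k::field) spf \<Rightarrow> (nat \<Rightarrow> ('x \<Rightarrow> 'k) \<Rightarrow> 'y \<Rightarrow> 'k) \<Rightarrow>
    nat \<Rightarrow> (('y \<Rightarrow> 'k) \<Rightarrow> 'k) \<Rightarrow> ('x \<Rightarrow> 'k) \<Rightarrow> 'k"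
  where "kuhn_dual_map T \<phi> n f = (\<lambda>v. if v \<in> val T n then f (\<phi> n v) else 0)"

definition weyl_functor :: "nat list \<Rightarrow> (nat multiset list \<Rightarrow> 'k, 'k::field) spf"
  where "weyl_functor \<mu> = kuhn_dual (schur_functor \<mu>)"

text \<open>
  The self-duality of a tensor product of exterior powers, which identifies the dual basis of the
  standard basis with the standard basis.
\<close>

definition ext_self_dual ::
    "nat list \<Rightarrow> nat \<Rightarrow> ((nat set list \<Rightarrow> 'k::field) \<Rightarrow> 'k) \<Rightarrow> nat set list \<Rightarrow> 'k"
  where "ext_self_dual \<mu> n f =
    (\<lambda>A. if A \<in> idx (ext_tensor \<mu> :: (_, 'k) based) n then f (unit_vec A) else 0)"

definition weyl_incl ::
    "nat list \<Rightarrow> nat \<Rightarrow> ((nat multiset list \<Rightarrow> 'k::field) \<Rightarrow> 'k) \<Rightarrow> nat set list \<Rightarrow> 'k"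
  where "weyl_incl \<mu> n f =
    ext_self_dual \<mu> n (kuhn_dual_map (spf_of (ext_tensor \<mu>)) (schur_map \<mu>) n f)"

definition simple_functor :: "nat list \<Rightarrow> (nat multiset list, 'k::field) spf"
  where "simple_functor \<mu> = image_spf (weyl_functor \<mu>)
    (\<lambda>n f. schur_map \<mu> n (weyl_incl \<mu> n f)) (schur_functor \<mu>)"

section \<open>Hooks\<close>

definition hook :: "nat \<Rightarrow> nat \<Rightarrow> nat list"
  where "hook p i = Suc i # replicate (p - i - 1) 1"

definition hook_S :: "nat \<Rightarrow> nat \<Rightarrow> (nat multiset list, 'k::field) spf"
  where "hook_S p i = schur_functor (hook p i)"

definition hook_W :: "nat \<Rightarrow> nat \<Rightarrow> (nat multiset list \<Rightarrow> 'k, 'k::field) spf"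
  where "hook_W p i = weyl_functor (hook p i)"

definition hook_F :: "nat \<Rightarrow> nat \<Rightarrow> (nat multiset list, 'k::field) spf"
  where "hook_F p i = (if i < p then simple_functor (hook p i) else zero_spf)"

end

theory Submission
  imports Defs
begin

text \<open>
  Write \<open>\<Omega>\<^sup>i = S\<^sup>p\<^sup>-\<^sup>i \<otimes> \<Lambda>\<^sup>i\<close>, with the Koszul differential \<open>\<kappa> : \<Omega>\<^sup>i \<rightarrow> \<Omega>\<^sup>i\<^sup>-\<^sup>1\<close> and the de Rham differential
  \<open>d : \<Omega>\<^sup>i \<rightarrow> \<Omega>\<^sup>i\<^sup>+\<^sup>1\<close>. The Schur functor \<open>S\<^sub>i\<close> of a hook is \<open>\<kappa> \<Omega>\<^sup>i\<^sup>+\<^sup>1\<close>. In degree \<open>p\<close> we have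
  \<open>d \<kappa> + \<kappa> d = p = 0\<close>, so \<open>d\<close> induces a map \<open>S\<^sub>i \<rightarrow> S\<^sub>i\<^sub>+\<^sub>1\<close>.
  Let \<open>s\<close> be the surjection \<open>\<Lambda>\<^sup>\<lambda> \<rightarrow> S\<^sub>i\<close>. The map \<open>\<theta> = s s\<^sup>T : W\<^sub>i \<rightarrow> S\<^sub>i\<close>, whose image is \<open>F\<^sub>i\<close>, is a
  symmetric form. The weight \<open>(p - i, 1, \<dots>, 1)\<close> occurs once in \<open>S\<^sub>i\<close>; a vector \<open>v\<^sub>0\<close> of this weight
  generates \<open>F\<^sub>i\<close> and lies in every nonzero subfunctor of \<open>S\<^sub>i\<close>. Hence \<open>F\<^sub>i\<close> is the simple socle of
  \<open>S\<^sub>i\<close>, and dually \<open>W\<^sub>i\<close> has the simple head \<open>F\<^sub>i\<close>.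
  The map \<open>d\<close> kills \<open>F\<^sub>i\<close>, since \<open>d v\<^sub>0\<close> would be a form of degree \<open>i + 2\<close> in \<open>i + 1\<close> variables. Its
  image is \<open>F\<^sub>i\<^sub>+\<^sub>1\<close>: as \<open>S\<^sub>i\<close> is generated by one multilinear vector, it suffices to compute \<open>d\<close> of that
  vector. Its kernel is \<open>F\<^sub>i\<close>: in a weight with a multiplicity \<open>a\<^sub>x\<close> prime to \<open>p\<close>, Cartan's formula with
  the contraction by \<open>x \<partial>/\<partial>x\<close> puts the kernel into \<open>d S\<^sub>i\<^sub>-\<^sub>1 = F\<^sub>i\<close>, and the other weights are multiples
  \<open>p \<cdot> x\<close> of one letter. This is the sequence for \<open>S\<^sub>i\<close>; its transpose, with \<open>F\<^sub>i\<^sub>+\<^sub>1\<close> identified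
  with its dual by \<open>\<theta>\<close>, is the one for \<open>W\<^sub>i\<close>. So \<open>W\<^sub>i\<close> has at most one proper nonzero subfunctor,
  which determines its composition series.
\<close>

section \<open>Alternating sums\<close>

text \<open>The field may be finite, so torus elements need not separate weights and the action is
  known only through coefficients of monomials. This shapes the encoding: exterior powers are
  embedded in tensor powers and every vector is written with words. A coefficient then sends a word
  J to the sum of the words I with a prescribed multiset of pairs (I_k, J_k), a condition that is
  blind to a common permutation of positions. Hence whatever is built from permutations of positions
  is natural, which covers the Koszul and the de Rham map at once; the price is factorials of
  numbers below p, all invertible. Weight components are coefficients of diagonal monomials, and
  T(1) = 1 says that they add up to the vector. The form \<open>theta\<close> is a morphism because
  the minors of a transposed matrix are the transposed minors. Multiplicities are defined by a
  definite description, so all composition series are determined outright. The simple functors are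
  told apart by where they first become nonzero: F_i vanishes on k^n for n up to i, but not on
  k^(i+1).\<close>

lemma word_sign_Nil [simp]: "word_sign [] = 1"
  by (simp add: word_sign_def)

lemma word_sign_Cons:
  "word_sign (x # xs) = (-1) ^ card {j. j < length xs \<and> xs ! j < x} * word_sign xs"
proof -
  let ?A = "Pair (0::nat) ` Suc ` {j. j < length xs \<and> xs ! j < x}"
  let ?B = "map_prod Suc Suc ` {(i, j). i < j \<and> j < length xs \<and> xs ! j < xs ! i}"
  have eq: "{(i, j). i < j \<and> j < length (x # xs) \<and> (x # xs) ! j < (x # xs) ! i} = ?A \<union> ?B"
    apply (intro set_eqI iffI)
    subgoal for ij
      apply (cases ij; cases "fst ij"; cases "snd ij")
      apply (auto simp: image_iff)
      done
    apply auto
    done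
  have fin: "finite {(i, j). i < j \<and> j < length xs \<and> xs ! j < xs ! i}"
    by (rule finite_subset[of _ "{..<length xs} \<times> {..<length xs}"]) auto
  have "card (?A \<union> ?B) = card ?A + card ?B"
    by (rule card_Un_disjoint) (use fin in auto)
  also have "card ?A = card {j. j < length xs \<and> xs ! j < x}"
    by (simp add: card_image inj_on_def image_image)
  also have "card ?B = card {(i, j). i < j \<and> j < length xs \<and> xs ! j < xs ! i}"
    by (rule card_image) (auto simp: inj_on_def)
  finally show ?thesis
    unfolding word_sign_def eq by (simp add: power_add)
qed

lemma word_sign_Cons_distinct:
  assumes "distinct xs"
  shows "word_sign (x # xs) = (-1) ^ card {y \<in> set xs. y < x} * word_sign xs"
proof -
  have "{y \<in> set xs. y < x} = (!) xs ` {j. j < length xs \<and> xs ! j < x}"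
    by (auto simp: in_set_conv_nth)
  moreover have "inj_on ((!) xs) {j. j < length xs \<and> xs ! j < x}"
    using assms by (auto simp: inj_on_def nth_eq_iff_index_eq)
  ultimately show ?thesis
    by (simp add: word_sign_Cons card_image)
qed

lemma word_sign_square [simp]: "word_sign xs * word_sign xs = 1"
  by (simp add: word_sign_def flip: power_mult_distrib)

lemma word_sign_square_scale [simp]: "word_sign xs *\<^sub>f word_sign xs *\<^sub>f v = v"
  by simp

lemma word_sign_sorted: "sorted xs \<Longrightarrow> word_sign xs = 1"
  unfolding word_sign_def
  by (subst card_eq_0_iff[THEN iffD2]) (auto simp: sorted_iff_nth_mono not_less)

lemma word_sign_map_mono:
  assumes "\<And>x y. x \<in> set xs \<Longrightarrow> y \<in> set xs \<Longrightarrow> f x < f y \<longleftrightarrow> x < y"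
  shows "word_sign (map f xs) = word_sign xs"
proof -
  have "{(i, j). i < j \<and> j < length (map f xs) \<and> map f xs ! j < map f xs ! i} =
        {(i, j). i < j \<and> j < length xs \<and> xs ! j < xs ! i}"
    using assms by auto
  then show ?thesis by (simp add: word_sign_def)
qed

text \<open>Letters in front see the same set of later letters, and each neighbour is compared with
  the same rest; only the inversion between the two neighbours appears or disappears.\<close>

lemma word_sign_swap:
  fixes xs :: "nat list"
  assumes "distinct (xs @ x # y # zs)"
  shows "word_sign (xs @ y # x # zs) = - (word_sign (xs @ x # y # zs) :: 'k::field)"
  using assms
proof (induction xs)
  case Nil
  have *: "{w \<in> set (v # zs). w < u} = (if v < u then insert v {w \<in> set zs. w < u} else {w \<in> set zs. w < u})"
    for u v by auto
  have **: "card {w \<in> set (v # zs). w < u} = (if v < u then 1 else 0) + card {w \<in> set zs. w < u}"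
    if "v \<notin> set zs" for u v
    unfolding * using that by simp
  show ?case
  proof -
    have d: "distinct zs" "distinct (x # zs)" "distinct (y # zs)" "x \<noteq> y" using Nil by auto
    have "word_sign (y # x # zs) = (
      (-1) ^ ((if x < y then 1 else 0) + card {w \<in> set zs. w < y}) * ((-1) ^ card {w \<in> set zs. w < x} * word_sign zs) :: 'k)"
      using d by (subst word_sign_Cons_distinct, simp, subst **, simp, subst word_sign_Cons_distinct) auto
    moreover have "word_sign (x # y # zs) = (
      (-1) ^ ((if y < x then 1 else 0) + card {w \<in> set zs. w < x}) * ((-1) ^ card {w \<in> set zs. w < y} * word_sign zs) :: 'k)"
      using d by (subst word_sign_Cons_distinct, simp, subst **, simp, subst word_sign_Cons_distinct) auto
    ultimately show ?thesis using d(4)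
      by (cases "x < y") (auto simp: power_add not_less)
  qed
next
  case (Cons a xs)
  have "{w \<in> set (xs @ y # x # zs). w < a} = {w \<in> set (xs @ x # y # zs). w < a}" by auto
  moreover have "distinct (xs @ y # x # zs)" "distinct (xs @ x # y # zs)" using Cons.prems by auto
  ultimately show ?case
    using Cons by (simp only: append_Cons word_sign_Cons_distinct distinct.simps) simp
qed

lemma transpose_Suc_less:
  assumes "x \<noteq> y" "{x, y} \<noteq> {k, Suc k}"
  shows "transpose k (Suc k) x < transpose k (Suc k) y \<longleftrightarrow> x < y"
  using assms by (auto simp: transpose_def)

text \<open>Exchanging the values \<open>k\<close> and \<open>Suc k\<close> keeps the order of every
  other pair of values, so the only new inversion is the pair of positions
  \<open>(a, b)\<close>.\<close>

lemma word_sign_transpose_values_aux: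
  assumes "distinct I" "a < b" "b < length I" "I ! a = k" "I ! b = Suc k"
  shows "word_sign (map (transpose k (Suc k)) I) = - (word_sign I :: 'k::field)"
proof -
  let ?t = "transpose k (Suc k)"
  let ?Inv = "\<lambda>I :: nat list. {(i, j). i < j \<and> j < length I \<and> I ! j < I ! i}"
  have "?t (I ! j) < ?t (I ! i) \<longleftrightarrow> (i, j) = (a, b) \<or> I ! j < I ! i"
    if "i < j" "j < length I" for i j
  proof (cases "{I ! j, I ! i} = {k, Suc k}")
    case True
    then have "I ! j = I ! a \<and> I ! i = I ! b \<or> I ! j = I ! b \<and> I ! i = I ! a"
      using assms by (auto simp: doubleton_eq_iff)
    then have "(i = a \<and> j = b) \<or> (i = b \<and> j = a)"
      using assms(1-3) that by (metis nth_eq_iff_index_eq order.strict_trans)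
    then show ?thesis using assms that by auto
  next
    case False
    moreover have "I ! j \<noteq> I ! i" using assms(1) that by (simp add: nth_eq_iff_index_eq)
    moreover have "(i, j) \<noteq> (a, b)" using False assms by auto
    ultimately show ?thesis using transpose_Suc_less[of "I ! j" "I ! i" k] by blast
  qed
  then have "?Inv (map ?t I) = insert (a, b) (?Inv I)"
    using assms by auto
  moreover have "(a, b) \<notin> ?Inv I" using assms by auto
  moreover have "finite (?Inv I)"
    by (rule finite_subset[of _ "{..<length I} \<times> {..<length I}"]) auto
  ultimately have "card (?Inv (map ?t I)) = Suc (card (?Inv I))" by simp
  then show ?thesis unfolding word_sign_def by (simp only: power_Suc mult_minus_left mult_1_left)
qed

lemma word_sign_transpose_values:
  assumes "distinct I" "k \<in> set I" "Suc k \<in> set I"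
  shows "word_sign (map (transpose k (Suc k)) I) = - (word_sign I :: 'k::field)"
proof -
  obtain a b where ab: "a < length I" "I ! a = k" "b < length I" "I ! b = Suc k"
    using assms by (metis in_set_conv_nth)
  then have "a \<noteq> b" by auto
  then consider "a < b" | "b < a" by linarith
  then show ?thesis
  proof cases
    case 1
    show ?thesis
      by (rule word_sign_transpose_values_aux[of _ a b]) (use assms ab 1 in simp_all)
  next
    case 2
    let ?J = "map (transpose k (Suc k)) I"
    have "word_sign (map (transpose k (Suc k)) ?J) = - (word_sign ?J :: 'k)"
      by (rule word_sign_transpose_values_aux[of _ b a]) (use assms 2 ab in \<open>auto simp: distinct_map\<close>)
    then have "word_sign I = - (word_sign ?J :: 'k)" by (simp add: comp_def)
    then show ?thesis by (simp only: minus_minus)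
  qed
qed

text \<open>Permutations of \<open>{..<m}\<close> are written in one-line notation, as words.\<close>

definition perms :: "nat \<Rightarrow> nat list set"
  where "perms m = permutations_of_set {..<m}"

definition place :: "'a list \<Rightarrow> nat list \<Rightarrow> 'a list"
  where "place a I = map ((!) a) I"

text \<open>The sign belongs to the permutation of positions, not to the letters. The sum therefore
  makes sense for repeated letters and for letters of any type.\<close>

definition altsum :: "('a list \<Rightarrow> 'x \<Rightarrow> 'k::field) \<Rightarrow> 'a list \<Rightarrow> 'x \<Rightarrow> 'k"
  where "altsum G a = (\<Sum>I\<in>perms (length a). word_sign I *\<^sub>f G (place a I))"

lemma finite_perms [simp]: "finite (perms m)"
  by (simp add: perms_def)

lemma permsD: "I \<in> perms m \<Longrightarrow> distinct I \<and> set I = {..<m} \<and> length I = m"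
  unfolding perms_def using permutations_of_setD[of I] distinct_card[of I] by fastforce

lemma perms_iff: "I \<in> perms m \<longleftrightarrow> distinct I \<and> set I = {..<m}"
  unfolding perms_def by (auto dest: permutations_of_setD)

lemma length_place [simp]: "length (place a I) = length I"
  by (simp add: place_def)

lemma mset_place: "I \<in> perms (length a) \<Longrightarrow> mset (place a I) = mset a"
proof -
  assume "I \<in> perms (length a)"
  then have "distinct I" "set I = set [0..<length a]"
    using permsD[of I "length a"] by (simp_all add: atLeast_upt)
  then have "mset I = mset [0..<length a]"
    by (intro iffD1[OF set_eq_iff_mset_eq_distinct]) auto
  then have "mset (place a I) = image_mset ((!) a) (mset [0..<length a])"
    unfolding place_def by (simp only: mset_map)
  also have "\<dots> = mset a" by (simp only: mset_map[symmetric] map_nth)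
  finally show ?thesis .
qed

lemma altsum_cong:
  assumes "\<And>u. mset u = mset a \<Longrightarrow> G u = H u"
  shows "altsum G a = altsum H a"
  unfolding altsum_def by (rule sum.cong) (auto simp: assms mset_place)

lemma altsum_Nil [simp]: "altsum G [] = G []"
  by (simp add: altsum_def perms_def place_def)

lemma altsum_zero [simp]: "altsum (\<lambda>u. 0) a = 0"
  by (simp add: altsum_def)

lemma fscale_sum_apply: "(\<Sum>s\<in>S. f s) x = (\<Sum>s\<in>S. f s x)"
  by (induction S rule: infinite_finite_induct) auto

lemma nth_swap:
  assumes "v < length (xs @ x # y # zs)"
  shows "(xs @ y # x # zs) ! v = (xs @ x # y # zs) ! (transpose (length xs) (Suc (length xs)) v)"
  using assms by (auto simp: transpose_def nth_append nth_Cons split: nat.split)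

lemma map_transpose_perms:
  assumes "Suc k < m"
  shows "bij_betw (map (transpose k (Suc k))) (perms m) (perms m)"
proof (rule bij_betwI[of _ _ _ "map (transpose k (Suc k))"])
  have *: "map (transpose k (Suc k)) I \<in> perms m" if "I \<in> perms m" for I
  proof -
    have "transpose k (Suc k) ` {..<m} = {..<m}"
      using assms by (simp add: transpose_image_eq)
    then show ?thesis using that by (auto simp: perms_iff distinct_map)
  qed
  show "map (transpose k (Suc k)) \<in> perms m \<rightarrow> perms m"
       "map (transpose k (Suc k)) \<in> perms m \<rightarrow> perms m"
    using * by auto
qed (auto simp: comp_def)

lemma altsum_swap: "altsum G (xs @ y # x # zs) = - altsum G (xs @ x # y # zs)"
proof -
  let ?k = "length xs" and ?m = "length (xs @ x # y # zs)"
  let ?t = "transpose ?k (Suc ?k)"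
  have "altsum G (xs @ x # y # zs) =
    (\<Sum>I\<in>perms ?m. word_sign (map ?t I) *\<^sub>f G (place (xs @ x # y # zs) (map ?t I)))"
    unfolding altsum_def
    by (rule sum.reindex_bij_betw[symmetric]) (rule map_transpose_perms, simp)
  also have "\<dots> = (\<Sum>I\<in>perms ?m. - (word_sign I *\<^sub>f G (place (xs @ y # x # zs) I)))"
  proof (rule sum.cong)
    fix I assume I: "I \<in> perms ?m"
    then have "word_sign (map ?t I) = - (word_sign I :: 'b)"
      by (intro word_sign_transpose_values) (auto simp: perms_iff)
    moreover have "place (xs @ x # y # zs) (map ?t I) = place (xs @ y # x # zs) I"
      unfolding place_def using I nth_swap[of _ xs x y zs] by (auto simp: perms_iff)
    ultimately show "word_sign (map ?t I) *\<^sub>f G (place (xs @ x # y # zs) (map ?t I)) =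
      - (word_sign I *\<^sub>f G (place (xs @ y # x # zs) I))" by simp
  qed simp
  also have "\<dots> = - altsum G (xs @ y # x # zs)"
    by (simp add: altsum_def sum_negf)
  finally show ?thesis by simp
qed

text \<open>Pairing a permutation with its product with the transposition works also in characteristic 2.\<close>

lemma altsum_adjacent_eq: "altsum G (xs @ x # x # zs) = 0"
proof -
  let ?k = "length xs" and ?m = "length (xs @ x # x # zs)"
  let ?t = "transpose ?k (Suc ?k)"
  let ?f = "\<lambda>I. word_sign I *\<^sub>f G (place (xs @ x # x # zs) I)"
  define pos where "pos = (\<lambda>(I :: nat list) v. THE i. i < length I \<and> I ! i = v)"
  have pos: "pos I v = i" if "distinct I" "i < length I" "I ! i = v" for I v i
    unfolding pos_def using that by (auto simp: nth_eq_iff_index_eq)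
  have pos_map: "pos (map ?t I) v = pos I (?t v)" for I v
    unfolding pos_def by (rule arg_cong[of _ _ The]) (auto simp: fun_eq_iff)
  \<comment> \<open>The permutations are split by which of the two equal letters comes first; the
    transposition exchanges the two halves, and paired terms cancel without a division by 2.\<close>
  define A where "A = {I \<in> perms ?m. pos I ?k < pos I (Suc ?k)}"
  define B where "B = {I \<in> perms ?m. pos I (Suc ?k) < pos I ?k}"
  have "perms ?m = A \<union> B"
  proof -
    have "pos I ?k \<noteq> pos I (Suc ?k)" if I: "I \<in> perms ?m" for I
    proof -
      have "?k \<in> set I" "Suc ?k \<in> set I" using permsD[OF I] by auto
      then obtain a b where "a < length I" "I ! a = ?k" "b < length I" "I ! b = Suc ?k"
        by (auto simp: in_set_conv_nth)
      moreover have "distinct I" using permsD[OF I] by simp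
      ultimately show ?thesis using pos[of I a ?k] pos[of I b "Suc ?k"] by auto
    qed
    then show ?thesis unfolding A_def B_def by force
  qed
  moreover have "A \<inter> B = {}" "finite A" "finite B" by (auto simp: A_def B_def)
  ultimately have "altsum G (xs @ x # x # zs) = sum ?f A + sum ?f B"
    unfolding altsum_def by (simp add: sum.union_disjoint)
  also have "sum ?f B = (\<Sum>I\<in>A. ?f (map ?t I))"
  proof (rule sum.reindex_bij_betw[symmetric])
    have "map ?t I \<in> perms ?m" if "I \<in> perms ?m" for I
      using bij_betwE[OF map_transpose_perms[of ?k ?m]] that by auto
    then show "bij_betw (map ?t) A B"
      by (intro bij_betwI[of _ _ _ "map ?t"]) (auto simp: comp_def A_def B_def pos_map)
  qed
  also have "\<dots> = (\<Sum>I\<in>A. - ?f I)"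
  proof (rule sum.cong)
    fix I assume "I \<in> A"
    then have I: "I \<in> perms ?m" by (simp add: A_def)
    then have "word_sign (map ?t I) = - (word_sign I :: 'b)"
      by (intro word_sign_transpose_values) (auto simp: perms_iff)
    moreover have "place (xs @ x # x # zs) (map ?t I) = place (xs @ x # x # zs) I"
      unfolding place_def using I nth_swap[of _ xs x x zs] by (auto simp: perms_iff)
    ultimately show "?f (map ?t I) = - ?f I" by simp
  qed simp
  also have "sum ?f A + \<dots> = 0" by (simp only: sum_negf right_minus)
  finally show ?thesis .
qed

lemma altsum_move:
  "altsum G (us @ xs @ x # zs) = (-1) ^ length xs *\<^sub>f altsum G (us @ x # xs @ zs)"
proof (induction xs arbitrary: us)
  case (Cons y xs)
  have "altsum G (us @ (y # xs) @ x # zs) = (-1) ^ length xs *\<^sub>f altsum G ((us @ [y]) @ x # xs @ zs)"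
    using Cons[of "us @ [y]"] by simp
  also have "altsum G ((us @ [y]) @ x # xs @ zs) = - altsum G (us @ x # y # xs @ zs)"
    using altsum_swap[of G us y x "xs @ zs"] by (simp only: append_assoc append_Cons append_Nil)
  finally show ?case
    by (simp only: fun_space.scale_minus_right length_Cons power_Suc append_Cons append_Nil
        mult_minus_left mult_1 fun_space.scale_minus_left append_assoc)
qed simp

lemma altsum_not_distinct:
  assumes "\<not> distinct a"
  shows "altsum G a = 0"
proof -
  obtain xs y ys zs where a: "a = xs @ [y] @ ys @ [y] @ zs"
    using not_distinct_decomp[OF assms] by blast
  have "altsum G a = (-1) ^ length ys *\<^sub>f altsum G ((xs @ [y]) @ y # ys @ zs)"
    using altsum_move[of G "xs @ [y]" ys y zs] by (simp add: a)
  also have "(xs @ [y]) @ y # ys @ zs = xs @ y # y # ys @ zs" by simp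
  finally show ?thesis by (simp only: altsum_adjacent_eq fun_space.scale_zero_right)
qed

text \<open>Adjacent transpositions generate all permutations: the first letter of \<open>a\<close>
  is bubbled to the front of \<open>b\<close>, and the induction continues behind it. This is why a
  fixed prefix \<open>pre\<close> is carried along.\<close>

lemma adjacent_swap_invariant_append:
  assumes "\<And>xs x y zs. f (xs @ x # y # zs) = f (xs @ y # x # zs)" and "mset a = mset b"
  shows "f (pre @ a) = f (pre @ b)"
  using assms(2)
proof (induction a arbitrary: pre b)
  case (Cons x a)
  then have "x \<in> set b" using mset_eq_setD[OF Cons.prems] by auto
  then obtain us vs where b: "b = us @ x # vs" by (auto simp: in_set_conv_decomp)
  have "f (pre @ us @ x # vs) = f (pre @ x # us @ vs)"
  proof (induction us arbitrary: pre)
    case (Cons u us)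
    then show ?case using Cons[of "pre @ [u]"] assms(1)[of pre u x "us @ vs"] by simp
  qed simp
  moreover have "f ((pre @ [x]) @ a) = f ((pre @ [x]) @ (us @ vs))"
    using Cons.IH[of "us @ vs" "pre @ [x]"] Cons.prems b by simp
  ultimately show ?case by (simp add: b)
qed simp

lemma adjacent_swap_invariant:
  assumes "\<And>xs x y zs. f (xs @ x # y # zs) = f (xs @ y # x # zs)" and "mset a = mset b"
  shows "f a = f b"
  using adjacent_swap_invariant_append[of f a b "[]"] assms by simp

lemma altsum_distinct_perm:
  assumes "distinct a" "mset a = mset b"
  shows "word_sign a *\<^sub>f altsum G a = word_sign b *\<^sub>f altsum G b"
proof -
  \<comment> \<open>On distinct words both factors change sign under a swap. The value 0 on the
    other words makes the invariance hold without side condition.\<close>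
  define f where "f = (\<lambda>u. if distinct u then word_sign u *\<^sub>f altsum G u else 0)"
  have "f a = f b"
  proof (rule adjacent_swap_invariant[OF _ assms(2)])
    show "f (xs @ x # y # zs) = f (xs @ y # x # zs)" for xs x y zs
    proof (cases "distinct (xs @ x # y # zs)")
      case True
      then have "distinct (xs @ y # x # zs)" by auto
      with True show ?thesis
        unfolding f_def altsum_swap[of G xs y x zs] word_sign_swap[OF True]
        by (simp only: if_True fun_space.scale_minus_right fun_space.scale_minus_left minus_minus)
    next
      case False
      then have "\<not> distinct (xs @ y # x # zs)" by auto
      with False show ?thesis unfolding f_def by (simp only: if_False)
    qed
  qed
  moreover have "distinct b" using assms mset_eq_imp_distinct_iff by blast
  ultimately show ?thesis using assms by (simp add: f_def)
qed

lemma altsum_sorted: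
  fixes G :: "nat list \<Rightarrow> 'x \<Rightarrow> 'k::field"
  assumes "finite A" "a \<in> permutations_of_set A"
  shows "altsum G a = word_sign a *\<^sub>f altsum G (sorted_list_of_set A)"
proof -
  have d: "distinct a" "distinct (sorted_list_of_set A)" "set a = set (sorted_list_of_set A)"
    using permutations_of_setD[OF assms(2)] assms(1) by simp_all
  then have m: "mset a = mset (sorted_list_of_set A)"
    by (metis set_eq_iff_mset_eq_distinct)
  have "word_sign a *\<^sub>f altsum G a = altsum G (sorted_list_of_set A)"
    unfolding altsum_distinct_perm[OF d(1) m, of G] by (simp add: word_sign_sorted)
  then have "word_sign a *\<^sub>f word_sign a *\<^sub>f altsum G a = word_sign a *\<^sub>f altsum G (sorted_list_of_set A)"
    by (rule arg_cong)
  then show ?thesis by (simp only: word_sign_square_scale)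
qed

lemma place_upt [simp]: "place a [0..<length a] = a"
  by (simp add: place_def map_nth)

lemma place_place: "set J \<subseteq> {..<length I} \<Longrightarrow> place (place a I) J = place a (place I J)"
  by (auto simp: place_def)

lemma place_zip:
  "length x = length y \<Longrightarrow> set I \<subseteq> {..<length x} \<Longrightarrow> place (zip x y) I = zip (place x I) (place y I)"
  by (auto simp: place_def zip_map_map zip_same_conv_map intro!: nth_equalityI)

lemma upt_perms: "[0..<m] \<in> perms m"
  by (auto simp: perms_iff)

text \<open>The letters of \<open>a\<close> may repeat, so \<open>altsum_distinct_perm\<close> is
  applied to the word \<open>I\<close> of positions, which is distinct, with \<open>G\<close>
  precomposed with \<open>place a\<close>.\<close>

lemma altsum_place:
  fixes G :: "'a list \<Rightarrow> 'x \<Rightarrow> 'k::field"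
  assumes I: "I \<in> perms (length a)"
  shows "altsum G (place a I) = word_sign I *\<^sub>f altsum G a"
proof -
  let ?H = "\<lambda>K. G (place a K)"
  have len: "length I = length a" using permsD[OF I] by simp
  have *: "altsum G (place a J) = altsum ?H J" if "J \<in> perms (length a)" for J
  proof -
    have "length J = length a" using permsD[OF that] by simp
    then show ?thesis unfolding altsum_def
      by (intro sum.cong) (auto simp: place_place perms_iff)
  qed
  have "mset I = mset [0..<length a]"
    by (rule iffD1[OF set_eq_iff_mset_eq_distinct]) (use permsD[OF I] in \<open>auto simp: atLeast_upt\<close>)
  then have "word_sign I *\<^sub>f altsum ?H I = word_sign [0..<length a] *\<^sub>f altsum ?H [0..<length a]"
    by (intro altsum_distinct_perm) (use permsD[OF I] in auto)
  also have "\<dots> = altsum G a"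
    using *[OF upt_perms] by (simp add: word_sign_sorted)
  finally have "word_sign I *\<^sub>f word_sign I *\<^sub>f altsum ?H I = word_sign I *\<^sub>f altsum G a"
    by (rule arg_cong)
  then show ?thesis unfolding *[OF I] by (simp only: word_sign_square_scale)
qed

lemma bij_betw_place_sorted:
  assumes "finite A"
  shows "bij_betw (place (sorted_list_of_set A)) (perms (card A)) (permutations_of_set A)"
proof -
  let ?s = "sorted_list_of_set A" and ?m = "card A"
  have inj: "inj_on ((!) ?s) {..<?m}"
    using assms by (auto simp: inj_on_def nth_eq_iff_index_eq)
  have im: "(!) ?s ` {..<?m} = A"
    using assms by (metis atLeast_upt list.set_map map_nth length_sorted_list_of_set set_sorted_list_of_set)
  have "permutations_of_set A = place ?s ` perms ?m"
    unfolding place_def perms_def using permutations_of_set_image_inj[OF inj] im by simp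
  moreover have "inj_on (place ?s) (perms ?m)"
    unfolding place_def by (rule inj_on_subset[OF inj_on_mapI]) (use inj in \<open>auto simp: perms_iff\<close>)
  ultimately show ?thesis by (simp add: bij_betw_def)
qed

text \<open>A strictly increasing list transports inversions of positions to inversions of letters.
  This links \<open>altsum\<close> to the antisymmetrization in \<open>ext_incl\<close>, whose signs
  are those of the letters.\<close>

lemma altsum_sorted_list_of_set:
  assumes "finite A"
  shows "altsum G (sorted_list_of_set A) = (\<Sum>I\<in>permutations_of_set A. word_sign I *\<^sub>f G I)"
proof -
  let ?s = "sorted_list_of_set A" and ?m = "card A"
  have "bij_betw (place ?s) (perms ?m) (permutations_of_set A)"
    by (rule bij_betw_place_sorted[OF assms])
  then have "(\<Sum>I\<in>permutations_of_set A. word_sign I *\<^sub>f G I) =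
    (\<Sum>I\<in>perms ?m. word_sign (place ?s I) *\<^sub>f G (place ?s I))"
    by (rule sum.reindex_bij_betw[symmetric])
  also have "\<dots> = altsum G ?s"
    unfolding altsum_def
  proof (rule sum.cong)
    fix I assume "I \<in> perms (length ?s)"
    then have I: "set I = {..<length ?s}" by (simp add: perms_iff)
    have "?s ! x < ?s ! y \<longleftrightarrow> x < y" if "x \<in> set I" "y \<in> set I" for x y
    proof -
      have sw: "sorted_wrt (<) ?s" using assms by simp
      have "x < length ?s" "y < length ?s" using that I by auto
      then show ?thesis using sw
        by (metis linorder_neqE_nat order_less_asym order_less_irrefl sorted_wrt_nth_less)
    qed
    then have "word_sign (place ?s I) = (word_sign I :: 'b)"
      unfolding place_def by (rule word_sign_map_mono)
    then show "word_sign (place ?s I) *\<^sub>f G (place ?s I) = word_sign I *\<^sub>f G (place ?s I)" by simp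
  qed simp
  finally show ?thesis by simp
qed

text \<open>Permutations are grouped by their first value \<open>t\<close>, which is larger than
  \<open>t\<close> later values and so contributes the sign \<open>(-1) ^ t\<close>; the remaining
  values form a permutation of one letter less once the gap at \<open>t\<close> is closed.\<close>

lemma altsum_laplace:
  fixes G :: "'a list \<Rightarrow> 'x \<Rightarrow> 'k::field"
  shows "altsum G a = (if a = [] then G [] else
    (\<Sum>t<length a. (-1) ^ t *\<^sub>f altsum (\<lambda>u. G (a ! t # u)) (take t a @ drop (Suc t) a)))"
proof (cases a)
  case (Cons a0 as)
  define m where "m = length as"
  have len: "length a = Suc m" by (simp add: Cons m_def)
  \<comment> \<open>The increasing map that reopens the gap at \<open>t\<close>.\<close>
  define sh where "sh = (\<lambda>t s :: nat. if s < t then s else Suc s)"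
  have sh_less: "sh t x < sh t y \<longleftrightarrow> x < y" for t x y by (auto simp: sh_def)
  have sh_im: "sh t ` {..<m} = {..<Suc m} - {t}" if "t < Suc m" for t
  proof (intro set_eqI iffI)
    fix y assume "y \<in> {..<Suc m} - {t}"
    then have "y = sh t (if y < t then y else y - 1) \<and> (if y < t then y else y - 1) < m"
      using that by (auto simp: sh_def)
    then show "y \<in> sh t ` {..<m}" by blast
  qed (use that in \<open>auto simp: sh_def\<close>)
  have inj_sh: "inj (sh t)" for t by (rule injI) (metis sh_less linorder_neqE_nat order_less_irrefl)
  have "bij_betw (\<lambda>(t, J). t # map (sh t) J) ({..<Suc m} \<times> perms m) (perms (Suc m))"
    unfolding bij_betw_def
  proof
    show "inj_on (\<lambda>(t, J). t # map (sh t) J) ({..<Suc m} \<times> perms m)"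
      using inj_mapI[OF inj_sh] by (auto simp: inj_on_def)
    show "(\<lambda>(t, J). t # map (sh t) J) ` ({..<Suc m} \<times> perms m) = perms (Suc m)"
    proof (intro set_eqI iffI)
      fix I assume "I \<in> perms (Suc m)"
      then have "I \<in> permutations_of_set {..<Suc m}" "set I = {..<Suc m}"
        using permsD by (simp_all add: perms_def)
      then obtain t I' where I': "I = t # I'" "t < Suc m" "I' \<in> permutations_of_set ({..<Suc m} - {t})"
        by (subst (asm) permutations_of_set_nonempty) auto
      then have "I' \<in> map (sh t) ` perms m"
        unfolding perms_def sh_im[OF I'(2), symmetric]
        using permutations_of_set_image_inj[OF inj_on_subset[OF inj_sh subset_UNIV]] by simp
      then show "I \<in> (\<lambda>(t, J). t # map (sh t) J) ` ({..<Suc m} \<times> perms m)"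
        using I' by auto
    next
      fix I assume "I \<in> (\<lambda>(t, J). t # map (sh t) J) ` ({..<Suc m} \<times> perms m)"
      then obtain t J where tJ: "I = t # map (sh t) J" "t < Suc m" "J \<in> perms m" by auto
      have "distinct (map (sh t) J)"
        using permsD[OF tJ(3)] inj_on_subset[OF inj_sh subset_UNIV] by (simp add: distinct_map)
      moreover have "set (map (sh t) J) = {..<Suc m} - {t}"
        using permsD[OF tJ(3)] sh_im[OF tJ(2)] by simp
      ultimately show "I \<in> perms (Suc m)" unfolding tJ(1) perms_iff using tJ(2) by auto
    qed
  qed
  then have "altsum G a =
    (\<Sum>(t, J)\<in>{..<Suc m} \<times> perms m. word_sign (t # map (sh t) J) *\<^sub>f G (place a (t # map (sh t) J)))"
    unfolding altsum_def len by (subst sum.reindex_bij_betw[symmetric]) (auto simp: case_prod_unfold)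
  also have "\<dots> = (\<Sum>t<Suc m. \<Sum>J\<in>perms m. (-1) ^ t *\<^sub>f word_sign J *\<^sub>f G (a ! t # place (take t a @ drop (Suc t) a) J))"
    unfolding sum.cartesian_product[symmetric]
  proof (intro sum.cong refl)
    fix t J assume t: "t \<in> {..<Suc m}" and J: "J \<in> perms m"
    have "distinct (map (sh t) J)"
      using permsD[OF J] inj_on_subset[OF inj_sh subset_UNIV] by (simp add: distinct_map)
    moreover have "{y \<in> set (map (sh t) J). y < t} = {..<t}"
      using permsD[OF J] sh_im[of t] t by auto
    ultimately have "word_sign (t # map (sh t) J) = (-1) ^ t * (word_sign J :: 'k)"
      by (simp add: word_sign_Cons_distinct word_sign_map_mono sh_less del: set_map)
    moreover have "place a (t # map (sh t) J) = a ! t # place (take t a @ drop (Suc t) a) J"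
      using permsD[OF J] t len by (auto simp: place_def sh_def nth_append)
    ultimately show "word_sign (t # map (sh t) J) *\<^sub>f G (place a (t # map (sh t) J)) =
      (-1) ^ t *\<^sub>f word_sign J *\<^sub>f G (a ! t # place (take t a @ drop (Suc t) a) J)"
      by simp
  qed
  also have "\<dots> = (\<Sum>t<length a. (-1) ^ t *\<^sub>f altsum (\<lambda>u. G (a ! t # u)) (take t a @ drop (Suc t) a))"
    unfolding len
  proof (intro sum.cong refl)
    fix t assume "t \<in> {..<Suc m}"
    then have "length (take t a @ drop (Suc t) a) = m" by (auto simp: len)
    then show "(\<Sum>J\<in>perms m. (-1) ^ t *\<^sub>f word_sign J *\<^sub>f G (a ! t # place (take t a @ drop (Suc t) a) J)) =
      (-1) ^ t *\<^sub>f altsum (\<lambda>u. G (a ! t # u)) (take t a @ drop (Suc t) a)"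
      unfolding altsum_def by (simp only: fun_space.scale_sum_right)
  qed
  finally show ?thesis using Cons by simp
qed simp

text \<open>Here two arguments of \<open>G\<close> are exchanged, not two letters of
  \<open>a\<close>: the permutation is composed with the transposition on the other side than in
  \<open>altsum_swap\<close>.\<close>

lemma altsum_swap_first:
  fixes G :: "'a list \<Rightarrow> 'x \<Rightarrow> 'k::field"
  assumes "2 \<le> length a" "\<And>x y zs. H (x # y # zs) = G (y # x # zs)"
  shows "altsum H a = - altsum G a"
proof -
  let ?m = "length a"
  define sw :: "nat list \<Rightarrow> nat list" where "sw = (\<lambda>I. I ! 1 # I ! 0 # drop 2 I)"
  have ex: "\<exists>x y zs. I = x # y # zs" if "I \<in> perms ?m" for I
    using permsD[OF that] assms(1) by (cases I; cases "tl I") auto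
  have "bij_betw sw (perms ?m) (perms ?m)"
  proof (rule bij_betwI[of _ _ _ sw])
    have "sw I \<in> perms ?m \<and> sw (sw I) = I" if I: "I \<in> perms ?m" for I
    proof -
      obtain x y zs where xy: "I = x # y # zs" using ex[OF I] by blast
      have "distinct (y # x # zs)" "set (y # x # zs) = set I" using permsD[OF I] xy by auto
      then have "y # x # zs \<in> perms ?m" using permsD[OF I] unfolding perms_iff by metis
      then show ?thesis by (simp add: sw_def xy)
    qed
    then show "sw \<in> perms ?m \<rightarrow> perms ?m" "sw \<in> perms ?m \<rightarrow> perms ?m"
      "\<And>I. I \<in> perms ?m \<Longrightarrow> sw (sw I) = I" "\<And>I. I \<in> perms ?m \<Longrightarrow> sw (sw I) = I" by auto
  qed
  then have "altsum H a = (\<Sum>I\<in>perms ?m. word_sign (sw I) *\<^sub>f H (place a (sw I)))"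
    unfolding altsum_def by (rule sum.reindex_bij_betw[symmetric])
  also have "\<dots> = (\<Sum>I\<in>perms ?m. - (word_sign I *\<^sub>f G (place a I)))"
  proof (rule sum.cong)
    fix I assume I: "I \<in> perms ?m"
    then obtain x y zs where xy: "I = x # y # zs" using ex by blast
    have "word_sign (y # x # zs) = - (word_sign (x # y # zs) :: 'k)"
      using word_sign_swap[of "[]" x y zs] permsD[OF I] xy by auto
    then show "word_sign (sw I) *\<^sub>f H (place a (sw I)) = - (word_sign I *\<^sub>f G (place a I))"
      by (simp only: xy sw_def place_def list.map assms(2) nth_Cons_0 One_nat_def nth_Cons_Suc
        numeral_2_eq_2 drop_Suc_Cons drop_0 fun_space.scale_minus_left)
  qed simp
  also have "\<dots> = - altsum G a" by (simp only: sum_negf altsum_def)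
  finally show ?thesis .
qed

section \<open>Inverse permutations in one-line notation\<close>

definition inv_word :: "nat list \<Rightarrow> nat list"
  where "inv_word I = map (\<lambda>v. THE i. i < length I \<and> I ! i = v) [0..<length I]"

lemma inv_word:
  assumes I: "I \<in> perms m"
  shows inv_word_nth: "i < m \<Longrightarrow> inv_word I ! (I ! i) = i"
    and inv_word_perms: "inv_word I \<in> perms m"
    and nth_inv_word: "i < m \<Longrightarrow> I ! (inv_word I ! i) = i"
proof -
  have d: "distinct I" "set I = {..<m}" "length I = m" using permsD[OF I] by auto
  have lt: "I ! i < m" if "i < m" for i using d that by (metis lessThan_iff nth_mem)
  show *: "inv_word I ! (I ! i) = i" if "i < m" for i
  proof -
    have "(THE j. j < length I \<and> I ! j = I ! i) = i"
      by (rule the_equality) (use d(1,3) that in \<open>auto simp: nth_eq_iff_index_eq\<close>)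
    then show ?thesis using lt[OF that] by (simp add: inv_word_def d(3))
  qed
  have len: "length (inv_word I) = m" by (simp add: inv_word_def d(3))
  have "{..<m} \<subseteq> set (inv_word I)"
  proof
    fix i assume "i \<in> {..<m}"
    then have "inv_word I ! (I ! i) = i" "I ! i < length (inv_word I)" using * lt len by auto
    then show "i \<in> set (inv_word I)" by (metis nth_mem)
  qed
  moreover have "card (set (inv_word I)) \<le> m" using card_length[of "inv_word I"] len by simp
  ultimately have s: "set (inv_word I) = {..<m}"
    by (metis card_lessThan card_seteq finite_set)
  then have "distinct (inv_word I)" by (intro card_distinct) (simp add: len)
  then show "inv_word I \<in> perms m" using s by (simp add: perms_iff)
  show "I ! (inv_word I ! i) = i" if "i < m" for i
  proof -
    have "i \<in> set I" using that unfolding d(2) by simp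
    then obtain j where "j < m" "I ! j = i" unfolding in_set_conv_nth d(3) by blast
    then show ?thesis using * by auto
  qed
qed

lemma inv_word_inv_word: "I \<in> perms m \<Longrightarrow> inv_word (inv_word I) = I"
proof (rule nth_equalityI)
  assume I: "I \<in> perms m"
  note p = inv_word_perms[OF I] inv_word_perms[OF inv_word_perms[OF I]]
  show "length (inv_word (inv_word I)) = length I" using permsD[OF p(2)] permsD[OF I] by simp
  fix i assume "i < length (inv_word (inv_word I))"
  then have "i < m" using permsD[OF p(2)] by simp
  then have "I ! i < m" using nth_mem[of i I] permsD[OF I] by auto
  have "inv_word (inv_word I) ! (inv_word I ! (I ! i)) = I ! i"
    by (rule inv_word_nth[OF p(1)]) fact
  then show "inv_word (inv_word I) ! i = I ! i" using inv_word_nth[OF I \<open>i < m\<close>] by simp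
qed

text \<open>An inversion of a permutation, read as a pair of values instead of positions, is an
  inversion of its inverse.\<close>

lemma word_sign_inv_word:
  assumes I: "I \<in> perms m"
  shows "word_sign (inv_word I) = word_sign I"
proof -
  let ?J = "inv_word I"
  have d: "length I = m" "set I = {..<m}" "length ?J = m" "set ?J = {..<m}"
    using permsD[OF I] permsD[OF inv_word_perms[OF I]] by auto
  have lt: "I ! i < m" "?J ! i < m" if "i < m" for i
    using that d by (metis lessThan_iff nth_mem)+
  have "bij_betw (\<lambda>(i, j). (I ! j, I ! i)) {(i, j). i < j \<and> j < length I \<and> I ! j < I ! i}
    {(i, j). i < j \<and> j < length ?J \<and> ?J ! j < ?J ! i}"
    by (rule bij_betwI[of _ _ _ "\<lambda>(i, j). (?J ! j, ?J ! i)"])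
      (auto simp: d(1,3) inv_word_nth[OF I] nth_inv_word[OF I] lt)
  from bij_betw_same_card[OF this] show ?thesis by (simp add: word_sign_def)
qed

text \<open>A multiset of pairs does not change when both words are rearranged by the inverse
  permutation. The lemma is behind the transposition symmetry of minors.\<close>

lemma zip_place_inv_word:
  assumes "I \<in> perms m" "length x = m" "length y = m"
  shows "mset (zip (place x I) y) = mset (zip x (place y (inv_word I)))"
proof -
  let ?J = "inv_word I"
  have d: "length I = m" "?J \<in> perms m" "set ?J = {..<m}"
    using permsD[OF assms(1)] inv_word_perms[OF assms(1)] permsD by auto
  have "place I ?J = [0..<m]"
    by (rule nth_equalityI) (use d(1) permsD[OF d(2), THEN conjunct2, THEN conjunct2] nth_inv_word[OF assms(1)] in \<open>simp_all add: place_def\<close>)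
  moreover have "place (place x I) ?J = place x (place I ?J)"
    by (rule place_place) (simp add: d(1,3))
  ultimately have "place (place x I) ?J = x" using assms(2) by (metis place_upt)
  moreover have "place (zip (place x I) y) ?J = zip (place (place x I) ?J) (place y ?J)"
    by (rule place_zip) (simp_all add: d(1,3) assms)
  moreover have "mset (place (zip (place x I) y) ?J) = mset (zip (place x I) y)"
    by (rule mset_place) (simp add: d(1,2) assms)
  ultimately show ?thesis by metis
qed

section \<open>Monomials\<close>

text \<open>Monomials are handled as multisets of variables, so that the product of the variables
  along two words becomes \<open>mset (zip I J)\<close>.\<close>

definition mm :: "(nat \<times> nat) multiset \<Rightarrow> mono"
  where "mm Z = (\<Sum>x\<in>#Z. mono_var x)"

lemma mm_empty [simp]: "mm {#} = 0"
  and mm_add: "mm (Y + Z) = mm Y + mm Z"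
  and mm_add_mset: "mm (add_mset x Z) = mono_var x + mm Z"
  by (simp_all add: mm_def)

lemma lookup_mm [simp]: "Poly_Mapping.lookup (mm Z) x = count Z x"
  by (induction Z) (auto simp: mm_add_mset lookup_add mono_var_def lookup_single when_def)

lemma mm_eq_iff [simp]: "mm Y = mm Z \<longleftrightarrow> Y = Z"
  by (metis lookup_mm multiset_eqI)

lemma ex_mm: "\<exists>Z. \<alpha> = mm Z"
proof -
  let ?Z = "\<Sum>x\<in>Poly_Mapping.keys \<alpha>. replicate_mset (Poly_Mapping.lookup \<alpha> x) x"
  have *: "Poly_Mapping.lookup \<alpha> x = count ?Z x" for x
    by (auto simp: count_sum sum.delta in_keys_iff split: if_splits)
  have "\<alpha> = mm ?Z" by (rule poly_mapping_eqI, subst lookup_mm) (rule *)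
  then show ?thesis ..
qed

lemma keys_mm [simp]: "Poly_Mapping.keys (mm Z) = set_mset Z"
  by (auto simp: in_keys_iff)

lemma mono_deg_mm [simp]: "mono_deg (mm Z) = size Z"
  by (simp add: mono_deg_def size_multiset_overloaded_eq)

lemma mm_in_monomials [simp]:
  "mm Z \<in> monomials e n m \<longleftrightarrow> set_mset Z \<subseteq> {..<n} \<times> {..<m} \<and> size Z = e"
  by (simp add: monomials_def)

lemma monomials_eq: "monomials e n m = mm ` {Z. set_mset Z \<subseteq> {..<n} \<times> {..<m} \<and> size Z = e}"
proof (intro set_eqI)
  fix \<alpha>
  obtain Z where "\<alpha> = mm Z" using ex_mm by blast
  then show "\<alpha> \<in> monomials e n m \<longleftrightarrow> \<alpha> \<in> mm ` {Z. set_mset Z \<subseteq> {..<n} \<times> {..<m} \<and> size Z = e}"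
    by (auto simp: image_iff)
qed

lemma mono_transpose_mm [simp]: "mono_transpose (mm Z) = mm (image_mset prod.swap Z)"
proof (rule poly_mapping_eqI)
  fix x
  have "count (image_mset prod.swap Z) x = count Z (prod.swap x)"
    by (induction Z) auto
  then show "Poly_Mapping.lookup (mono_transpose (mm Z)) x = Poly_Mapping.lookup (mm (image_mset prod.swap Z)) x"
    by (simp add: mono_transpose_def map_key.rep_eq)
qed

lemma mset_zip_swap: "image_mset prod.swap (mset (zip I J)) = mset (zip J I)"
  by (induction I J rule: list_induct2') auto

lemma image_mset_swap_eq_iff: "image_mset prod.swap Y = Z \<longleftrightarrow> Y = image_mset prod.swap Z"
  by (auto simp: multiset.map_comp)

lemma word_mono_eq:
  "length I = length J \<Longrightarrow> word_mono I J = (Poly_Mapping.single (mm (mset (zip I J))) 1 :: 'k::field mpoly)"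
proof (induction I J rule: list_induct2)
  case (Cons x I y J)
  have "word_mono (x # I) (y # J) = (var (x, y) * word_mono I J :: 'k mpoly)"
    by (simp add: word_mono_def prod.lessThan_Suc_shift del: prod.lessThan_Suc)
  then show ?case using Cons by (simp add: var_def mult_single mm_add_mset)
qed (simp add: word_mono_def)

section \<open>Words, and the coefficients of a monomial in the entries of a matrix product\<close>

definition words :: "nat \<Rightarrow> nat \<Rightarrow> nat list set"
  where "words e n = {J. length J = e \<and> set J \<subseteq> {..<n}}"

lemma finite_words [simp]: "finite (words e n)"
proof -
  have "words e n = {J. set J \<subseteq> {..<n} \<and> length J = e}" by (auto simp: words_def)
  then show ?thesis by (simp add: finite_lists_length_eq)
qed

lemma words_0 [simp]: "words 0 n = {[]}"
  by (auto simp: words_def)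

lemma words_Suc: "words (Suc e) n = (\<lambda>(x, J). x # J) ` ({..<n} \<times> words e n)"
  by (auto simp: words_def length_Suc_conv image_iff)

lemma sum_words_Suc: "(\<Sum>J\<in>words (Suc e) n. f J) = (\<Sum>x<n. \<Sum>J\<in>words e n. f (x # J))"
  unfolding words_Suc
  by (subst sum.reindex) (auto simp: inj_on_def sum.cartesian_product case_prod_unfold)

lemma wordsD: "J \<in> words e n \<Longrightarrow> length J = e" "J \<in> words e n \<Longrightarrow> x \<in> set J \<Longrightarrow> x < n"
  by (auto simp: words_def)

lemma mset_zip_monomials:
  assumes "I \<in> words e n" "J \<in> words e m"
  shows "set_mset (mset (zip I J)) \<subseteq> {..<n} \<times> {..<m} \<and> size (mset (zip I J)) = e"
  using assms by (auto simp: words_def dest: set_zip_leftD set_zip_rightD)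

lemma ex_words_zip:
  assumes "set_mset Z \<subseteq> {..<n} \<times> {..<m}" "size Z = e"
  obtains I J where "I \<in> words e n" "J \<in> words e m" "Z = mset (zip I J)"
proof -
  obtain zs where zs: "Z = mset zs" using ex_mset by metis
  show ?thesis
  proof (rule that)
    show "Z = mset (zip (map fst zs) (map snd zs))" by (simp add: zs zip_map_fst_snd)
    show "map fst zs \<in> words e n" "map snd zs \<in> words e m"
      using assms by (auto simp: zs words_def)
  qed
qed

text \<open>Expanding the product of sums chooses one intermediate index for each factor; the
  choices form a word \<open>J\<close>, and the two monomials are those of the pairs it forms with
  \<open>I\<close> and with \<open>K\<close>.\<close>

lemma mono_of_product_zip:
  assumes "length I = length K"
  shows "mono_of_product n (mm (mset (zip I K))) =
    (\<Sum>J\<in>words (length I) n. Poly_Mapping.single (mm (mset (zip I J))) (Poly_Mapping.single (mm (mset (zip J K))) 1))"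
proof -
  let ?f = "\<lambda>x. \<Sum>l<n. var (fst x, l) * Poly_Mapping.single 0 (var (l, snd x)) :: 'a mpoly mpoly"
  have "mono_of_product n (mm (mset (zip I K))) = prod_mset (image_mset ?f (mset (zip I K)))"
    by (simp add: mono_of_product_def image_prod_mset_multiplicity)
  also have "\<dots> = (\<Sum>J\<in>words (length I) n.
    Poly_Mapping.single (mm (mset (zip I J))) (Poly_Mapping.single (mm (mset (zip J K))) 1))"
    using assms
  proof (induction I K rule: list_induct2)
    case (Cons x I z K)
    have "prod_mset (image_mset ?f (mset (zip (x # I) (z # K)))) = ?f (x, z) *
      (\<Sum>J\<in>words (length I) n. Poly_Mapping.single (mm (mset (zip I J))) (Poly_Mapping.single (mm (mset (zip J K))) 1))"
      using Cons by simp
    also have "\<dots> = (\<Sum>l<n. \<Sum>J\<in>words (length I) n.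
      Poly_Mapping.single (mm (mset (zip (x # I) (l # J)))) (Poly_Mapping.single (mm (mset (zip (l # J) (z # K)))) 1))"
      by (simp add: sum_product var_def mult_single mm_add_mset)
    finally show ?case by (simp add: sum_words_Suc)
  qed simp
  finally show ?thesis .
qed

lemma lookup_mono_of_product:
  assumes "I \<in> words e q" "K \<in> words e m"
  shows "Poly_Mapping.lookup (Poly_Mapping.lookup (mono_of_product n (mm (mset (zip I K)))) (mm Y)) (mm X) =
    (\<Sum>J\<in>words e n. if mset (zip I J) = Y \<and> mset (zip J K) = X then 1 else 0 :: 'k::field)"
  using assms
  by (auto simp: mono_of_product_zip wordsD lookup_sum lookup_single when_def intro!: sum.cong)

section \<open>Linear maps between function spaces\<close>

interpretation fun_pair: vector_space_pair
  "fscale :: 'k::field \<Rightarrow> ('x \<Rightarrow> 'k) \<Rightarrow> 'x \<Rightarrow> 'k" "fscale :: 'k::field \<Rightarrow> ('y \<Rightarrow> 'k) \<Rightarrow> 'y \<Rightarrow> 'k"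
  by unfold_locales

abbreviation flinear :: "(('x \<Rightarrow> 'k::field) \<Rightarrow> 'y \<Rightarrow> 'k) \<Rightarrow> bool"
  where "flinear \<equiv> module_hom fscale fscale"

lemma flinearI: "(\<And>x y. f (x + y) = f x + f y) \<Longrightarrow> (\<And>c x. f (c *\<^sub>f x) = c *\<^sub>f f x) \<Longrightarrow> flinear f"
  by unfold_locales auto

lemmas flinear_add = module_hom.add
  and flinear_scale = module_hom.scale
  and flinear_sum = module_hom.sum
  and flinear_zero = module_hom.zero
  and flinear_diff = module_hom.diff
  and flinear_neg = module_hom.neg

lemma flinear_combination:
  "flinear (\<lambda>v :: 'x \<Rightarrow> 'k::field. \<Sum>s\<in>S. v (g s) *\<^sub>f w s)"
  by (rule flinearI) (simp_all add: distrib_right sum.distrib fscale_def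
      fun_eq_iff fscale_sum_apply sum_distrib_left mult.assoc)

lemma linear_between_flinear:
  "flinear f \<Longrightarrow> (\<And>v. v \<in> V \<Longrightarrow> f v \<in> W) \<Longrightarrow> linear_between V W f"
  by (auto simp: linear_between_def flinear_add flinear_scale)

definition supported :: "'x set \<Rightarrow> ('x \<Rightarrow> 'k::field) set"
  where "supported X = {v. \<forall>I. I \<notin> X \<longrightarrow> v I = 0}"

lemma supported_expand:
  assumes "finite X" "v \<in> supported X"
  shows "v = (\<Sum>I\<in>X. v I *\<^sub>f unit_vec I)"
  using assms by (auto simp: supported_def fun_eq_iff fscale_sum_apply fscale_def unit_vec_def if_distrib cong: if_cong)

lemma unit_vec_supported: "I \<in> X \<Longrightarrow> unit_vec I \<in> supported X"
  by (auto simp: supported_def unit_vec_def)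

lemma subspace_supported: "fun_space.subspace (supported X)"
  by (auto simp: fun_space.subspace_def supported_def fscale_def)

lemma supported_eq_span:
  assumes "finite X"
  shows "(supported X :: ('x \<Rightarrow> 'k::field) set) = fun_space.span (unit_vec ` X)"
proof
  show "fun_space.span (unit_vec ` X) \<subseteq> (supported X :: ('x \<Rightarrow> 'k) set)"
    by (rule fun_space.span_minimal) (auto simp: unit_vec_supported subspace_supported)
  show "(supported X :: ('x \<Rightarrow> 'k) set) \<subseteq> fun_space.span (unit_vec ` X)"
  proof
    fix v :: "'x \<Rightarrow> 'k" assume "v \<in> supported X"
    note eq = supported_expand[OF assms this]
    show "v \<in> fun_space.span (unit_vec ` X)"
      by (subst eq) (intro fun_space.span_sum fun_space.span_scale fun_space.span_base, simp)
  qed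
qed

lemma fin_dim_supported: "finite X \<Longrightarrow> fin_dim (supported X)"
  unfolding fin_dim_def using supported_eq_span by blast

lemma flinear_eq_on_span:
  assumes "flinear f" "flinear g" "\<And>x. x \<in> B \<Longrightarrow> f x = g x" "x \<in> fun_space.span B"
  shows "f x = g x"
  by (rule module_pair.module_hom_eq_on_span[OF fun_pair.module_pair_axioms assms])

lemma flinear_image_span: "flinear f \<Longrightarrow> f ` fun_space.span B = fun_space.span (f ` B)"
  by (rule module_hom.span_image[symmetric])

lemma fin_dim_span: "finite B \<Longrightarrow> fin_dim (fun_space.span B)"
  by (auto simp: fin_dim_def)

lemma fin_dim_subspace:
  assumes "fin_dim W" "fun_space.subspace V" "V \<subseteq> W"
  shows "fin_dim V"
proof -
  obtain B where B: "finite B" "W = fun_space.span B" using assms by (auto simp: fin_dim_def)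
  obtain C where C: "C \<subseteq> V" "fun_space.independent C" "V \<subseteq> fun_space.span C"
    using fun_space.maximal_independent_subset[of V] by blast
  then have "finite C" using fun_space.independent_span_bound[OF B(1) C(2)] B assms by auto
  moreover have "V = fun_space.span C"
    using C assms(2) by (simp add: fun_space.span_minimal subset_antisym)
  ultimately show ?thesis by (auto simp: fin_dim_def)
qed

section \<open>The functors \<open>S\<^sup>r \<otimes> I\<^sup>i\<close>\<close>

text \<open>Words name the basis of the symmetric power tensored with copies of the identity functor
  redundantly: the first \<open>r\<close> letters commute, the others keep their places.\<close>

definition lab :: "nat \<Rightarrow> nat list \<Rightarrow> nat multiset list"
  where "lab r J = mset (take r J) # map (\<lambda>x. {#x#}) (drop r J)"

text \<open>The identity functor appears as the first symmetric power, because the conjugate of a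
  hook is a hook and \<open>sym_tensor\<close> of it is the target of the Schur map.\<close>

abbreviation symb :: "nat \<Rightarrow> nat \<Rightarrow> (nat multiset list, 'k::field) based"
  where "symb r i \<equiv> sym_tensor (r # replicate i (Suc 0))"

definition symf :: "nat \<Rightarrow> nat \<Rightarrow> (nat multiset list, 'k::field) spf"
  where "symf r i = spf_of (symb r i)"

lemma inj_map_single [simp]: "map (\<lambda>x. {#x#}) c = map (\<lambda>x. {#x#}) d \<longleftrightarrow> c = d"
  by (rule inj_map_eq_map) (auto simp: inj_def)

lemma lab_eq_iff: "lab r I = lab r J \<longleftrightarrow> mset (take r I) = mset (take r J) \<and> drop r I = drop r J"
  by (simp add: lab_def)

lemma idx_symmetric_power_1: "M \<in> idx (symmetric_power (Suc 0)) n \<longleftrightarrow> (\<exists>x<n. M = {#x#})"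
  by (auto simp: symmetric_power_def dest!: size_1_singleton_mset[unfolded One_nat_def])

lemma idx_symb: "idx (symb r i :: (_, 'k::field) based) n = lab r ` words (r + i) n"
proof (intro set_eqI iffI)
  fix L assume "L \<in> idx (symb r i :: (_, 'k) based) n"
  then obtain M Ms where L: "L = M # Ms" "M \<in> idx (symmetric_power r :: (_, 'k) based) n"
    "list_all2 (\<lambda>I C. I \<in> idx C n) Ms (replicate i (symmetric_power (Suc 0) :: (_, 'k) based))"
    by (auto simp: sym_tensor_def tensor_based_def list_all2_Cons2)
  then have Ms: "length Ms = i" "\<forall>N\<in>set Ms. \<exists>x<n. N = {#x#}"
    by (auto simp: list_all2_conv_all_nth in_set_conv_nth idx_symmetric_power_1)
  then obtain c where c: "Ms = map (\<lambda>x. {#x#}) c" using ex_map_conv[of Ms "\<lambda>x. {#x#}"] by blast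
  obtain b where b: "mset b = M" using ex_mset by blast
  then have "length b = r" "set b \<subseteq> {..<n}" using L(2) by (auto simp: symmetric_power_def)
  moreover have "length c = i" "set c \<subseteq> {..<n}" using Ms c by auto
  ultimately have "b @ c \<in> words (r + i) n" "L = lab r (b @ c)"
    using b c L(1) by (auto simp: words_def lab_def)
  then show "L \<in> lab r ` words (r + i) n" by blast
next
  fix L assume "L \<in> lab r ` words (r + i) n"
  then obtain J where "length J = r + i" "set J \<subseteq> {..<n}" "L = lab r J" by (auto simp: words_def)
  then show "L \<in> idx (symb r i :: (_, 'k) based) n"
    using set_take_subset[of r J] set_drop_subset[of r J]
    by (auto simp: sym_tensor_def tensor_based_def lab_def symmetric_power_def list_all2_conv_all_nth
        nth_Cons less_Suc_eq_0_disj subset_iff split: nat.split)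
qed

lemma finite_idx_symb [simp]: "finite (idx (symb r i) n)"
  by (simp add: idx_symb)

lemma val_symf: "val (symf r i :: (_, 'k::field) spf) n = supported (idx (symb r i :: (_, 'k) based) n)"
  by (simp add: symf_def spf_of_def supported_def)

lemma ex_place:
  assumes "mset x = mset y"
  obtains P where "P \<in> perms (length x)" "place x P = y"
proof -
  obtain p where p: "p permutes {..<length x}" "permute_list p x = y"
    using mset_eq_permutation[of y x] assms by metis
  let ?P = "map p [0..<length x]"
  have "?P \<in> perms (length x)"
    using p permutes_image[OF p(1)] permutes_inj_on[OF p(1)] by (auto simp: perms_iff distinct_map atLeast0LessThan)
  moreover have "place x ?P = y" using p(2) by (simp add: place_def permute_list_def comp_def)
  ultimately show ?thesis by (rule that)
qed

lemma place_inv_word: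
  assumes "P \<in> perms (length b)"
  shows "place (place b P) (inv_word P) = b" "place (place b (inv_word P)) P = b"
proof -
  let ?m = "length b"
  have *: "place (place b P) Q = b" if P: "P \<in> perms ?m" "Q \<in> perms ?m" "place P Q = [0..<?m]" for P Q
  proof -
    have "place (place b P) Q = place b (place P Q)"
      by (rule place_place) (use permsD[OF P(1)] permsD[OF P(2)] in simp)
    then show ?thesis by (simp add: P(3))
  qed
  note p = inv_word_perms[OF assms]
  have "place P (inv_word P) = [0..<?m]" "place (inv_word P) P = [0..<?m]"
    by (rule nth_equalityI;
        use permsD[OF assms] permsD[OF p] in \<open>simp add: place_def nth_inv_word[OF assms] inv_word_nth[OF assms]\<close>)+
  then show "place (place b P) (inv_word P) = b" "place (place b (inv_word P)) P = b"
    using * assms p by blast+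
qed

lemma mset_zip_place:
  assumes "P \<in> perms (length x)" "length x = length y"
  shows "mset (zip (place x P) (place y P)) = mset (zip x y)"
proof -
  have "place (zip x y) P = zip (place x P) (place y P)"
    by (rule place_zip) (use assms permsD[OF assms(1)] in simp_all)
  then show ?thesis using mset_place[of P "zip x y"] assms by simp
qed

lemma bij_betw_place:
  assumes "P \<in> perms m" "\<And>b. b \<in> S \<Longrightarrow> length b = m \<and> place b P \<in> T"
    "\<And>b. b \<in> T \<Longrightarrow> length b = m \<and> place b (inv_word P) \<in> S"
  shows "bij_betw (\<lambda>b. place b P) S T"
proof (rule bij_betwI[of _ _ _ "\<lambda>b. place b (inv_word P)"])
  show "place (place b P) (inv_word P) = b" if "b \<in> S" for b
    using assms(1,2) that by (intro place_inv_word) auto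
  show "place (place b (inv_word P)) P = b" if "b \<in> T" for b
    using assms(1,3) that by (intro place_inv_word) auto
qed (use assms in auto)

text \<open>The definition of \<open>symmetric_power\<close> lists the source multiset in sorted
  order. Rearranging \<open>I\<close> together with \<open>b\<close> shows that every other listing
  gives the same entry.\<close>

lemma sum_permutations_word_mono:
  assumes "mset b = mset b'" "size A = length b"
  shows "(\<Sum>I\<in>permutations_of_multiset A. word_mono I b) = (\<Sum>I\<in>permutations_of_multiset A. word_mono I b')"
proof -
  obtain P where P: "P \<in> perms (length b)" "place b P = b'" using ex_place[OF assms(1)] by blast
  have len: "length I = length b" if "I \<in> permutations_of_multiset A" for I
    using that assms(2) by (auto dest!: permutations_of_multisetD)
  have "(\<Sum>I\<in>permutations_of_multiset A. word_mono I b') =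
    (\<Sum>I\<in>permutations_of_multiset A. word_mono (place I P) b' :: 'a mpoly)"
  proof (rule sum.reindex_bij_betw[symmetric], rule bij_betw_place[OF P(1)])
    fix I assume I: "I \<in> permutations_of_multiset A"
    show "length I = length b \<and> place I P \<in> permutations_of_multiset A"
      using len[OF I] mset_place[of P I] P permutations_of_multisetD[OF I]
      by (auto intro: permutations_of_multisetI)
    show "length I = length b \<and> place I (inv_word P) \<in> permutations_of_multiset A"
      using len[OF I] mset_place[of "inv_word P" I] inv_word_perms[OF P(1)] permutations_of_multisetD[OF I]
      by (auto intro: permutations_of_multisetI)
  qed
  also have "\<dots> = (\<Sum>I\<in>permutations_of_multiset A. word_mono I b)"
  proof (rule sum.cong)
    fix I assume I: "I \<in> permutations_of_multiset A"
    have "mset (zip (place I P) (place b P)) = mset (zip I b)"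
      by (rule mset_zip_place) (use len[OF I] P in simp_all)
    then have "word_mono (place I P) (place b P) = (word_mono I b :: 'a mpoly)"
      using len[OF I] by (simp add: word_mono_eq)
    then show "word_mono (place I P) b' = (word_mono I b :: 'a mpoly)" by (simp only: P(2))
  qed simp
  finally show ?thesis by simp
qed

lemma ent_symmetric_power_1: "ent (symmetric_power (Suc 0)) {#x#} {#y#} = var (x, y)"
  by (simp add: symmetric_power_def word_mono_def)

lemma ent_symb:
  assumes "length I\<^sub>0 = r + i" "length J = r + i"
  shows "ent (symb r i) (lab r I\<^sub>0) (lab r J) =
    (\<Sum>I | length I = r + i \<and> lab r I = lab r I\<^sub>0. word_mono I J :: 'k::field mpoly)"
proof -
  let ?A = "mset (take r I\<^sub>0)" and ?c = "drop r I\<^sub>0" and ?d = "drop r J"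
  have len: "length ?c = i" "length ?d = i" using assms by auto
  have "ent (symb r i) (lab r I\<^sub>0) (lab r J) =
    ent (symmetric_power r) ?A (mset (take r J)) * (\<Prod>t<i. ent (symmetric_power (Suc 0)) {#?c ! t#} {#?d ! t#} :: 'k mpoly)"
    unfolding sym_tensor_def tensor_based_def lab_def
    by (simp add: prod.lessThan_Suc_shift len assms del: prod.lessThan_Suc)
  also have "(\<Prod>t<i. ent (symmetric_power (Suc 0)) {#?c ! t#} {#?d ! t#}) = (word_mono ?c ?d :: 'k mpoly)"
    unfolding word_mono_def ent_symmetric_power_1 len ..
  also have "ent (symmetric_power r) ?A (mset (take r J)) = (\<Sum>b\<in>permutations_of_multiset ?A. word_mono b (take r J) :: 'k mpoly)"
    unfolding symmetric_power_def using assms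
    by (simp, intro sum_permutations_word_mono) auto
  also have "\<dots> * word_mono ?c ?d = (\<Sum>b\<in>permutations_of_multiset ?A. word_mono (b @ ?c) J :: 'k mpoly)"
    unfolding sum_distrib_right
  proof (rule sum.cong)
    fix b assume "b \<in> permutations_of_multiset ?A"
    then have "mset b = ?A" by (rule permutations_of_multisetD)
    then have b: "length b = r" using assms by (metis length_take min.absorb2 le_add1 size_mset)
    then have "zip (b @ ?c) J = zip b (take r J) @ zip ?c ?d" by (simp add: zip_append1)
    then show "word_mono b (take r J) * word_mono ?c ?d = (word_mono (b @ ?c) J :: 'k mpoly)"
      using b len assms by (simp add: word_mono_eq mult_single mm_add)
  qed simp
  also have "\<dots> = (\<Sum>I | length I = r + i \<and> lab r I = lab r I\<^sub>0. word_mono I J)"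
  proof -
    have *: "length b = r" if "mset b = ?A" for b
      using that assms by (metis length_take min.absorb2 le_add1 size_mset)
    have "bij_betw (\<lambda>b. b @ ?c) (permutations_of_multiset ?A) {I. length I = r + i \<and> lab r I = lab r I\<^sub>0}"
    proof (rule bij_betwI[of _ _ _ "take r"])
      show "(\<lambda>b. b @ ?c) \<in> permutations_of_multiset ?A \<rightarrow> {I. length I = r + i \<and> lab r I = lab r I\<^sub>0}"
        using assms * by (auto simp: lab_eq_iff dest: permutations_of_multisetD)
      show "take r \<in> {I. length I = r + i \<and> lab r I = lab r I\<^sub>0} \<rightarrow> permutations_of_multiset ?A"
        by (auto simp: lab_eq_iff intro: permutations_of_multisetI)
      show "take r (b @ ?c) = b" if "b \<in> permutations_of_multiset ?A" for b
        using * that by (auto dest: permutations_of_multisetD)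
      show "take r I @ ?c = I" if "I \<in> {I. length I = r + i \<and> lab r I = lab r I\<^sub>0}" for I
        using that append_take_drop_id[of r I] by (auto simp: lab_eq_iff)
    qed
    then show ?thesis by (rule sum.reindex_bij_betw)
  qed
  finally show ?thesis .
qed

definition E :: "nat \<Rightarrow> nat list \<Rightarrow> nat multiset list \<Rightarrow> 'k::field"
  where "E r J = unit_vec (lab r J)"

lemma flinear_coef_symf: "flinear (coef (symf r i) m n \<alpha>)"
  by (rule flinearI) (auto simp: symf_def spf_of_def fun_eq_iff fscale_def sum.distrib sum_distrib_left algebra_simps)

lemma coef_symf_supported:
  fixes v :: "nat multiset list \<Rightarrow> 'k::field"
  shows "coef (symf r i) m n \<alpha> v \<in> supported (idx (symb r i :: (_, 'k) based) n)"
  by (auto simp: symf_def spf_of_def supported_def)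

text \<open>The working form of the action: the sum inside a matrix entry runs over the words with
  one label, so summing over labels as well leaves a single sum over words, free of sorted
  listings.\<close>

lemma coef_symf_E:
  assumes J: "J \<in> words (r + i) m"
  shows "coef (symf r i) m n (mm Z) (E r J) =
    (\<Sum>I | I \<in> words (r + i) n \<and> mset (zip I J) = Z. E r I :: _ \<Rightarrow> 'k::field)"
proof (rule ext)
  fix L
  let ?S = "symb r i :: (_, 'k) based"
  show "coef (symf r i) m n (mm Z) (E r J) L =
    (\<Sum>I | I \<in> words (r + i) n \<and> mset (zip I J) = Z. E r I :: _ \<Rightarrow> 'k) L"
  proof (cases "L \<in> idx ?S n")
    case False
    moreover have "(\<Sum>I | I \<in> words (r + i) n \<and> mset (zip I J) = Z. E r I :: _ \<Rightarrow> 'k) \<in> supported (idx ?S n)"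
      by (intro fun_space.subspace_sum subspace_supported)
        (auto simp: E_def idx_symb intro!: unit_vec_supported)
    ultimately show ?thesis using coef_symf_supported[of r i m n "mm Z" "E r J :: _ \<Rightarrow> 'k"] by (simp add: supported_def)
  next
    case True
    then obtain I\<^sub>0 where I\<^sub>0: "I\<^sub>0 \<in> words (r + i) n" "L = lab r I\<^sub>0" unfolding idx_symb by blast
    have "lab r J \<in> idx ?S m" using J by (auto simp: idx_symb)
    then have "coef (symf r i) m n (mm Z) (E r J) L = Poly_Mapping.lookup (ent ?S L (lab r J)) (mm Z)"
      using True by (simp add: symf_def spf_of_def E_def unit_vec_def if_distrib cong: if_cong)
    also have "\<dots> = (\<Sum>I | length I = r + i \<and> lab r I = L. Poly_Mapping.lookup (word_mono I J) (mm Z))"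
      unfolding I\<^sub>0(2) using I\<^sub>0 J by (subst ent_symb) (simp_all add: wordsD lookup_sum)
    also have "{I. length I = r + i \<and> lab r I = L} = {I \<in> words (r + i) n. lab r I = L}"
    proof -
      have "set I \<subseteq> {..<n}" if "lab r I = L" for I
      proof -
        have "set I = set_mset (mset (take r I)) \<union> set (drop r I)"
          by (metis append_take_drop_id set_append set_mset_mset)
        also have "\<dots> = set_mset (mset (take r I\<^sub>0)) \<union> set (drop r I\<^sub>0)"
          using that unfolding I\<^sub>0(2) lab_eq_iff by simp
        also have "\<dots> = set I\<^sub>0" by (metis append_take_drop_id set_append set_mset_mset)
        finally show ?thesis using I\<^sub>0(1) by (simp add: words_def)
      qed
      then show ?thesis by (auto simp: words_def)
    qed
    also have "(\<Sum>I\<in>{I \<in> words (r + i) n. lab r I = L}. Poly_Mapping.lookup (word_mono I J) (mm Z)) =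
      (\<Sum>I\<in>words (r + i) n. if lab r I = L \<and> mset (zip I J) = Z then 1 else 0 :: 'k)"
      unfolding sum.inter_filter[OF finite_words] using J
      by (intro sum.cong refl) (auto simp: word_mono_eq wordsD lookup_single when_def)
    also have "\<dots> = (\<Sum>I | I \<in> words (r + i) n \<and> mset (zip I J) = Z. E r I L)"
      unfolding E_def unit_vec_def sum.inter_filter[OF finite_words] by (intro sum.cong refl) auto
    finally show ?thesis by (simp add: fscale_sum_apply)
  qed
qed

lemma val_symf_span: "val (symf r i) n = fun_space.span (E r ` words (r + i) n)"
  by (simp add: val_symf supported_eq_span idx_symb image_image E_def)

lemma flinear_compose: "flinear f \<Longrightarrow> flinear g \<Longrightarrow> flinear (\<lambda>v. g (f v))"
  by (rule flinearI) (simp_all add: flinear_add flinear_scale)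

lemma flinear_const_zero: "flinear (\<lambda>v. 0)"
  by (rule flinearI) simp_all

lemma flinear_ident: "flinear (\<lambda>v. v)"
  by (rule flinearI) simp_all

lemma flinear_scaled_sum:
  assumes "\<And>s. s \<in> S \<Longrightarrow> flinear (f s)"
  shows "flinear (\<lambda>v. \<Sum>s\<in>S. c s *\<^sub>f f s v)"
proof (rule flinearI)
  show "(\<Sum>s\<in>S. c s *\<^sub>f f s (x + y)) = (\<Sum>s\<in>S. c s *\<^sub>f f s x) + (\<Sum>s\<in>S. c s *\<^sub>f f s y)" for x y
    unfolding sum.distrib[symmetric]
    by (intro sum.cong refl) (simp add: flinear_add[OF assms] fun_space.scale_right_distrib)
  show "(\<Sum>s\<in>S. c s *\<^sub>f f s (d *\<^sub>f x)) = d *\<^sub>f (\<Sum>s\<in>S. c s *\<^sub>f f s x)" for d x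
    unfolding fun_space.scale_sum_right
    by (intro sum.cong refl) (simp add: flinear_scale[OF assms] mult.commute)
qed

lemma finite_monomials [simp]: "finite (monomials e n m)"
proof -
  have "monomials e n m \<subseteq> (\<lambda>(I, J). mm (mset (zip I J))) ` (words e n \<times> words e m)"
    unfolding monomials_eq by (auto elim!: ex_words_zip)
  then show ?thesis by (rule finite_subset) simp
qed

lemma symf_eqI:
  assumes "flinear f" "flinear g" "\<And>J. J \<in> words (r + i) m \<Longrightarrow> f (E r J) = g (E r J)"
    "v \<in> val (symf r i) m"
  shows "f v = g v"
  by (rule flinear_eq_on_span[OF assms(1,2), of "E r ` words (r + i) m"])
    (use assms(3,4) in \<open>auto simp: val_symf_span\<close>)

lemma sum_over_monomials:
  fixes g :: "mono \<Rightarrow> 'k::field" and X :: "nat list \<Rightarrow> 'x \<Rightarrow> 'k"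
  assumes "J \<in> words e m"
  shows "(\<Sum>\<gamma>\<in>monomials e n m. g \<gamma> *\<^sub>f (\<Sum>I | I \<in> words e n \<and> mm (mset (zip I J)) = \<gamma>. X I)) =
    (\<Sum>I\<in>words e n. g (mm (mset (zip I J))) *\<^sub>f X I)"
proof -
  have "(\<Sum>\<gamma>\<in>monomials e n m. g \<gamma> *\<^sub>f (\<Sum>I | I \<in> words e n \<and> mm (mset (zip I J)) = \<gamma>. X I)) =
    (\<Sum>\<gamma>\<in>monomials e n m. \<Sum>I | I \<in> words e n \<and> mm (mset (zip I J)) = \<gamma>. g (mm (mset (zip I J))) *\<^sub>f X I)"
    unfolding fun_space.scale_sum_right by (intro sum.cong refl) auto
  also have "\<dots> = (\<Sum>I\<in>words e n. g (mm (mset (zip I J))) *\<^sub>f X I)"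
    by (rule sum.group) (use mset_zip_monomials[OF _ assms] in auto)
  finally show ?thesis .
qed

lemma coef_symf_E_mono:
  assumes "J \<in> words (r + i) m"
  shows "coef (symf r i) m n \<alpha> (E r J) =
    (\<Sum>I | I \<in> words (r + i) n \<and> mm (mset (zip I J)) = \<alpha>. E r I :: _ \<Rightarrow> 'k::field)"
proof -
  obtain Z where "\<alpha> = mm Z" using ex_mm by blast
  then show ?thesis using coef_symf_E[OF assms] by simp
qed

text \<open>This is the value of a monomial at the identity matrix. Through it the axiom T(1) = 1
  selects the diagonal monomials and becomes the decomposition into weight components.\<close>

lemma diagonal_power:
  "(\<Prod>x\<in>Poly_Mapping.keys \<alpha>. (if fst x = snd x then 1 else 0) ^ Poly_Mapping.lookup \<alpha> x) =
    (if \<forall>x\<in>Poly_Mapping.keys \<alpha>. fst x = snd x then 1 else 0 :: 'k::field)"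
proof (cases "\<forall>x\<in>Poly_Mapping.keys \<alpha>. fst x = snd x")
  case False
  then obtain x where x: "x \<in> Poly_Mapping.keys \<alpha>" "fst x \<noteq> snd x" by blast
  then have "(if fst x = snd x then 1 else 0 :: 'k) ^ Poly_Mapping.lookup \<alpha> x = 0"
    by (simp add: in_keys_iff)
  then show ?thesis using x False by (subst if_not_P) (auto intro!: prod_zero)
qed simp

lemma zip_diagonal_iff:
  "length I = length J \<Longrightarrow> (\<forall>x\<in>set (zip I J). fst x = snd x) \<longleftrightarrow> I = J"
  by (induction I J rule: list_induct2) auto

lemma strict_polynomial_symf: "strict_polynomial (r + i) (symf r i :: (_, 'k::field) spf)"
proof -
  let ?T = "symf r i :: (_, 'k) spf"
  have val: "fun_space.subspace (val ?T n)" "fin_dim (val ?T n)" for n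
    by (simp_all add: val_symf subspace_supported fin_dim_supported)
  have lin: "linear_between (val ?T m) (val ?T n) (coef ?T m n \<alpha>)" for m n \<alpha>
    by (rule linear_between_flinear) (simp_all add: flinear_coef_symf val_symf coef_symf_supported)
  have deg: "coef ?T m n \<alpha> v = 0" if "\<alpha> \<notin> monomials (r + i) n m" "v \<in> val ?T m" for m n \<alpha> v
  proof (rule symf_eqI[OF flinear_coef_symf flinear_const_zero _ that(2)])
    fix J assume J: "J \<in> words (r + i) m"
    have "{I. I \<in> words (r + i) n \<and> mm (mset (zip I J)) = \<alpha>} = {}"
      using that(1) mset_zip_monomials[OF _ J] by auto
    then show "coef ?T m n \<alpha> (E r J) = 0" unfolding coef_symf_E_mono[OF J] by (simp only: sum.empty)
  qed
  let ?d = "\<lambda>\<alpha>. \<Prod>x\<in>Poly_Mapping.keys \<alpha>. (if fst x = snd x then 1 else 0 :: 'k) ^ Poly_Mapping.lookup \<alpha> x"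
  have ident: "(\<Sum>\<alpha>\<in>monomials (r + i) n n. ?d \<alpha> *\<^sub>f coef ?T n n \<alpha> v) = v" if "v \<in> val ?T n" for n v
  proof (rule symf_eqI[OF flinear_scaled_sum flinear_ident _ that, OF flinear_coef_symf])
    fix J assume J: "J \<in> words (r + i) n"
    have d: "?d (mm (mset (zip I J))) = (if I = J then 1 else 0)" if "I \<in> words (r + i) n" for I
      by (subst diagonal_power) (use that J in \<open>simp add: zip_diagonal_iff wordsD\<close>)
    have "(\<Sum>\<alpha>\<in>monomials (r + i) n n. ?d \<alpha> *\<^sub>f coef ?T n n \<alpha> (E r J)) =
      (\<Sum>I\<in>words (r + i) n. ?d (mm (mset (zip I J))) *\<^sub>f E r I)"
      unfolding coef_symf_E_mono[OF J] by (rule sum_over_monomials[OF J])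
    also have "\<dots> = (\<Sum>I\<in>words (r + i) n. if I = J then E r I else 0)"
      by (intro sum.cong refl) (subst d, simp_all)
    also have "\<dots> = E r J" using J by simp
    finally show "(\<Sum>\<alpha>\<in>monomials (r + i) n n. ?d \<alpha> *\<^sub>f coef ?T n n \<alpha> (E r J)) = E r J" .
  qed
  let ?c = "\<lambda>n \<gamma> \<beta> \<alpha>. Poly_Mapping.lookup (Poly_Mapping.lookup (mono_of_product n \<gamma> :: 'k mpoly mpoly) \<beta>) \<alpha>"
  have comp: "coef ?T n q \<beta> (coef ?T m n \<alpha> v) =
      (\<Sum>\<gamma>\<in>monomials (r + i) q m. ?c n \<gamma> \<beta> \<alpha> *\<^sub>f coef ?T m q \<gamma> v)"
    if "v \<in> val ?T m" for m n q \<alpha> \<beta> v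
  proof (rule symf_eqI[OF flinear_compose[OF flinear_coef_symf flinear_coef_symf] flinear_scaled_sum _ that,
        OF flinear_coef_symf])
    fix K assume K: "K \<in> words (r + i) m"
    obtain X where X: "\<alpha> = mm X" using ex_mm by blast
    obtain Y where Y: "\<beta> = mm Y" using ex_mm by blast
    let ?W = "words (r + i)"
    \<comment> \<open>Both sides attach to \<open>E r I\<close> the number of intermediate words
      \<open>J\<close> that form the prescribed multisets of pairs with \<open>I\<close> and with
      \<open>K\<close>.\<close>
    have "coef ?T n q \<beta> (coef ?T m n \<alpha> (E r K)) =
      (\<Sum>J | J \<in> ?W n \<and> mset (zip J K) = X. \<Sum>I | I \<in> ?W q \<and> mset (zip I J) = Y. E r I :: _ \<Rightarrow> 'k)"
      unfolding X Y coef_symf_E[OF K] flinear_sum[OF flinear_coef_symf]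
      by (intro sum.cong refl) (simp add: coef_symf_E)
    also have "\<dots> = (\<Sum>J\<in>?W n. \<Sum>I\<in>?W q. if mset (zip I J) = Y \<and> mset (zip J K) = X then E r I else 0)"
      unfolding sum.inter_filter[OF finite_words] by (intro sum.cong refl) auto
    also have "\<dots> = (\<Sum>I\<in>?W q. \<Sum>J\<in>?W n. if mset (zip I J) = Y \<and> mset (zip J K) = X then E r I else 0)"
      by (rule sum.swap)
    also have "\<dots> = (\<Sum>I\<in>?W q. ?c n (mm (mset (zip I K))) \<beta> \<alpha> *\<^sub>f E r I)"
      unfolding X Y using K
      by (intro sum.cong refl)
        (auto simp: lookup_mono_of_product fun_space.scale_sum_left intro!: sum.cong)
    also have "\<dots> = (\<Sum>\<gamma>\<in>monomials (r + i) q m. ?c n \<gamma> \<beta> \<alpha> *\<^sub>f coef ?T m q \<gamma> (E r K))"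
      unfolding coef_symf_E_mono[OF K] by (rule sum_over_monomials[OF K, symmetric])
    finally show "coef ?T n q \<beta> (coef ?T m n \<alpha> (E r K)) =
      (\<Sum>\<gamma>\<in>monomials (r + i) q m. ?c n \<gamma> \<beta> \<alpha> *\<^sub>f coef ?T m q \<gamma> (E r K))" .
  qed
  show ?thesis unfolding strict_polynomial_def using val lin deg ident comp by blast
qed

section \<open>Subfunctors and Kuhn duals\<close>

lemma strict_polynomial_sub:
  assumes T: "strict_polynomial e T" and sub: "subfunctor U T"
  shows "strict_polynomial e U"
proof -
  have U: "coef U = coef T" "\<And>n. fun_space.subspace (val U n)" "\<And>n. val U n \<subseteq> val T n"
    "\<And>m n \<alpha> v. v \<in> val U m \<Longrightarrow> coef T m n \<alpha> v \<in> val U n"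
    using sub by (auto simp: subfunctor_def)
  have T': "\<And>n. fin_dim (val T n)" "\<And>m n \<alpha>. linear_between (val T m) (val T n) (coef T m n \<alpha>)"
    using T by (simp_all add: strict_polynomial_def)
  have "linear_between (val U m) (val U n) (coef T m n \<alpha>)" for m n \<alpha>
    using T'(2)[of m n \<alpha>] U(3)[of m] U(4)[of _ m n \<alpha>] unfolding linear_between_def by blast
  note lin = this
  have deg: "\<And>m n \<alpha> v. \<alpha> \<notin> monomials e n m \<Longrightarrow> v \<in> val T m \<Longrightarrow> coef T m n \<alpha> v = 0"
    and ident: "\<And>n v. v \<in> val T n \<Longrightarrow> (\<Sum>\<alpha>\<in>monomials e n n.
         (\<Prod>x\<in>Poly_Mapping.keys \<alpha>. (if fst x = snd x then 1 else 0) ^ Poly_Mapping.lookup \<alpha> x)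
           *\<^sub>f coef T n n \<alpha> v) = v"
    and comp: "\<And>m n q \<alpha> \<beta> v. v \<in> val T m \<Longrightarrow> coef T n q \<beta> (coef T m n \<alpha> v) =
      (\<Sum>\<gamma>\<in>monomials e q m.
         Poly_Mapping.lookup (Poly_Mapping.lookup (mono_of_product n \<gamma>) \<beta>) \<alpha> *\<^sub>f coef T m q \<gamma> v)"
    using T unfolding strict_polynomial_def by blast+
  have in_T: "v \<in> val T n" if "v \<in> val U n" for v n using U(3) that by blast
  show ?thesis unfolding strict_polynomial_def U(1)
  proof (intro conjI allI impI ballI, goal_cases)
    case (1 n) show ?case by (rule U(2))
  next
    case (2 n) show ?case by (rule fin_dim_subspace[OF T'(1) U(2,3)])
  next
    case (3 m n \<alpha>) show ?case by (rule lin)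
  next
    case (4 m n \<alpha> v) then show ?case by (intro deg in_T)
  next
    case (5 n v) then show ?case by (intro ident in_T)
  next
    case (6 m n q \<alpha> \<beta> v) then show ?case by (intro comp in_T)
  qed
qed

lemma dual_space_iff:
  "f \<in> dual_space V \<longleftrightarrow> (\<forall>u\<in>V. \<forall>v\<in>V. f (u + v) = f u + f v) \<and>
     (\<forall>c. \<forall>v\<in>V. f (c *\<^sub>f v) = c * f v) \<and> (\<forall>v. v \<notin> V \<longrightarrow> f v = 0)"
  by (simp add: dual_space_def)

lemma dual_space_outside: "f \<in> dual_space V \<Longrightarrow> v \<notin> V \<Longrightarrow> f v = 0"
  by (simp add: dual_space_iff)

lemma dual_space_zero: "f \<in> dual_space V \<Longrightarrow> fun_space.subspace V \<Longrightarrow> f 0 = 0"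
  unfolding dual_space_iff by (metis fun_space.scale_zero_left fun_space.subspace_0 mult_zero_left)

lemma dual_space_sum:
  assumes f: "f \<in> dual_space V" and V: "fun_space.subspace V" and w: "\<And>s. s \<in> S \<Longrightarrow> w s \<in> V"
  shows "f (\<Sum>s\<in>S. c s *\<^sub>f w s) = (\<Sum>s\<in>S. c s * f (w s))"
  using w
proof (induction S rule: infinite_finite_induct)
  case (insert s S)
  have "(\<Sum>s\<in>S. c s *\<^sub>f w s) \<in> V" "c s *\<^sub>f w s \<in> V" "w s \<in> V"
    using insert.prems V by (auto intro: fun_space.subspace_sum fun_space.subspace_scale)
  then have "f (c s *\<^sub>f w s + (\<Sum>s\<in>S. c s *\<^sub>f w s)) = f (c s *\<^sub>f w s) + f (\<Sum>s\<in>S. c s *\<^sub>f w s)"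
    "f (c s *\<^sub>f w s) = c s * f (w s)"
    using f unfolding dual_space_iff by blast+
  moreover have "f (\<Sum>s\<in>S. c s *\<^sub>f w s) = (\<Sum>s\<in>S. c s * f (w s))"
    using insert.IH insert.prems by blast
  ultimately show ?case unfolding sum.insert[OF insert.hyps(1,2)] by argo
qed (use f V dual_space_zero in auto)

lemma subspace_dual_space: "fun_space.subspace (dual_space V)"
  by (auto simp: fun_space.subspace_def dual_space_iff fscale_def algebra_simps)

lemma fin_dim_dual_space:
  assumes fd: "fin_dim V" and V: "fun_space.subspace V"
  shows "fin_dim (dual_space V)"
proof -
  obtain B where B: "B \<subseteq> V" "fun_space.independent B" "V \<subseteq> fun_space.span B"
    using fun_space.maximal_independent_subset[of V] by blast
  obtain C where "finite C" "V = fun_space.span C" using fd by (auto simp: fin_dim_def)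
  then have fin: "finite B" using fun_space.independent_span_bound[OF _ B(2)] B(1) by auto
  have sp: "fun_space.span B = V" using B V by (simp add: fun_space.span_minimal subset_antisym)
  define c where "c = (\<lambda>b v. if v \<in> V then fun_space.representation B v b else 0)"
  have "f = (\<Sum>b\<in>B. f b *\<^sub>f c b)" if f: "f \<in> dual_space V" for f
  proof (rule ext)
    fix v
    show "f v = (\<Sum>b\<in>B. f b *\<^sub>f c b) v"
    proof (cases "v \<in> V")
      case True
      then have v: "(\<Sum>b\<in>B. fun_space.representation B v b *\<^sub>f b) = v"
        by (intro fun_space.sum_representation_eq) (use B fin sp in auto)
      have "f v = (\<Sum>b\<in>B. fun_space.representation B v b * f b)"
        using dual_space_sum[OF f V, of B "\<lambda>b. b" "fun_space.representation B v"] B(1) v by auto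
      then show ?thesis using True by (simp add: fscale_sum_apply fscale_def c_def mult.commute)
    qed (use f in \<open>simp add: fscale_sum_apply fscale_def c_def dual_space_iff\<close>)
  qed
  moreover have "(\<Sum>b\<in>B. f b *\<^sub>f c b) \<in> fun_space.span (c ` B)" for f
    by (intro fun_space.span_sum fun_space.span_scale fun_space.span_base imageI)
  ultimately have "dual_space V \<subseteq> fun_space.span (c ` B)" by (metis subsetI)
  then show ?thesis
    by (intro fin_dim_subspace[OF fin_dim_span subspace_dual_space]) (use fin in auto)
qed

lemma mono_transpose_monomials: "mono_transpose ` monomials e n m = monomials e m n"
proof -
  have *: "mono_transpose ` monomials e n m \<subseteq> monomials e m n" for n m
  proof
    fix \<alpha> assume "\<alpha> \<in> mono_transpose ` monomials e n m"
    then obtain Z where "\<alpha> = mm (image_mset prod.swap Z)" "set_mset Z \<subseteq> {..<n} \<times> {..<m}" "size Z = e"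
      unfolding monomials_eq by auto
    then show "\<alpha> \<in> monomials e m n" by auto
  qed
  have inv: "mono_transpose (mono_transpose \<alpha>) = \<alpha>" for \<alpha>
    using ex_mm[of \<alpha>] by (auto simp: multiset.map_comp)
  show ?thesis
  proof
    show "monomials e m n \<subseteq> mono_transpose ` monomials e n m"
      using *[of m n] inv by (metis image_iff image_subset_iff subsetI)
  qed (rule *)
qed

lemma mono_transpose_twice [simp]: "mono_transpose (mono_transpose \<alpha>) = \<alpha>"
  using ex_mm[of \<alpha>] by (auto simp: multiset.map_comp)

lemma sum_monomials_transpose:
  "(\<Sum>\<gamma>\<in>monomials e m n. h \<gamma>) = (\<Sum>\<gamma>\<in>monomials e n m. h (mono_transpose \<gamma>))"
proof -
  have "inj_on mono_transpose (monomials e n m)" by (metis inj_on_inverseI mono_transpose_twice)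
  then show ?thesis using sum.reindex[of mono_transpose "monomials e n m" h]
    by (simp add: mono_transpose_monomials)
qed

text \<open>The transpose of Y X is the product of the transposes in reverse order: all pairs are
  reversed, the two factors exchange their roles, and the intermediate words are the same.\<close>

lemma lookup_mono_of_product_transpose:
  fixes k :: "'k::field"
  assumes "\<gamma> \<in> monomials e q m"
  shows "Poly_Mapping.lookup (Poly_Mapping.lookup (mono_of_product n (mono_transpose \<gamma>)) (mono_transpose \<alpha>)) (mono_transpose \<beta>) =
    (Poly_Mapping.lookup (Poly_Mapping.lookup (mono_of_product n \<gamma>) \<beta>) \<alpha> :: 'k)"
proof -
  obtain X Y where XY: "\<alpha> = mm X" "\<beta> = mm Y" using ex_mm by blast
  obtain I K where IK: "I \<in> words e q" "K \<in> words e m" "\<gamma> = mm (mset (zip I K))"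
  proof -
    obtain Z where "\<gamma> = mm Z" "set_mset Z \<subseteq> {..<q} \<times> {..<m}" "size Z = e"
      using assms by (auto simp: monomials_eq)
    then show ?thesis using ex_words_zip[of Z q m e] that by metis
  qed
  have sw: "mset (zip A B) = image_mset prod.swap Z \<longleftrightarrow> mset (zip B A) = Z" for A B :: "nat list" and Z
    by (metis mset_zip_swap image_mset_swap_eq_iff)
  show ?thesis
    unfolding XY IK(3) mono_transpose_mm mset_zip_swap lookup_mono_of_product[OF IK(1,2)]
      lookup_mono_of_product[OF IK(2,1)] sw by (rule sum.cong) auto
qed

lemma strict_polynomial_kuhn_dual:
  fixes T :: "('x, 'k::field) spf"
  assumes T: "strict_polynomial e T"
  shows "strict_polynomial e (kuhn_dual T)"
proof -
  let ?W = "kuhn_dual T"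
  let ?c = "\<lambda>n \<gamma> \<beta> \<alpha>. Poly_Mapping.lookup (Poly_Mapping.lookup (mono_of_product n \<gamma> :: 'k mpoly mpoly) \<beta>) \<alpha>"
  let ?d = "\<lambda>\<alpha>. \<Prod>x\<in>Poly_Mapping.keys \<alpha>. (if fst x = snd x then 1 else 0 :: 'k) ^ Poly_Mapping.lookup \<alpha> x"
  have sub: "fun_space.subspace (val T n)" and fd: "fin_dim (val T n)"
    and lin: "linear_between (val T m) (val T n) (coef T m n \<alpha>)"
    and deg: "\<alpha> \<notin> monomials e n m \<Longrightarrow> v \<in> val T m \<Longrightarrow> coef T m n \<alpha> v = 0"
    and ident: "v \<in> val T n \<Longrightarrow> (\<Sum>\<alpha>\<in>monomials e n n. ?d \<alpha> *\<^sub>f coef T n n \<alpha> v) = v"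
    and comp: "v \<in> val T m \<Longrightarrow> coef T n q \<beta> (coef T m n \<alpha> v) =
      (\<Sum>\<gamma>\<in>monomials e q m. ?c n \<gamma> \<beta> \<alpha> *\<^sub>f coef T m q \<gamma> v)" for m n q \<alpha> \<beta> v
    using T unfolding strict_polynomial_def by blast+
  have cl: "coef T m n \<alpha> v \<in> val T n" if "v \<in> val T m" for m n \<alpha> v
    using lin[of m n \<alpha>] that by (auto simp: linear_between_def)
  have val: "val ?W n = dual_space (val T n)" for n by (simp add: kuhn_dual_def)
  have coef: "coef ?W m n \<alpha> f = (\<lambda>v. if v \<in> val T n then f (coef T n m (mono_transpose \<alpha>) v) else 0)" for m n \<alpha> f
    by (simp add: kuhn_dual_def)
  have wcl: "coef ?W m n \<alpha> f \<in> val ?W n" if f: "f \<in> val ?W m" for m n \<alpha> f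
  proof -
    have add: "coef T n m \<beta> (u + v) = coef T n m \<beta> u + coef T n m \<beta> v"
      and sc: "coef T n m \<beta> (c *\<^sub>f v) = c *\<^sub>f coef T n m \<beta> v" if "u \<in> val T n" "v \<in> val T n" for \<beta> u v c
      using lin[of n m \<beta>] that by (auto simp: linear_between_def)
    show ?thesis
      using f sub[of n] cl unfolding val coef dual_space_iff
      by (auto simp: add sc fun_space.subspace_add fun_space.subspace_scale)
  qed
  have "linear_between (val ?W m) (val ?W n) (coef ?W m n \<alpha>)" for m n \<alpha>
    unfolding linear_between_def using wcl
    by (auto simp: coef fun_eq_iff fscale_def)
  moreover have "coef ?W m n \<alpha> f = 0" if "\<alpha> \<notin> monomials e n m" "f \<in> val ?W m" for m n \<alpha> f
  proof -
    have "mono_transpose \<alpha> \<notin> monomials e m n"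
      using that(1) mono_transpose_monomials[of e m n] by (metis imageI mono_transpose_twice)
    then have zero: "f (coef T n m (mono_transpose \<alpha>) v) = 0" if "v \<in> val T n" for v
      unfolding deg[OF \<open>mono_transpose \<alpha> \<notin> _\<close> that]
      using dual_space_zero[OF _ sub] \<open>f \<in> val ?W m\<close> unfolding val by blast
    show ?thesis
    proof (rule ext)
      fix v
      show "coef ?W m n \<alpha> f v = 0 v" by (cases "v \<in> val T n") (simp_all add: coef zero)
    qed
  qed
  moreover have "(\<Sum>\<alpha>\<in>monomials e n n. ?d \<alpha> *\<^sub>f coef ?W n n \<alpha> f) = f" if f: "f \<in> val ?W n" for n f
  proof (rule ext)
    fix v
    have dt: "?d (mono_transpose \<alpha>) = ?d \<alpha>" for \<alpha>
    proof -
      obtain Z where Z: "\<alpha> = mm Z" using ex_mm by blast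
      have "(\<forall>x\<in>#Z. fst (prod.swap x) = snd (prod.swap x)) \<longleftrightarrow> (\<forall>x\<in>#Z. fst x = snd x)"
        unfolding fst_swap snd_swap by metis
      then show ?thesis unfolding diagonal_power unfolding Z mono_transpose_mm keys_mm set_image_mset ball_simps by simp
    qed
    show "(\<Sum>\<alpha>\<in>monomials e n n. ?d \<alpha> *\<^sub>f coef ?W n n \<alpha> f) v = f v"
    proof (cases "v \<in> val T n")
      case True
      have "(\<Sum>\<alpha>\<in>monomials e n n. ?d \<alpha> *\<^sub>f coef ?W n n \<alpha> f) v =
        (\<Sum>\<alpha>\<in>monomials e n n. ?d \<alpha> * f (coef T n n (mono_transpose \<alpha>) v))"
        using True by (simp add: fscale_sum_apply fscale_def coef)
      also have "\<dots> = (\<Sum>\<alpha>\<in>monomials e n n. ?d \<alpha> * f (coef T n n \<alpha> v))"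
        by (subst (2) sum_monomials_transpose) (simp add: dt)
      also have "\<dots> = f (\<Sum>\<alpha>\<in>monomials e n n. ?d \<alpha> *\<^sub>f coef T n n \<alpha> v)"
        using f cl[OF True] by (subst dual_space_sum[OF _ sub]) (auto simp: val)
      finally show ?thesis using ident[OF True] by simp
    next
      case False
      then show ?thesis using f by (simp add: fscale_sum_apply fscale_def coef val dual_space_outside)
    qed
  qed
  moreover have "coef ?W n q \<beta> (coef ?W m n \<alpha> f) =
      (\<Sum>\<gamma>\<in>monomials e q m. ?c n \<gamma> \<beta> \<alpha> *\<^sub>f coef ?W m q \<gamma> f)" if f: "f \<in> val ?W m" for m n q \<alpha> \<beta> f
  proof (rule ext)
    fix v
    show "coef ?W n q \<beta> (coef ?W m n \<alpha> f) v = (\<Sum>\<gamma>\<in>monomials e q m. ?c n \<gamma> \<beta> \<alpha> *\<^sub>f coef ?W m q \<gamma> f) v"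
    proof (cases "v \<in> val T q")
      case True
      have "coef ?W n q \<beta> (coef ?W m n \<alpha> f) v =
        f (coef T n m (mono_transpose \<alpha>) (coef T q n (mono_transpose \<beta>) v))"
        using True cl by (simp add: coef)
      also have "\<dots> = f (\<Sum>\<gamma>\<in>monomials e m q. ?c n \<gamma> (mono_transpose \<alpha>) (mono_transpose \<beta>) *\<^sub>f coef T q m \<gamma> v)"
        using comp[OF True] by simp
      also have "\<dots> = (\<Sum>\<gamma>\<in>monomials e m q. ?c n \<gamma> (mono_transpose \<alpha>) (mono_transpose \<beta>) * f (coef T q m \<gamma> v))"
        using f cl[OF True] by (subst dual_space_sum[OF _ sub]) (auto simp: val)
      also have "\<dots> = (\<Sum>\<gamma>\<in>monomials e q m. ?c n (mono_transpose \<gamma>) (mono_transpose \<alpha>) (mono_transpose \<beta>) * f (coef T q m (mono_transpose \<gamma>) v))"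
        by (rule sum_monomials_transpose)
      also have "\<dots> = (\<Sum>\<gamma>\<in>monomials e q m. ?c n \<gamma> \<beta> \<alpha> *\<^sub>f coef ?W m q \<gamma> f) v"
        using True by (simp add: fscale_sum_apply fscale_def coef lookup_mono_of_product_transpose)
      finally show ?thesis .
    next
      case False
      then show ?thesis by (simp add: coef fscale_sum_apply fscale_def)
    qed
  qed
  ultimately show ?thesis
    unfolding strict_polynomial_def
    by (intro conjI allI impI ballI) (simp_all only: val subspace_dual_space fin_dim_dual_space[OF fd sub])
qed

section \<open>Families of vectors indexed by words\<close>

text \<open>Says that sending the basis vector of the tensor power with word \<open>J\<close> to
  \<open>X J\<close> commutes with the polynomial actions. For \<open>X J\<close> in the values of
  \<open>symf r i\<close> this is a morphism from the tensor power of degree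
  \<open>r + i\<close>.\<close>

definition natural :: "nat \<Rightarrow> nat \<Rightarrow> (nat list \<Rightarrow> nat multiset list \<Rightarrow> 'k::field) \<Rightarrow> bool"
  where "natural r i X \<longleftrightarrow> (\<forall>m n Z. \<forall>J\<in>words (r + i) m.
    coef (symf r i) m n (mm Z) (X J) = (\<Sum>I | I \<in> words (r + i) n \<and> mset (zip I J) = Z. X I))"

lemma naturalD:
  "natural r i X \<Longrightarrow> J \<in> words (r + i) m \<Longrightarrow>
    coef (symf r i) m n (mm Z) (X J) = (\<Sum>I | I \<in> words (r + i) n \<and> mset (zip I J) = Z. X I)"
  by (simp add: natural_def)

lemma natural_E: "natural r i (E r)"
  by (simp add: natural_def coef_symf_E)

lemma natural_cong:
  assumes "natural r i X" "\<And>J. length J = r + i \<Longrightarrow> X J = Y J"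
  shows "natural r i Y"
proof -
  have *: "X J = Y J" if "J \<in> words (r + i) m" for J m using that assms(2) by (simp add: wordsD)
  show ?thesis unfolding natural_def
  proof (intro allI ballI)
    fix m n Z J assume J: "J \<in> words (r + i) m"
    have "coef (symf r i) m n (mm Z) (Y J) = (\<Sum>I | I \<in> words (r + i) n \<and> mset (zip I J) = Z. X I)"
      using naturalD[OF assms(1) J] *[OF J] by simp
    also have "\<dots> = (\<Sum>I | I \<in> words (r + i) n \<and> mset (zip I J) = Z. Y I)"
      by (rule sum.cong) (use * in auto)
    finally show "coef (symf r i) m n (mm Z) (Y J) = (\<Sum>I | I \<in> words (r + i) n \<and> mset (zip I J) = Z. Y I)" .
  qed
qed

lemma place_words: "P \<in> perms e \<Longrightarrow> J \<in> words e n \<Longrightarrow> place J P \<in> words e n"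
  using mset_place[of P J] mset_eq_setD[of "place J P" J] permsD[of P e] by (simp add: words_def)

text \<open>The symmetric group acts on the tensor power by natural maps: rearranging both words in
  the same way preserves their multiset of pairs.\<close>

lemma natural_place:
  assumes X: "natural r i X" and P: "P \<in> perms (r + i)"
  shows "natural r i (\<lambda>J. X (place J P))"
  unfolding natural_def
proof (intro allI ballI)
  fix m n Z J assume J: "J \<in> words (r + i) m"
  let ?S = "{I \<in> words (r + i) n. mset (zip I J) = Z}"
  let ?T = "{I \<in> words (r + i) n. mset (zip I (place J P)) = Z}"
  have "bij_betw (\<lambda>I. place I P) ?S ?T"
  proof (rule bij_betw_place[OF P])
    fix I assume I: "I \<in> ?S"
    then have "mset (zip (place I P) (place J P)) = mset (zip I J)"
      by (intro mset_zip_place) (use J P in \<open>auto simp: wordsD\<close>)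
    then show "length I = r + i \<and> place I P \<in> ?T" using I P by (auto simp: place_words wordsD)
  next
    fix I assume I: "I \<in> ?T"
    let ?I = "place I (inv_word P)"
    have I': "?I \<in> words (r + i) n" using I inv_word_perms[OF P] by (auto simp: place_words)
    have len: "length (inv_word P) = r + i" using permsD[OF inv_word_perms[OF P]] by simp
    have "place ?I P = I" by (rule place_inv_word) (use I P in \<open>auto simp: wordsD\<close>)
    moreover have "mset (zip (place ?I P) (place J P)) = mset (zip ?I J)"
      by (rule mset_zip_place) (use I' J P len in \<open>simp_all add: wordsD\<close>)
    ultimately show "length I = r + i \<and> ?I \<in> ?S" using I I' by (auto simp: wordsD)
  qed
  then have "sum X ?T = (\<Sum>I\<in>?S. X (place I P))" by (rule sum.reindex_bij_betw[symmetric])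
  then show "coef (symf r i) m n (mm Z) (X (place J P)) =
    (\<Sum>I | I \<in> words (r + i) n \<and> mset (zip I J) = Z. X (place I P))"
    using naturalD[OF X place_words[OF P J]] by simp
qed

lemma natural_scaled_sum:
  assumes "\<And>s. s \<in> S \<Longrightarrow> natural r i (X s)"
  shows "natural r i (\<lambda>J. \<Sum>s\<in>S. c s *\<^sub>f X s J)"
  unfolding natural_def
proof (intro allI ballI)
  fix m n Z J assume J: "J \<in> words (r + i) m"
  have "coef (symf r i) m n (mm Z) (\<Sum>s\<in>S. c s *\<^sub>f X s J) =
    (\<Sum>s\<in>S. c s *\<^sub>f coef (symf r i) m n (mm Z) (X s J))"
    by (simp only: flinear_sum[OF flinear_coef_symf] flinear_scale[OF flinear_coef_symf])
  also have "\<dots> = (\<Sum>s\<in>S. \<Sum>I | I \<in> words (r + i) n \<and> mset (zip I J) = Z. c s *\<^sub>f X s I)"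
    using naturalD[OF assms J] by (intro sum.cong refl) (simp add: fun_space.scale_sum_right)
  also have "\<dots> = (\<Sum>I | I \<in> words (r + i) n \<and> mset (zip I J) = Z. \<Sum>s\<in>S. c s *\<^sub>f X s I)"
    by (rule sum.swap)
  finally show "coef (symf r i) m n (mm Z) (\<Sum>s\<in>S. c s *\<^sub>f X s J) =
    (\<Sum>I | I \<in> words (r + i) n \<and> mset (zip I J) = Z. \<Sum>s\<in>S. c s *\<^sub>f X s I)" .
qed

lemma E_cong: "mset b = mset b' \<Longrightarrow> length b = r \<Longrightarrow> E r (b @ c) = E r (b' @ c)"
  using mset_eq_length[of b b'] by (simp add: E_def lab_def)

text \<open>
  With \<open>S\<^sup>r \<otimes> \<Lambda>\<^sup>i\<close> embedded in \<open>S\<^sup>r \<otimes> I\<^sup>i\<close> by antisymmetrization, \<open>omega r b c\<close> is the differential form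
  \<open>x\<^sup>b e\<^sub>c\<close>, and \<open>K q a b\<close> is the Koszul differential of \<open>x\<^sup>b e\<^sub>a\<close>. The latter is the image of
  \<open>e\<^sub>a \<otimes> e\<^sub>b\<close> under the map that defines the Schur functor of a hook.
\<close>

definition omega :: "nat \<Rightarrow> nat list \<Rightarrow> nat list \<Rightarrow> nat multiset list \<Rightarrow> 'k::field"
  where "omega r b c = altsum (\<lambda>u. E r (b @ u)) c"

definition K :: "nat \<Rightarrow> nat list \<Rightarrow> nat list \<Rightarrow> nat multiset list \<Rightarrow> 'k::field"
  where "K q a b = altsum (\<lambda>u. E (Suc q) (hd u # b @ tl u)) a"

lemma place_append: "place (a @ b) (map ((+) (length a)) I) = place b I"
  by (simp add: place_def nth_append comp_def)

lemma place_append1: "set I \<subseteq> {..<length a} \<Longrightarrow> place (a @ b) I = place a I"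
  by (auto simp: place_def nth_append)

lemma natural_omega: "natural r i (\<lambda>J. omega r (take r J) (drop r J) :: _ \<Rightarrow> 'k::field)"
proof -
  define P where "P = (\<lambda>I. [0..<r] @ map ((+) r) I)"
  have P: "P I \<in> perms (r + i)" if "I \<in> perms i" for I
  proof -
    have "set (map ((+) r) I) = {r..<r + i}"
      using permsD[OF that] by (simp add: lessThan_atLeast0 add.commute)
    then show ?thesis using permsD[OF that]
      by (auto simp: perms_iff P_def distinct_map)
  qed
  have "natural r i (\<lambda>J. \<Sum>I\<in>perms i. word_sign I *\<^sub>f E r (place J (P I)) :: _ \<Rightarrow> 'k)"
    by (intro natural_scaled_sum natural_place natural_E P)
  then show ?thesis
  proof (rule natural_cong)
    fix J :: "nat list" assume J: "length J = r + i"
    have "place J (P I) = take r J @ place (drop r J) I" for I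
    proof -
      have "place J [0..<r] = take r J"
        using J by (intro nth_equalityI) (auto simp: place_def)
      moreover have "place J (map ((+) r) I) = place (drop r J) I"
        using J place_append[of "take r J" "drop r J" I] by simp
      ultimately show ?thesis by (simp add: P_def place_def)
    qed
    then show "(\<Sum>I\<in>perms i. word_sign I *\<^sub>f E r (place J (P I)) :: _ \<Rightarrow> 'k) = omega r (take r J) (drop r J)"
      using J by (simp add: omega_def altsum_def)
  qed
qed

lemma natural_K: "natural (Suc q) i (\<lambda>J. K q (take (Suc i) J) (drop (Suc i) J) :: _ \<Rightarrow> 'k::field)"
proof -
  \<comment> \<open>The positions of \<open>a @ b\<close> read in the order: one chosen letter of
    \<open>a\<close>, then all of \<open>b\<close>, then the rest of \<open>a\<close>. The positions
    of \<open>b\<close> begin at \<open>Suc i\<close>, the length of \<open>a\<close>.\<close>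
  define P where "P = (\<lambda>I. hd I # [Suc i..<Suc i + q] @ tl I)"
  have P: "P I \<in> perms (Suc q + i)" if I: "I \<in> perms (Suc i)" for I
  proof -
    obtain x I' where xI: "I = x # I'" using permsD[OF I] by (metis length_Suc_conv)
    have x: "insert x (set I') = {..<Suc i}" "distinct (x # I')" using permsD[OF I] xI by simp_all
    have "{..<Suc q + i} = {..<Suc i} \<union> {Suc i..<Suc i + q}" by auto
    then have "set (P I) = {..<Suc q + i}" unfolding x(1)[symmetric] by (simp add: P_def xI Un_commute del: upt_Suc)
    moreover have "x < Suc i" "\<And>y. y \<in> set I' \<Longrightarrow> y < Suc i" using x(1) by blast+
    then have "distinct (P I)" using x(2) by (fastforce simp: P_def xI simp del: upt_Suc)
    ultimately show ?thesis by (simp add: perms_iff)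
  qed
  have "natural (Suc q) i (\<lambda>J. \<Sum>I\<in>perms (Suc i). word_sign I *\<^sub>f E (Suc q) (place J (P I)) :: _ \<Rightarrow> 'k)"
    by (intro natural_scaled_sum natural_place natural_E P)
  then show ?thesis
  proof (rule natural_cong)
    fix J :: "nat list" assume J: "length J = Suc q + i"
    let ?a = "take (Suc i) J" and ?b = "drop (Suc i) J"
    have "place J (P I) = hd (place ?a I) # ?b @ tl (place ?a I)" if I: "I \<in> perms (Suc i)" for I
    proof -
      obtain x I' where xI: "I = x # I'" using permsD[OF I] by (metis length_Suc_conv)
      have "place J I = place ?a I"
        using place_append1[of I ?a ?b] permsD[OF I] J by simp
      moreover have "place J [Suc i..<Suc i + q] = ?b"
        using J by (intro nth_equalityI) (auto simp: place_def simp del: upt_Suc)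
      ultimately show ?thesis by (simp add: P_def place_def xI del: upt_Suc)
    qed
    then show "(\<Sum>I\<in>perms (Suc i). word_sign I *\<^sub>f E (Suc q) (place J (P I)) :: _ \<Rightarrow> 'k) = K q ?a ?b"
      using J by (simp add: K_def altsum_def)
  qed
qed

lemma K_not_distinct: "\<not> distinct a \<Longrightarrow> K q a b = 0"
  by (simp add: K_def altsum_not_distinct)

lemma K_cong: "mset b = mset b' \<Longrightarrow> length b = q \<Longrightarrow> K q a b = K q a b'"
  unfolding K_def by (rule altsum_cong)
    (metis E_cong append_Cons length_Cons mset.simps(2))

lemma omega_cong: "mset b = mset b' \<Longrightarrow> length b = r \<Longrightarrow> omega r b c = omega r b' c"
  unfolding omega_def by (rule altsum_cong) (rule E_cong)

lemma K_omega:
  assumes "a \<noteq> []"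
  shows "K q a b = (\<Sum>t<length a. (-1) ^ t *\<^sub>f omega (Suc q) (a ! t # b) (take t a @ drop (Suc t) a))"
  unfolding K_def omega_def using assms by (subst altsum_laplace) simp

lemma K_sorted:
  "finite A \<Longrightarrow> a \<in> permutations_of_set A \<Longrightarrow> K q a b = word_sign a *\<^sub>f K q (sorted_list_of_set A) b"
  unfolding K_def by (rule altsum_sorted)

text \<open>Indexes the standard basis of the exterior tensor attached to the hook. The vectors
  \<open>KB q x\<close> are the images of this basis under the Schur map; they span the Schur
  functor but need not be independent.\<close>

definition KI :: "nat \<Rightarrow> nat \<Rightarrow> nat \<Rightarrow> (nat set \<times> nat list) set"
  where "KI q i n = {A. A \<subseteq> {..<n} \<and> card A = Suc i} \<times> words q n"

abbreviation KB :: "nat \<Rightarrow> nat set \<times> nat list \<Rightarrow> nat multiset list \<Rightarrow> 'k::field"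
  where "KB q x \<equiv> K q (sorted_list_of_set (fst x)) (snd x)"

lemma finite_KI [simp]: "finite (KI q i n)"
  by (simp add: KI_def)

lemma append_words: "a \<in> words l n \<Longrightarrow> b \<in> words m n \<Longrightarrow> a @ b \<in> words (l + m) n"
  by (auto simp: words_def)

lemma take_words: "J \<in> words (l + m) n \<Longrightarrow> take l J \<in> words l n"
  and drop_words: "J \<in> words (l + m) n \<Longrightarrow> drop l J \<in> words m n"
  by (auto simp: words_def dest: in_set_takeD in_set_dropD)

lemma sum_words_append:
  "(\<Sum>J\<in>words (l + m) n. f J) = (\<Sum>a\<in>words l n. \<Sum>b\<in>words m n. f (a @ b))"
proof -
  have "bij_betw (\<lambda>(a, b). a @ b) (words l n \<times> words m n) (words (l + m) n)"
    by (rule bij_betwI[of _ _ _ "\<lambda>J. (take l J, drop l J)"])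
      (auto simp: append_words take_words drop_words wordsD)
  then have "(\<Sum>J\<in>words (l + m) n. f J) = (\<Sum>(a, b)\<in>words l n \<times> words m n. f (a @ b))"
    by (subst sum.reindex_bij_betw[symmetric]) (auto simp: case_prod_unfold)
  then show ?thesis by (simp add: sum.cartesian_product)
qed

lemma sum_distinct_words:
  fixes f :: "nat list \<Rightarrow> 'x \<Rightarrow> 'k::field"
  assumes "\<And>a. a \<in> words l n \<Longrightarrow> \<not> distinct a \<Longrightarrow> f a = 0"
  shows "(\<Sum>a\<in>words l n. f a) =
    (\<Sum>A | A \<subseteq> {..<n} \<and> card A = l. \<Sum>a\<in>permutations_of_set A. f a)"
proof -
  let ?D = "{a \<in> words l n. distinct a}" and ?S = "{A. A \<subseteq> {..<n} \<and> card A = l}"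
  have "(\<Sum>a\<in>words l n. f a) = (\<Sum>a\<in>?D. f a)"
    by (rule sum.mono_neutral_right) (use assms in auto)
  also have "\<dots> = (\<Sum>A\<in>?S. \<Sum>a\<in>{a \<in> ?D. set a = A}. f a)"
  proof (rule sum.group[symmetric])
    show "finite ?D" "finite ?S" by simp_all
    show "set ` ?D \<subseteq> ?S" by (auto simp: words_def distinct_card)
  qed
  also have "\<dots> = (\<Sum>A\<in>?S. \<Sum>a\<in>permutations_of_set A. f a)"
  proof (intro sum.cong refl)
    fix A assume "A \<in> ?S"
    then show "{a \<in> ?D. set a = A} = permutations_of_set A"
      by (auto simp: words_def distinct_card length_finite_permutations_of_set dest: permutations_of_setD)
  qed
  finally show ?thesis .
qed

section \<open>The functors attached to a hook\<close>

text \<open>In degree \<open>p\<close> one has \<open>q = p - i - 1\<close>; with \<open>q\<close> as parameter no truncated subtraction occurs.\<close>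

definition hk :: "nat \<Rightarrow> nat \<Rightarrow> nat list"
  where "hk q i = Suc i # replicate q (Suc 0)"

definition xlab :: "nat set \<times> nat list \<Rightarrow> nat set list"
  where "xlab x = fst x # map (\<lambda>x. {x}) (snd x)"

lemma idx_exterior_power_1: "A \<in> idx (exterior_power (Suc 0)) n \<longleftrightarrow> (\<exists>x<n. A = {x})"
  by (auto simp: exterior_power_def card_1_singleton_iff)

lemma idx_ext_hk: "idx (ext_tensor (hk q i) :: (_, 'k::field) based) n = xlab ` KI q i n"
proof (intro set_eqI iffI)
  fix L assume "L \<in> idx (ext_tensor (hk q i) :: (_, 'k) based) n"
  then obtain A As where L: "L = A # As" "A \<in> idx (exterior_power (Suc i) :: (_, 'k) based) n"
    "list_all2 (\<lambda>I C. I \<in> idx C n) As (replicate q (exterior_power (Suc 0) :: (_, 'k) based))"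
    by (auto simp: ext_tensor_def tensor_based_def list_all2_Cons2 hk_def)
  then have As: "length As = q" "\<forall>N\<in>set As. \<exists>x<n. N = {x}"
    by (auto simp: list_all2_conv_all_nth in_set_conv_nth idx_exterior_power_1)
  then obtain c where c: "As = map (\<lambda>x. {x}) c" using ex_map_conv[of As "\<lambda>x. {x}"] by blast
  then have "c \<in> words q n" using As by (auto simp: words_def)
  moreover have "A \<subseteq> {..<n} \<and> card A = Suc i" using L(2) by (simp add: exterior_power_def)
  ultimately have "(A, c) \<in> KI q i n" by (simp add: KI_def)
  moreover have "L = xlab (A, c)" by (simp add: xlab_def L(1) c)
  ultimately show "L \<in> xlab ` KI q i n" by blast
next
  fix L assume "L \<in> xlab ` KI q i n"
  then obtain A c where "L = A # map (\<lambda>x. {x}) c" "A \<subseteq> {..<n}" "card A = Suc i" "length c = q" "set c \<subseteq> {..<n}"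
    by (auto simp: KI_def words_def xlab_def)
  then show "L \<in> idx (ext_tensor (hk q i) :: (_, 'k) based) n"
    by (auto simp: ext_tensor_def tensor_based_def hk_def exterior_power_def list_all2_conv_all_nth
        nth_Cons less_Suc_eq_0_disj subset_iff split: nat.split)
qed

lemma inj_xlab: "inj xlab"
proof (rule injI)
  fix x y assume "xlab x = xlab y"
  then have "fst x = fst y" "map (\<lambda>x. {x}) (snd x) = map (\<lambda>x. {x}) (snd y)" by (simp_all add: xlab_def)
  moreover have "inj (\<lambda>x :: nat. {x})" by (simp add: inj_def)
  ultimately show "x = y" by (metis inj_map_eq_map prod.expand)
qed

lemma conjugate_hk: "conjugate (hk q i) = Suc q # replicate i (Suc 0)"
proof -
  have "conjugate (hk q i) = map (\<lambda>c. if c = 0 then Suc q else Suc 0) [0..<Suc i]"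
    unfolding conjugate_def hk_def by (auto simp: filter_replicate)
  also have "\<dots> = Suc q # map (\<lambda>c. if c = 0 then Suc q else Suc 0) [Suc 0..<Suc i]"
    by (simp add: upt_rec[of 0] del: upt_Suc)
  also have "map (\<lambda>c. if c = 0 then Suc q else Suc 0) [Suc 0..<Suc i] = map (\<lambda>c. Suc 0) [Suc 0..<Suc i]"
    by (rule map_cong) auto
  finally show ?thesis by (simp add: map_replicate_const)
qed

lemma row_reading_hk: "row_reading (hk q i) = map (Pair 0) [0..<Suc i] @ map (\<lambda>r. (r, 0)) [1..<Suc q]"
proof -
  have "row_reading (hk q i) = concat (map (\<lambda>r. map (Pair r) [0..<hk q i ! r]) [0..<Suc q])"
    by (simp add: row_reading_def hk_def)
  also have "\<dots> = map (Pair 0) [0..<Suc i] @ concat (map (\<lambda>r. map (Pair r) [0..<hk q i ! r]) [Suc 0..<Suc q])"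
    by (simp add: upt_rec[of 0 "Suc q"] hk_def del: upt_Suc)
  also have "map (\<lambda>r. map (Pair r) [0..<hk q i ! r]) [Suc 0..<Suc q] = map (\<lambda>r. [(r, 0)]) [Suc 0..<Suc q]"
  proof (rule map_cong[OF refl])
    fix x assume "x \<in> set [Suc 0..<Suc q]"
    then have "Suc 0 \<le> x \<and> x < Suc q" by (simp del: upt_Suc)
    then obtain y where "x = Suc y" "y < q" by (intro that[of "x - 1"]) auto
    then show "map (Pair x) [0..<hk q i ! x] = [(x, 0)]" by (simp add: hk_def)
  qed
  also have "concat (map (\<lambda>r. [(r, 0)]) [Suc 0..<Suc q]) = map (\<lambda>r. (r, 0)) [1..<Suc q]"
    by (simp add: concat_map_singleton del: upt_Suc)
  finally show ?thesis .
qed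

lemma column_reading_hk: "column_reading (hk q i) = map (\<lambda>r. (r, 0)) [0..<Suc q] @ map (Pair 0) [1..<Suc i]"
proof -
  have "column_reading (hk q i) = concat (map (\<lambda>c. map (\<lambda>r. (r, c)) [0..<conjugate (hk q i) ! c]) [0..<Suc i])"
    by (simp add: column_reading_def conjugate_hk)
  also have "\<dots> = map (\<lambda>r. (r, 0)) [0..<Suc q] @
      concat (map (\<lambda>c. map (\<lambda>r. (r, c)) [0..<conjugate (hk q i) ! c]) [Suc 0..<Suc i])"
    by (simp add: upt_rec[of 0 "Suc i"] conjugate_hk del: upt_Suc)
  also have "map (\<lambda>c. map (\<lambda>r. (r, c)) [0..<conjugate (hk q i) ! c]) [Suc 0..<Suc i] = map (\<lambda>c. [(0, c)]) [Suc 0..<Suc i]"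
  proof (rule map_cong[OF refl])
    fix x assume "x \<in> set [Suc 0..<Suc i]"
    then have "Suc 0 \<le> x \<and> x < Suc i" by (simp del: upt_Suc)
    then obtain y where "x = Suc y" "y < i" by (intro that[of "x - 1"]) auto
    then show "map (\<lambda>r. (r, x)) [0..<conjugate (hk q i) ! x] = [(0, x)]" by (simp add: conjugate_hk)
  qed
  also have "concat (map (\<lambda>c. [(0, c)]) [Suc 0..<Suc i]) = map (Pair 0) [1..<Suc i]"
    by (simp add: concat_map_singleton del: upt_Suc)
  finally show ?thesis .
qed

lemma sum_list_hk: "sum_list (hk q i) = Suc q + i" "sum_list (conjugate (hk q i)) = Suc q + i"
  unfolding conjugate_hk by (simp_all add: hk_def sum_list_replicate)

text \<open>Rows list the arm with the corner first and then the leg; columns list the corner, then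
  the leg, then the rest of the arm. With \<open>a\<close> on the first row and \<open>b\<close> on
  the leg, the column word is \<open>hd a # b @ tl a\<close>.\<close>

lemma row_to_column_hk:
  assumes "length a = Suc i" "length b = q"
  shows "row_to_column (hk q i) t (hd a # b @ tl a) = t (a @ b)"
proof -
  let ?J = "hd a # b @ tl a" and ?C = "column_reading (hk q i)"
  obtain x a' where a: "a = x # a'" "length a' = i" using assms by (cases a) auto
  have lenC: "length ?C = Suc q + i" by (simp add: column_reading_hk del: upt_Suc)
  have dist: "distinct ?C"
    unfolding column_reading_hk by (auto simp: distinct_map inj_on_def simp del: upt_Suc)
  have nth: "the (map_of (zip ?C ?J) (?C ! k)) = ?J ! k" if "k < Suc q + i" for k
    using map_of_zip_nth[of ?C ?J k] lenC dist that assms by simp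
  have C1: "?C ! 0 = (0, 0)" by (simp add: column_reading_hk nth_append upt_rec[of 0 "Suc q"] del: upt_Suc)
  have C2: "?C ! r = (r, 0)" if "r < Suc q" for r
    using that by (simp add: column_reading_hk nth_append del: upt_Suc)
  have C3: "?C ! (q + c) = (0, c)" if "0 < c" "c < Suc i" for c
    using that by (simp add: column_reading_hk nth_append del: upt_Suc)
  have 1: "map (\<lambda>b. the (map_of (zip ?C ?J) b)) (map (Pair 0) [0..<Suc i]) = a"
  proof (rule nth_equalityI)
    fix c assume "c < length (map (\<lambda>b. the (map_of (zip ?C ?J) b)) (map (Pair 0) [0..<Suc i]))"
    then have c: "c < Suc i" by simp
    show "map (\<lambda>b. the (map_of (zip ?C ?J) b)) (map (Pair 0) [0..<Suc i]) ! c = a ! c"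
    proof (cases c)
      case 0
      then show ?thesis using nth[of 0] C1 a by (simp del: upt_Suc)
    next
      case (Suc d)
      then have "the (map_of (zip ?C ?J) (0, c)) = ?J ! (q + c)"
        using nth[of "q + c"] C3[of c] c by simp
      also have "\<dots> = a ! c" using Suc assms(2) a c by (simp add: nth_append)
      finally show ?thesis using c by (simp del: upt_Suc)
    qed
  qed (use assms in simp)
  have 2: "map (\<lambda>b. the (map_of (zip ?C ?J) b)) (map (\<lambda>r. (r, 0)) [1..<Suc q]) = b"
  proof (rule nth_equalityI)
    fix k assume "k < length (map (\<lambda>b. the (map_of (zip ?C ?J) b)) (map (\<lambda>r. (r, 0)) [1..<Suc q]))"
    then have k: "k < q" by (simp del: upt_Suc)
    then have "the (map_of (zip ?C ?J) (Suc k, 0)) = ?J ! Suc k"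
      using nth[of "Suc k"] C2[of "Suc k"] by simp
    then show "map (\<lambda>b. the (map_of (zip ?C ?J) b)) (map (\<lambda>r. (r, 0)) [1..<Suc q]) ! k = b ! k"
      using k assms(2) by (simp add: nth_append del: upt_Suc)
  qed (use assms in simp)
  have len: "length ?J = sum_list (hk q i)" using assms by (simp add: sum_list_hk)
  show ?thesis unfolding row_to_column_def if_P[OF len] row_reading_hk map_append 1 2 ..
qed

lemma chunks_replicate_1: "length b = q \<Longrightarrow> chunks (replicate q (Suc 0)) b = map (\<lambda>x. [x]) b"
proof (induction b arbitrary: q)
  case (Cons x b)
  then show ?case by (cases q) auto
qed simp

lemma chunks_hk: "length a = Suc i \<Longrightarrow> length b = q \<Longrightarrow> chunks (hk q i) (a @ b) = a # map (\<lambda>x. [x]) b"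
  by (simp add: hk_def chunks_replicate_1)

lemma mset_chunks: "length J = r + i \<Longrightarrow> map mset (chunks (r # replicate i (Suc 0)) J) = lab r J"
  by (simp add: chunks_replicate_1 lab_def comp_def)

lemma ext_incl_hk:
  assumes "length a = Suc i" "length b = q"
  shows "ext_incl (hk q i) v (a @ b) = (if distinct a then word_sign a * v (xlab (set a, b)) else 0)"
proof -
  have 1: "prod_list (map word_sign (map (\<lambda>x. [x]) b)) = (1 :: 'a)"
    by (induction b) (simp_all add: word_sign_Cons)
  have 2: "list_all distinct (map (\<lambda>x. [x]) b)" by (simp add: list_all_iff)
  have 3: "map set (map (\<lambda>x. [x]) b) = map (\<lambda>x. {x}) b" by simp
  have "length (a @ b) = sum_list (hk q i)" using assms by (simp add: sum_list_hk)
  then show ?thesis unfolding ext_incl_def chunks_hk[OF assms]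
    using 1 2 3 by (simp add: xlab_def del: map_map)
qed

lemma set_lab: "set J = \<Union> (set_mset ` set (lab r J))"
proof -
  have "\<Union> (set_mset ` set (lab r J)) = set (take r J) \<union> set (drop r J)"
    by (auto simp: lab_def)
  also have "\<dots> = set J" by (metis append_take_drop_id set_append)
  finally show ?thesis ..
qed

text \<open>Identifies the Schur map of a hook with the Koszul differential. The composite that
  defines \<open>schur_map\<close> is used only through this formula.\<close>

lemma schur_map_hk:
  fixes v :: "nat set list \<Rightarrow> 'k::field"
  assumes v: "v \<in> val (spf_of (ext_tensor (hk q i))) n"
  shows "schur_map (hk q i) n v = (\<Sum>x\<in>KI q i n. v (xlab x) *\<^sub>f KB q x)"
proof -
  let ?e = "Suc q + i" and ?t = "row_to_column (hk q i) (ext_incl (hk q i) v)"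
  have supp: "v L = 0" if "L \<notin> xlab ` KI q i n" for L
    using v that unfolding idx_ext_hk[where ?'k = 'k, symmetric] by (simp add: spf_of_def)
  have split: "\<exists>a b. J = hd a # b @ tl a \<and> length a = Suc i \<and> length b = q" if J: "length J = ?e" for J :: "nat list"
  proof -
    obtain x J' where "J = x # J'" "length J' = q + i" using J by (cases J) auto
    then show ?thesis
      by (intro exI[of _ "x # drop q J'"] exI[of _ "take q J'"]) simp
  qed
  have t: "?t (hd a # b @ tl a) = (if distinct a then word_sign a * v (xlab (set a, b)) else 0)"
    if "length a = Suc i" "length b = q" for a b
    by (simp only: row_to_column_hk[OF that] ext_incl_hk[OF that])
  have t0: "?t J = 0" if J: "length J = ?e" "J \<notin> words ?e n" for J
  proof -
    obtain a b where ab: "J = hd a # b @ tl a" "length a = Suc i" "length b = q" using split[OF J(1)] by blast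
    then have "\<not> set (a @ b) \<subseteq> {..<n}" using J by (cases a) (auto simp: words_def)
    then have "xlab (set a, b) \<notin> xlab ` KI q i n"
      by (auto simp: inj_image_mem_iff[OF inj_xlab] KI_def words_def)
    then show ?thesis using t[OF ab(2,3)] ab(1) supp by simp
  qed
  have "schur_map (hk q i) n v = (\<Sum>J\<in>words ?e n. ?t J *\<^sub>f E (Suc q) J)"
  proof (rule ext)
    fix M
    have "{J. length J = sum_list (conjugate (hk q i)) \<and> map mset (chunks (conjugate (hk q i)) J) = M} =
      {J. length J = ?e \<and> lab (Suc q) J = M}"
      unfolding sum_list_hk(2) unfolding conjugate_hk
      by (intro Collect_cong conj_cong refl) (simp only: mset_chunks)
    then have "schur_map (hk q i) n v M = (\<Sum>J | length J = ?e \<and> lab (Suc q) J = M. ?t J)"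
      by (simp add: schur_map_def sym_proj_def)
    also have "\<dots> = (\<Sum>J\<in>{J \<in> words ?e n. lab (Suc q) J = M}. ?t J)"
    proof (rule sum.mono_neutral_right)
      have "{J. length J = ?e \<and> lab (Suc q) J = M} \<subseteq> {J. set J \<subseteq> \<Union> (set_mset ` set M) \<and> length J = ?e}"
        using set_lab by blast
      moreover have "finite (\<Union> (set_mset ` set M))" by simp
      ultimately show "finite {J. length J = ?e \<and> lab (Suc q) J = M}"
        using finite_lists_length_eq finite_subset by blast
    qed (use t0 in \<open>auto simp: wordsD\<close>)
    also have "\<dots> = (\<Sum>J\<in>words ?e n. ?t J *\<^sub>f E (Suc q) J) M"
      unfolding sum.inter_filter[OF finite_words] fscale_sum_apply
      by (intro sum.cong refl) (auto simp: fscale_def E_def unit_vec_def)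
    finally show "schur_map (hk q i) n v M = (\<Sum>J\<in>words ?e n. ?t J *\<^sub>f E (Suc q) J) M" .
  qed
  also have "\<dots> = (\<Sum>(a, b)\<in>words (Suc i) n \<times> words q n. ?t (hd a # b @ tl a) *\<^sub>f E (Suc q) (hd a # b @ tl a))"
  proof -
    have "bij_betw (\<lambda>(a, b). hd a # b @ tl a) (words (Suc i) n \<times> words q n) (words ?e n)"
    proof (rule bij_betwI[of _ _ _ "\<lambda>J. (hd J # drop (Suc q) J, take q (tl J))"])
      show "(\<lambda>J. (hd J # drop (Suc q) J, take q (tl J))) \<in> words ?e n \<rightarrow> words (Suc i) n \<times> words q n"
      proof
        fix J assume "J \<in> words ?e n"
        then obtain x J' where "J = x # J'" "length J' = q + i" "x < n" "set J' \<subseteq> {..<n}"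
          by (cases J) (auto simp: words_def)
        then show "(hd J # drop (Suc q) J, take q (tl J)) \<in> words (Suc i) n \<times> words q n"
          by (auto simp: words_def dest: in_set_takeD in_set_dropD)
      qed
    next
      fix J assume "J \<in> words ?e n"
      then obtain x J' where "J = x # J'" "length J' = q + i" by (cases J) (auto simp: words_def)
      then show "(\<lambda>(a, b). hd a # b @ tl a) (hd J # drop (Suc q) J, take q (tl J)) = J" by simp
    next
      fix x assume "x \<in> words (Suc i) n \<times> words q n"
      then obtain y a b where "x = (y # a, b)" "length b = q" "length a = i"
        by (auto simp: words_def length_Suc_conv)
      then show "(hd ((\<lambda>(a, b). hd a # b @ tl a) x) # drop (Suc q) ((\<lambda>(a, b). hd a # b @ tl a) x),
        take q (tl ((\<lambda>(a, b). hd a # b @ tl a) x))) = x" by simp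
    qed (auto simp: words_def length_Suc_conv)
    then show ?thesis by (subst sum.reindex_bij_betw[symmetric]) (auto simp: case_prod_unfold)
  qed
  also have "\<dots> = (\<Sum>b\<in>words q n. \<Sum>a\<in>words (Suc i) n. ?t (hd a # b @ tl a) *\<^sub>f E (Suc q) (hd a # b @ tl a))"
    by (subst sum.swap) (simp add: sum.cartesian_product)
  \<comment> \<open>Words \<open>a\<close> with a repeated letter contribute nothing, and the signed
    orderings of a set \<open>A\<close> combine to one Koszul vector.\<close>
  also have "\<dots> = (\<Sum>b\<in>words q n. \<Sum>A | A \<subseteq> {..<n} \<and> card A = Suc i. v (xlab (A, b)) *\<^sub>f KB q (A, b))"
  proof (intro sum.cong refl)
    fix b assume "b \<in> words q n"
    then have b: "length b = q" by (simp add: wordsD)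
    have "(\<Sum>a\<in>words (Suc i) n. ?t (hd a # b @ tl a) *\<^sub>f E (Suc q) (hd a # b @ tl a)) =
      (\<Sum>A | A \<subseteq> {..<n} \<and> card A = Suc i. \<Sum>a\<in>permutations_of_set A. ?t (hd a # b @ tl a) *\<^sub>f E (Suc q) (hd a # b @ tl a))"
      by (rule sum_distinct_words) (use t b in \<open>simp add: wordsD\<close>)
    also have "\<dots> = (\<Sum>A | A \<subseteq> {..<n} \<and> card A = Suc i. v (xlab (A, b)) *\<^sub>f KB q (A, b))"
    proof (intro sum.cong refl)
      fix A assume "A \<in> {A. A \<subseteq> {..<n} \<and> card A = Suc i}"
      then have A: "finite A" "card A = Suc i" by (auto intro: finite_subset)
      have "?t (hd a # b @ tl a) = word_sign a * v (xlab (A, b))" if "a \<in> permutations_of_set A" for a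
      proof -
        have "length a = Suc i" using length_finite_permutations_of_set[OF that] A by simp
        then show ?thesis using t[OF _ b, of a] permutations_of_setD[OF that] by simp
      qed
      then have "(\<Sum>a\<in>permutations_of_set A. ?t (hd a # b @ tl a) *\<^sub>f E (Suc q) (hd a # b @ tl a)) =
        v (xlab (A, b)) *\<^sub>f (\<Sum>a\<in>permutations_of_set A. word_sign a *\<^sub>f E (Suc q) (hd a # b @ tl a))"
        unfolding fun_space.scale_sum_right by (intro sum.cong refl) (simp add: mult.commute)
      then show "(\<Sum>a\<in>permutations_of_set A. ?t (hd a # b @ tl a) *\<^sub>f E (Suc q) (hd a # b @ tl a)) =
        v (xlab (A, b)) *\<^sub>f KB q (A, b)"
        by (simp add: K_def altsum_sorted_list_of_set[OF A(1)])
    qed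
    finally show "(\<Sum>a\<in>words (Suc i) n. ?t (hd a # b @ tl a) *\<^sub>f E (Suc q) (hd a # b @ tl a)) =
      (\<Sum>A | A \<subseteq> {..<n} \<and> card A = Suc i. v (xlab (A, b)) *\<^sub>f KB q (A, b))" .
  qed
  also have "\<dots> = (\<Sum>x\<in>KI q i n. v (xlab x) *\<^sub>f KB q x)"
    by (subst sum.swap) (simp add: KI_def sum.cartesian_product case_prod_unfold)
  finally show ?thesis .
qed

lemma fscale_apply: "(c *\<^sub>f v) x = c * v x"
  by (simp add: fscale_def)

section \<open>The functors of a hook in terms of Koszul vectors\<close>

definition SV :: "nat \<Rightarrow> nat \<Rightarrow> nat \<Rightarrow> (nat multiset list \<Rightarrow> 'k::field) set"
  where "SV q i n = fun_space.span (KB q ` KI q i n)"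

abbreviation Sf :: "nat \<Rightarrow> nat \<Rightarrow> (nat multiset list, 'k::field) spf"
  where "Sf q i \<equiv> schur_functor (hk q i)"

abbreviation Wf :: "nat \<Rightarrow> nat \<Rightarrow> (nat multiset list \<Rightarrow> 'k, 'k::field) spf"
  where "Wf q i \<equiv> weyl_functor (hk q i)"

text \<open>The sum runs over the basis of the exterior tensor that its self-duality treats as
  orthonormal. That this is the composite defining the simple functor is the content of
  \<open>simple_map\<close>.\<close>

definition theta :: "nat \<Rightarrow> nat \<Rightarrow> nat \<Rightarrow> ((nat multiset list \<Rightarrow> 'k) \<Rightarrow> 'k::field) \<Rightarrow> nat multiset list \<Rightarrow> 'k"
  where "theta q i n f = (\<Sum>x\<in>KI q i n. f (KB q x) *\<^sub>f KB q x)"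

definition FV :: "nat \<Rightarrow> nat \<Rightarrow> nat \<Rightarrow> (nat multiset list \<Rightarrow> 'k::field) set"
  where "FV q i n = theta q i n ` dual_space (SV q i n)"

lemma val_ext: "val (spf_of (ext_tensor (hk q i)) :: (_, 'k::field) spf) n = supported (xlab ` KI q i n)"
  unfolding idx_ext_hk[where ?'k = 'k, symmetric] by (simp add: spf_of_def supported_def)

lemma schur_map_unit_vec:
  assumes "x \<in> KI q i n"
  shows "schur_map (hk q i) n (unit_vec (xlab x)) = (KB q x :: _ \<Rightarrow> 'k::field)"
proof -
  have "unit_vec (xlab x) \<in> val (spf_of (ext_tensor (hk q i)) :: (_, 'k) spf) n"
    unfolding val_ext using assms by (intro unit_vec_supported imageI)
  then have "schur_map (hk q i) n (unit_vec (xlab x)) =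
    (\<Sum>y\<in>KI q i n. unit_vec (xlab x) (xlab y) *\<^sub>f KB q y :: _ \<Rightarrow> 'k)"
    by (rule schur_map_hk)
  also have "\<dots> = (\<Sum>y\<in>KI q i n. if y = x then KB q y else 0)"
    by (intro sum.cong refl) (auto simp: unit_vec_def inj_eq[OF inj_xlab])
  also have "\<dots> = KB q x" using assms by simp
  finally show ?thesis .
qed

lemma val_Sf: "val (Sf q i) n = (SV q i n :: (_ \<Rightarrow> 'k::field) set)"
proof -
  let ?V = "val (spf_of (ext_tensor (hk q i)) :: (_, 'k) spf) n"
  let ?L = "\<lambda>v :: _ \<Rightarrow> 'k. \<Sum>x\<in>KI q i n. v (xlab x) *\<^sub>f KB q x"
  have "val (Sf q i) n = schur_map (hk q i) n ` ?V"
    by (simp add: schur_functor_def image_spf_def)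
  also have "\<dots> = ?L ` ?V" by (rule image_cong) (simp_all add: schur_map_hk)
  also have "\<dots> = ?L ` fun_space.span (unit_vec ` xlab ` KI q i n)"
    by (simp add: val_ext supported_eq_span)
  also have "\<dots> = fun_space.span (?L ` unit_vec ` xlab ` KI q i n)"
    by (rule flinear_image_span) (rule flinear_combination)
  also have "?L ` unit_vec ` xlab ` KI q i n = KB q ` KI q i n"
  proof -
    have "?L (unit_vec (xlab x)) = KB q x" if x: "x \<in> KI q i n" for x
    proof -
      have u: "unit_vec (xlab x) \<in> ?V"
        unfolding val_ext using x by (intro unit_vec_supported imageI)
      show ?thesis by (rule trans[OF schur_map_hk[OF u, symmetric] schur_map_unit_vec[OF x]])
    qed
    then show ?thesis unfolding image_image by (intro image_cong refl)
  qed
  finally show ?thesis by (simp add: SV_def)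
qed

lemma coef_Sf: "coef (Sf q i) = coef (symf (Suc q) i)"
  by (simp add: schur_functor_def image_spf_def conjugate_hk symf_def)

lemma subspace_SV [simp]: "fun_space.subspace (SV q i n)"
  by (simp add: SV_def)

lemma KB_in_SV: "x \<in> KI q i n \<Longrightarrow> KB q x \<in> SV q i n"
  by (auto simp: SV_def intro: fun_space.span_base)

lemma K_in_SV:
  assumes "a \<in> words (Suc i) n" "b \<in> words q n"
  shows "K q a b \<in> SV q i n"
proof (cases "distinct a")
  case True
  then have "(set a, b) \<in> KI q i n" using assms by (simp add: KI_def words_def distinct_card)
  moreover have "K q a b = word_sign a *\<^sub>f KB q (set a, b)"
    using K_sorted[of "set a" a q b] True by auto
  ultimately show ?thesis using KB_in_SV by (metis fun_space.subspace_scale subspace_SV)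
qed (simp add: K_not_distinct fun_space.subspace_0)

lemma sorted_words: "A \<subseteq> {..<n} \<Longrightarrow> card A = l \<Longrightarrow> sorted_list_of_set A \<in> words l n"
  using finite_subset[of A "{..<n}"] by (simp add: words_def)

lemma KI_words: "x \<in> KI q i n \<Longrightarrow> sorted_list_of_set (fst x) \<in> words (Suc i) n \<and> snd x \<in> words q n"
  by (auto simp: KI_def sorted_words)

lemma SV_span_words: "SV q i n = fun_space.span {K q a b | a b. a \<in> words (Suc i) n \<and> b \<in> words q n}"
proof
  show "SV q i n \<subseteq> fun_space.span {K q a b | a b. a \<in> words (Suc i) n \<and> b \<in> words q n}"
    unfolding SV_def using KI_words[of _ q i n] by (intro fun_space.span_mono) blast
  show "fun_space.span {K q a b | a b. a \<in> words (Suc i) n \<and> b \<in> words q n} \<subseteq> SV q i n"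
    by (rule fun_space.span_minimal) (auto simp: K_in_SV)
qed

lemma coef_K:
  assumes "a \<in> words (Suc i) m" "b \<in> words q m"
  shows "coef (symf (Suc q) i) m n (mm Z) (K q a b) =
    (\<Sum>I | I \<in> words (Suc i + q) n \<and> mset (zip I (a @ b)) = Z. K q (take (Suc i) I) (drop (Suc i) I))"
proof -
  have "a @ b \<in> words (Suc q + i) m" using append_words[OF assms] by (simp add: add.commute)
  then have 1: "coef (symf (Suc q) i) m n (mm Z) (K q (take (Suc i) (a @ b)) (drop (Suc i) (a @ b))) =
    (\<Sum>I | I \<in> words (Suc q + i) n \<and> mset (zip I (a @ b)) = Z. K q (take (Suc i) I) (drop (Suc i) I))"
    by (rule naturalD[OF natural_K])
  have 2: "take (Suc i) (a @ b) = a" "drop (Suc i) (a @ b) = b"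
    using wordsD(1)[OF assms(1)] by simp_all
  have 3: "Suc q + i = Suc i + q" by simp
  show ?thesis using 1 unfolding 2 3 .
qed

lemma coef_SV:
  assumes "v \<in> SV q i m"
  shows "coef (symf (Suc q) i) m n \<alpha> v \<in> SV q i n"
proof -
  obtain Z where Z: "\<alpha> = mm Z" using ex_mm by blast
  have "SV q i m \<subseteq> coef (symf (Suc q) i) m n \<alpha> -` SV q i n"
    unfolding SV_span_words[of q i m]
  proof (rule fun_space.span_minimal)
    show "fun_space.subspace (coef (symf (Suc q) i) m n \<alpha> -` SV q i n)"
      by (rule module_hom.subspace_vimage[OF flinear_coef_symf]) simp
    show "{K q a b | a b. a \<in> words (Suc i) m \<and> b \<in> words q m} \<subseteq> coef (symf (Suc q) i) m n \<alpha> -` SV q i n"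
      unfolding Z by (auto simp: coef_K intro!: fun_space.subspace_sum K_in_SV take_words drop_words)
  qed
  then show ?thesis using assms by auto
qed

lemma E_in_val: "J \<in> words (r + i) n \<Longrightarrow> E r J \<in> val (symf r i) n"
  by (auto simp: val_symf_span intro: fun_space.span_base)

lemma subspace_val_symf: "fun_space.subspace (val (symf r i) n)"
  by (simp add: val_symf subspace_supported)

lemma K_in_val:
  assumes "a \<in> words (Suc i) n" "b \<in> words q n"
  shows "K q a b \<in> val (symf (Suc q) i) n"
  unfolding K_def altsum_def
proof (intro fun_space.subspace_sum subspace_val_symf fun_space.subspace_scale E_in_val)
  fix I assume "I \<in> perms (length a)"
  then have "place a I \<in> words (Suc i) n"
    using assms by (intro place_words) (simp_all add: wordsD)
  then obtain y u where "place a I = y # u" "y < n" "u \<in> words i n"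
    by (auto simp: words_def length_Suc_conv)
  then show "hd (place a I) # b @ tl (place a I) \<in> words (Suc q + i) n"
    using assms by (auto simp: words_def)
qed

lemma SV_subset_val: "SV q i n \<subseteq> val (symf (Suc q) i) n"
  unfolding SV_span_words by (rule fun_space.span_minimal) (auto simp: K_in_val subspace_val_symf)

lemma subfunctor_Sf: "subfunctor (Sf q i) (symf (Suc q) i)"
  unfolding subfunctor_def val_Sf coef_Sf using SV_subset_val coef_SV by auto

lemma strict_polynomial_Sf: "strict_polynomial (Suc q + i) (Sf q i)"
  by (rule strict_polynomial_sub[OF strict_polynomial_symf subfunctor_Sf])

lemma strict_polynomial_Wf: "strict_polynomial (Suc q + i) (Wf q i)"
  unfolding weyl_functor_def by (rule strict_polynomial_kuhn_dual[OF strict_polynomial_Sf])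

lemma val_Wf: "val (Wf q i) n = dual_space (SV q i n)"
  by (simp add: weyl_functor_def kuhn_dual_def val_Sf)

lemma coef_Wf: "coef (Wf q i) m n \<alpha> f =
    (\<lambda>v. if v \<in> SV q i n then f (coef (symf (Suc q) i) n m (mono_transpose \<alpha>) v) else 0)"
  unfolding weyl_functor_def kuhn_dual_def coef_Sf val_Sf by (simp add: val_Sf coef_Sf)

lemma coef_Wf_closed:
  fixes f :: "(nat multiset list \<Rightarrow> 'k::field) \<Rightarrow> 'k"
  assumes "f \<in> dual_space (SV q i m)"
  shows "coef (Wf q i) m n \<alpha> f \<in> dual_space (SV q i n)"
proof -
  have "strict_polynomial (Suc q + i) (Wf q i :: (_, 'k) spf)" by (rule strict_polynomial_Wf)
  then have "linear_between (val (Wf q i :: (_, 'k) spf) m) (val (Wf q i) n) (coef (Wf q i) m n \<alpha>)"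
    unfolding strict_polynomial_def by blast
  then show ?thesis using assms by (auto simp: linear_between_def val_Wf)
qed

lemma simple_map:
  fixes f :: "(nat multiset list \<Rightarrow> 'k::field) \<Rightarrow> 'k"
  shows "schur_map (hk q i) n (weyl_incl (hk q i) n f) = theta q i n f"
proof -
  let ?T = "spf_of (ext_tensor (hk q i)) :: (_, 'k) spf"
  have w: "weyl_incl (hk q i) n f = (\<lambda>A. if A \<in> xlab ` KI q i n
      then kuhn_dual_map ?T (schur_map (hk q i)) n f (unit_vec A) else 0)"
    by (simp add: weyl_incl_def ext_self_dual_def idx_ext_hk)
  then have "weyl_incl (hk q i) n f \<in> val ?T n" by (simp add: val_ext supported_def)
  then have "schur_map (hk q i) n (weyl_incl (hk q i) n f) =
    (\<Sum>x\<in>KI q i n. weyl_incl (hk q i) n f (xlab x) *\<^sub>f KB q x)"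
    by (rule schur_map_hk)
  also have "\<dots> = theta q i n f"
    unfolding theta_def
  proof (intro sum.cong refl)
    fix x assume x: "x \<in> KI q i n"
    then have "unit_vec (xlab x) \<in> val ?T n" by (simp add: val_ext unit_vec_supported)
    then have "weyl_incl (hk q i) n f (xlab x) = f (KB q x)"
      using x by (simp add: w kuhn_dual_map_def schur_map_unit_vec)
    then show "weyl_incl (hk q i) n f (xlab x) *\<^sub>f KB q x = f (KB q x) *\<^sub>f KB q x" by simp
  qed
  finally show ?thesis .
qed

lemma val_simple: "val (simple_functor (hk q i)) n = FV q i n"
  by (simp add: simple_functor_def image_spf_def simple_map val_Wf FV_def)

lemma coef_simple: "coef (simple_functor (hk q i)) = coef (symf (Suc q) i)"
  by (simp add: simple_functor_def image_spf_def coef_Sf)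

section \<open>The map from the Weyl functor to the Schur functor\<close>

lemma flinear_theta: "flinear (theta q i n)"
  unfolding theta_def by (rule flinear_combination)

lemma theta_in_SV: "theta q i n f \<in> SV q i n"
  unfolding theta_def by (intro fun_space.subspace_sum fun_space.subspace_scale KB_in_SV) simp_all

lemma theta_symmetric:
  assumes "f \<in> dual_space (SV q i n)" "g \<in> dual_space (SV q i n)"
  shows "g (theta q i n f) = f (theta q i n g)"
proof -
  have "g (theta q i n f) = (\<Sum>x\<in>KI q i n. f (KB q x) * g (KB q x))"
    unfolding theta_def by (rule dual_space_sum[OF assms(2)]) (simp_all add: KB_in_SV)
  moreover have "f (theta q i n g) = (\<Sum>x\<in>KI q i n. g (KB q x) * f (KB q x))"
    unfolding theta_def by (rule dual_space_sum[OF assms(1)]) (simp_all add: KB_in_SV)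
  ultimately show ?thesis by (simp add: mult.commute)
qed

text \<open>The coefficient of the monomial \<open>Z\<close> in a minor of the generic matrix, times a monomial.\<close>

definition minor :: "nat \<Rightarrow> (nat \<times> nat) multiset \<Rightarrow> nat set \<times> nat list \<Rightarrow> nat set \<times> nat list \<Rightarrow> 'k::field"
  where "minor i Z y x = (\<Sum>I\<in>perms (Suc i). if mset (zip (place (sorted_list_of_set (fst y)) I) (sorted_list_of_set (fst x)))
    + mset (zip (snd y) (snd x)) = Z then word_sign I else 0)"

text \<open>As for the determinant of a transpose: every permutation is replaced by its inverse,
  which has the same sign and gives the same pairs in reversed order.\<close>

lemma minor_transpose:
  assumes "x \<in> KI q i m" "y \<in> KI q i n"
  shows "minor i (image_mset prod.swap Z) x y = (minor i Z y x :: 'k::field)"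
proof -
  let ?a = "sorted_list_of_set (fst x)" and ?b = "sorted_list_of_set (fst y)"
  have len: "length ?a = Suc i" "length ?b = Suc i" "length (snd x) = length (snd y)"
    using KI_words[OF assms(1)] KI_words[OF assms(2)] wordsD(1) by metis+
  have "bij_betw inv_word (perms (Suc i)) (perms (Suc i))"
    by (rule bij_betwI[of _ _ _ inv_word]) (auto simp: inv_word_perms inv_word_inv_word)
  then have "minor i Z y x = (\<Sum>I\<in>perms (Suc i). if mset (zip (place ?b (inv_word I)) ?a)
    + mset (zip (snd y) (snd x)) = Z then word_sign (inv_word I) else 0 :: 'k)"
    unfolding minor_def by (rule sum.reindex_bij_betw[symmetric])
  also have "\<dots> = minor i (image_mset prod.swap Z) x y"
    unfolding minor_def
  proof (intro sum.cong refl)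
    fix I assume I: "I \<in> perms (Suc i)"
    have "mset (zip (place ?b (inv_word I)) ?a) = mset (zip ?b (place ?a I))"
      using zip_place_inv_word[OF inv_word_perms[OF I] len(2,1)] inv_word_inv_word[OF I] by simp
    then have "mset (zip (place ?a I) ?b) + mset (zip (snd x) (snd y)) =
      image_mset prod.swap (mset (zip (place ?b (inv_word I)) ?a) + mset (zip (snd y) (snd x)))"
      by (simp add: mset_zip_swap)
    then have "mset (zip (place ?a I) ?b) + mset (zip (snd x) (snd y)) = image_mset prod.swap Z \<longleftrightarrow>
      mset (zip (place ?b (inv_word I)) ?a) + mset (zip (snd y) (snd x)) = Z"
      by (metis image_mset_swap_eq_iff)
    then show "(if mset (zip (place ?b (inv_word I)) ?a) + mset (zip (snd y) (snd x)) = Z then word_sign (inv_word I) else 0) =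
      (if mset (zip (place ?a I) ?b) + mset (zip (snd x) (snd y)) = image_mset prod.swap Z then word_sign I else 0 :: 'k)"
      by (simp add: word_sign_inv_word[OF I])
  qed
  finally show ?thesis by simp
qed

text \<open>Groups the words in \<open>coef_K\<close> by the set of letters of their alternating
  part; the signs of the arrangements of each set collect to a minor.\<close>

lemma coef_KB:
  assumes x: "x \<in> KI q i m"
  shows "coef (symf (Suc q) i) m n (mm Z) (KB q x) = (\<Sum>y\<in>KI q i n. minor i Z y x *\<^sub>f KB q y :: _ \<Rightarrow> 'k::field)"
proof -
  let ?a = "sorted_list_of_set (fst x)" and ?b = "snd x"
  let ?S = "{A. A \<subseteq> {..<n} \<and> card A = Suc i}"
  let ?P = "\<lambda>a' b'. mset (zip a' ?a) + mset (zip b' ?b) = Z"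
  have w: "?a \<in> words (Suc i) m" "?b \<in> words q m" using KI_words[OF x] by auto
  have "coef (symf (Suc q) i) m n (mm Z) (KB q x) =
    (\<Sum>I\<in>words (Suc i + q) n. if mset (zip I (?a @ ?b)) = Z then K q (take (Suc i) I) (drop (Suc i) I) else 0 :: _ \<Rightarrow> 'k)"
    unfolding coef_K[OF w] sum.inter_filter[OF finite_words] ..
  also have "\<dots> = (\<Sum>a'\<in>words (Suc i) n. \<Sum>b'\<in>words q n. if ?P a' b' then K q a' b' else 0)"
    unfolding sum_words_append
  proof (intro sum.cong refl)
    fix a' b' assume "a' \<in> words (Suc i) n" "b' \<in> words q n"
    then have "zip (a' @ b') (?a @ ?b) = zip a' ?a @ zip b' ?b"
      using w by (intro zip_append) (metis wordsD(1))
    then show "(if mset (zip (a' @ b') (?a @ ?b)) = Z then K q (take (Suc i) (a' @ b')) (drop (Suc i) (a' @ b')) else 0) =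
      (if ?P a' b' then K q a' b' else 0 :: _ \<Rightarrow> 'k)"
      using wordsD(1)[OF \<open>a' \<in> words (Suc i) n\<close>] by simp
  qed
  also have "\<dots> = (\<Sum>A\<in>?S. \<Sum>a'\<in>permutations_of_set A. \<Sum>b'\<in>words q n. if ?P a' b' then K q a' b' else 0)"
    by (rule sum_distinct_words) (auto simp: K_not_distinct intro!: sum.neutral)
  also have "\<dots> = (\<Sum>A\<in>?S. \<Sum>b'\<in>words q n. minor i Z (A, b') x *\<^sub>f KB q (A, b'))"
  proof (rule sum.cong[OF refl])
    fix A assume "A \<in> ?S"
    then have A: "finite A" "card A = Suc i" by (auto intro: finite_subset)
    let ?s = "sorted_list_of_set A"
    have "(\<Sum>a'\<in>permutations_of_set A. \<Sum>b'\<in>words q n. if ?P a' b' then K q a' b' else 0) =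
      (\<Sum>I\<in>perms (Suc i). \<Sum>b'\<in>words q n. if ?P (place ?s I) b' then K q (place ?s I) b' else 0 :: _ \<Rightarrow> 'k)"
      by (rule sum.reindex_bij_betw[symmetric]) (use bij_betw_place_sorted[OF A(1)] A(2) in simp)
    also have "\<dots> = (\<Sum>I\<in>perms (Suc i). \<Sum>b'\<in>words q n. (if ?P (place ?s I) b' then word_sign I else 0) *\<^sub>f KB q (A, b'))"
      using A by (intro sum.cong refl) (simp add: K_def altsum_place)
    also have "\<dots> = (\<Sum>b'\<in>words q n. \<Sum>I\<in>perms (Suc i). (if ?P (place ?s I) b' then word_sign I else 0) *\<^sub>f KB q (A, b'))"
      by (rule sum.swap)
    also have "\<dots> = (\<Sum>b'\<in>words q n. minor i Z (A, b') x *\<^sub>f KB q (A, b'))"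
      by (simp add: minor_def fun_space.scale_sum_left)
    finally show "(\<Sum>a'\<in>permutations_of_set A. \<Sum>b'\<in>words q n. if ?P a' b' then K q a' b' else 0) =
      (\<Sum>b'\<in>words q n. minor i Z (A, b') x *\<^sub>f KB q (A, b') :: _ \<Rightarrow> 'k)" .
  qed
  also have "\<dots> = (\<Sum>y\<in>KI q i n. minor i Z y x *\<^sub>f KB q y)"
    by (simp add: KI_def sum.cartesian_product case_prod_unfold)
  finally show ?thesis .
qed

text \<open>The Kuhn dual acts through the transposed monomial, and \<open>minor_transpose\<close>
  turns the resulting coefficients back into those of the Schur functor.\<close>

lemma theta_natural:
  assumes f: "f \<in> dual_space (SV q i m)"
  shows "theta q i n (coef (Wf q i) m n \<alpha> f) = coef (symf (Suc q) i) m n \<alpha> (theta q i m f)"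
proof -
  obtain Z where Z: "\<alpha> = mm Z" using ex_mm by blast
  let ?Z = "image_mset prod.swap Z"
  have "theta q i n (coef (Wf q i) m n \<alpha> f) =
    (\<Sum>y\<in>KI q i n. f (coef (symf (Suc q) i) n m (mm ?Z) (KB q y)) *\<^sub>f KB q y)"
    unfolding theta_def by (intro sum.cong refl) (simp add: coef_Wf KB_in_SV Z)
  also have "\<dots> = (\<Sum>y\<in>KI q i n. \<Sum>x\<in>KI q i m. (minor i Z y x * f (KB q x)) *\<^sub>f KB q y)"
  proof (intro sum.cong refl)
    fix y assume y: "y \<in> KI q i n"
    have "f (coef (symf (Suc q) i) n m (mm ?Z) (KB q y)) = (\<Sum>x\<in>KI q i m. minor i ?Z x y * f (KB q x))"
      unfolding coef_KB[OF y] by (rule dual_space_sum[OF f]) (simp_all add: KB_in_SV)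
    also have "\<dots> = (\<Sum>x\<in>KI q i m. minor i Z y x * f (KB q x))"
      by (intro sum.cong refl) (simp add: minor_transpose[OF _ y])
    finally show "f (coef (symf (Suc q) i) n m (mm ?Z) (KB q y)) *\<^sub>f KB q y =
      (\<Sum>x\<in>KI q i m. (minor i Z y x * f (KB q x)) *\<^sub>f KB q y)"
      by (simp add: fun_space.scale_sum_left)
  qed
  also have "\<dots> = (\<Sum>x\<in>KI q i m. \<Sum>y\<in>KI q i n. (minor i Z y x * f (KB q x)) *\<^sub>f KB q y)"
    by (rule sum.swap)
  also have "\<dots> = (\<Sum>x\<in>KI q i m. f (KB q x) *\<^sub>f coef (symf (Suc q) i) m n \<alpha> (KB q x))"
    unfolding Z by (intro sum.cong refl) (simp add: coef_KB fun_space.scale_sum_right mult.commute)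
  also have "\<dots> = coef (symf (Suc q) i) m n \<alpha> (theta q i m f)"
    by (simp add: theta_def flinear_sum[OF flinear_coef_symf] flinear_scale[OF flinear_coef_symf])
  finally show ?thesis .
qed

lemma subspace_FV [simp]: "fun_space.subspace (FV q i n)"
  unfolding FV_def by (rule module_hom.subspace_image[OF flinear_theta subspace_dual_space])

lemma FV_subset_SV: "FV q i n \<subseteq> SV q i n"
  by (auto simp: FV_def theta_in_SV)

lemma coef_FV: "v \<in> FV q i m \<Longrightarrow> coef (symf (Suc q) i) m n \<alpha> v \<in> FV q i n"
  by (auto simp: FV_def theta_natural[symmetric] intro!: imageI coef_Wf_closed)

lemma strict_polynomial_simple: "strict_polynomial (Suc q + i) (simple_functor (hk q i))"
proof (rule strict_polynomial_sub[OF strict_polynomial_Sf])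
  show "subfunctor (simple_functor (hk q i)) (Sf q i)"
    unfolding subfunctor_def val_simple coef_simple val_Sf coef_Sf using FV_subset_SV coef_FV by auto
qed

section \<open>Highest weight vectors\<close>

text \<open>The word of the highest weight: the letter 0 fills the symmetric part, and
  \<open>1, ..., i\<close> stand in the alternating slots. The coordinate of \<open>v0\<close> at
  its label is 1.\<close>

definition J0 :: "nat \<Rightarrow> nat \<Rightarrow> nat list"
  where "J0 q i = replicate (Suc q) 0 @ [1..<Suc i]"

definition v0 :: "nat \<Rightarrow> nat \<Rightarrow> nat multiset list \<Rightarrow> 'k::field"
  where "v0 q i = K q [0..<Suc i] (replicate q 0)"

text \<open>The coordinate forms, cut off outside the Schur functor as \<open>dual_space\<close>
  demands. They span the Weyl functor by \<open>dual_SV_eps\<close>.\<close>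

definition eps :: "nat \<Rightarrow> nat \<Rightarrow> nat \<Rightarrow> nat multiset list \<Rightarrow> (nat multiset list \<Rightarrow> 'k::field) \<Rightarrow> 'k"
  where "eps q i n L = (\<lambda>v. if v \<in> SV q i n then v L else 0)"

lemma J0_words: "J0 q i \<in> words (Suc q + i) (Suc i)"
  by (auto simp: J0_def words_def)

lemma eps_dual: "eps q i n L \<in> dual_space (SV q i n)"
  unfolding dual_space_iff eps_def
  by (auto simp: fun_space.subspace_add fun_space.subspace_scale) (simp add: fscale_apply)

lemma v0_in_SV: "v0 q i \<in> SV q i (Suc i)"
  unfolding v0_def by (rule K_in_SV) (auto simp: words_def)

lemma lab_eq_J0: "length I = Suc q + i \<Longrightarrow> lab (Suc q) I = lab (Suc q) (J0 q i) \<longleftrightarrow> I = J0 q i"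
proof
  assume len: "length I = Suc q + i" and eq: "lab (Suc q) I = lab (Suc q) (J0 q i)"
  then have m: "mset (take (Suc q) I) = mset (replicate (Suc q) 0)" and d: "drop (Suc q) I = [1..<Suc i]"
    unfolding lab_eq_iff J0_def by (simp_all del: replicate_Suc upt_Suc)
  have "set (take (Suc q) I) = {0}" using mset_eq_setD[OF m] by (auto simp: set_replicate_conv_if)
  then have "take (Suc q) I = replicate (Suc q) 0"
    using len by (intro replicate_eqI) auto
  then show "I = J0 q i" using d unfolding J0_def by (metis append_take_drop_id)
qed simp

text \<open>Pairing with the \<open>Suc q\<close> zeros of \<open>J0\<close> remembers a multiset,
  and pairing with the distinct nonzero letters remembers each later letter with its place. This is
  the information in a label.\<close>

lemma zip_J0_eq_iff:
  assumes "length J = Suc q + i" "length J' = Suc q + i"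
  shows "mset (zip (J0 q i) J) = mset (zip (J0 q i) J') \<longleftrightarrow> lab (Suc q) J = lab (Suc q) J'"
proof -
  have z: "mset (zip (J0 q i) J) = image_mset (Pair 0) (mset (take (Suc q) J)) + mset (zip [1..<Suc i] (drop (Suc q) J))"
    if "length J = Suc q + i" for J
  proof -
    have "zip (J0 q i) J = zip (replicate (Suc q) 0) (take (Suc q) J) @ zip [1..<Suc i] (drop (Suc q) J)"
      unfolding J0_def using that by (simp add: zip_append1 del: upt_Suc replicate_Suc)
    moreover have "zip (replicate (Suc q) (0 :: nat)) (take (Suc q) J) = map (Pair 0) (take (Suc q) J)"
      using that by (simp add: zip_replicate1 del: replicate_Suc)
    ultimately show ?thesis by (simp del: replicate_Suc upt_Suc)
  qed
  show ?thesis
  proof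
    assume eq: "mset (zip (J0 q i) J) = mset (zip (J0 q i) J')"
    have nz: "filter_mset (\<lambda>x. fst x = 0) (mset (zip [1..<Suc i] c)) = {#}" for c :: "nat list"
    proof -
      have "filter (\<lambda>x. fst x = 0) (zip [1..<Suc i] c) = []"
        by (auto simp: filter_empty_conv dest!: set_zip_leftD simp del: upt_Suc)
      then show ?thesis by (metis mset.simps(1) mset_filter)
    qed
    have "mset (take (Suc q) J) = image_mset snd (filter_mset (\<lambda>x. fst x = 0) (mset (zip (J0 q i) J)))"
      "mset (take (Suc q) J') = image_mset snd (filter_mset (\<lambda>x. fst x = 0) (mset (zip (J0 q i) J')))"
      unfolding z[OF assms(1)] z[OF assms(2)] filter_union_mset nz
      by (simp_all add: filter_mset_image_mset multiset.map_comp comp_def)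
    then have 1: "mset (take (Suc q) J) = mset (take (Suc q) J')" using eq by simp
    then have "mset (zip [1..<Suc i] (drop (Suc q) J)) = mset (zip [1..<Suc i] (drop (Suc q) J'))"
      using eq unfolding z[OF assms(1)] z[OF assms(2)] by simp
    then have s: "set (zip [1..<Suc i] (drop (Suc q) J)) = set (zip [1..<Suc i] (drop (Suc q) J'))"
      by (rule mset_eq_setD)
    have "drop (Suc q) J = drop (Suc q) J'"
    proof (rule nth_equalityI)
      fix k assume k: "k < length (drop (Suc q) J)"
      then have "k < i" using assms by simp
      then have "(Suc k, drop (Suc q) J ! k) \<in> set (zip [1..<Suc i] (drop (Suc q) J))"
        using assms by (auto simp: set_zip intro!: exI[of _ k] simp del: upt_Suc)
      then have "(Suc k, drop (Suc q) J ! k) \<in> set (zip [1..<Suc i] (drop (Suc q) J'))" using s by simp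
      then show "drop (Suc q) J ! k = drop (Suc q) J' ! k"
        using assms by (auto simp: set_zip simp del: upt_Suc)
    qed (use assms in simp)
    then show "lab (Suc q) J = lab (Suc q) J'" using 1 by (simp add: lab_eq_iff)
  next
    assume "lab (Suc q) J = lab (Suc q) J'"
    then show "mset (zip (J0 q i) J) = mset (zip (J0 q i) J')"
      unfolding z[OF assms(1)] z[OF assms(2)] by (simp add: lab_eq_iff)
  qed
qed

lemma flinear_apply_eq_on_span:
  assumes "flinear f" "flinear g" "\<And>x. x \<in> B \<Longrightarrow> f x L = g x M" "x \<in> fun_space.span B"
  shows "f x L = g x M"
proof -
  have f: "flinear (\<lambda>v (_ :: unit). f v L)"
    by (rule flinearI; rule ext) (simp_all add: flinear_add[OF assms(1)] flinear_scale[OF assms(1)] fscale_apply)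
  have g: "flinear (\<lambda>v (_ :: unit). g v M)"
    by (rule flinearI; rule ext) (simp_all add: flinear_add[OF assms(2)] flinear_scale[OF assms(2)] fscale_apply)
  note * = f g
  have "(\<lambda>_ :: unit. f x L) = (\<lambda>_. g x M)"
    by (rule flinear_eq_on_span[OF *(1) *(2) _ assms(4)]) (simp add: assms(3))
  then show ?thesis by (rule fun_cong)
qed

text \<open>Among all words only \<open>J0\<close> has the label of \<open>J0\<close>, and by
  \<open>zip_J0_eq_iff\<close> it is reached only from words with the label of
  \<open>J\<close>.\<close>

lemma coef_J0_coordinate:
  assumes J: "J \<in> words (Suc q + i) n" and v: "v \<in> SV q i n"
  shows "coef (symf (Suc q) i) n (Suc i) (mm (mset (zip (J0 q i) J))) v (lab (Suc q) (J0 q i)) = (v (lab (Suc q) J) :: 'k::field)"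
proof (rule flinear_apply_eq_on_span[OF flinear_coef_symf flinear_ident])
  show "v \<in> fun_space.span (E (Suc q) ` words (Suc q + i) n)"
    using v SV_subset_val val_symf_span by blast
  fix x :: "nat multiset list \<Rightarrow> 'k" assume "x \<in> E (Suc q) ` words (Suc q + i) n"
  then obtain J' where J': "J' \<in> words (Suc q + i) n" "x = E (Suc q) J'" by blast
  let ?W = "words (Suc q + i) (Suc i)"
  have "coef (symf (Suc q) i) n (Suc i) (mm (mset (zip (J0 q i) J))) x (lab (Suc q) (J0 q i)) =
    (\<Sum>I\<in>?W. if mset (zip I J') = mset (zip (J0 q i) J) then E (Suc q) I (lab (Suc q) (J0 q i)) else 0)"
    unfolding J'(2) coef_symf_E[OF J'(1)] fscale_sum_apply unfolding sum.inter_filter[OF finite_words] ..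
  also have "\<dots> = (\<Sum>I\<in>?W. if I = J0 q i then (if lab (Suc q) J' = lab (Suc q) J then 1 else 0) else 0)"
  proof (intro sum.cong refl)
    fix I assume "I \<in> ?W"
    then have "E (Suc q) I (lab (Suc q) (J0 q i)) = (if I = J0 q i then 1 else 0 :: 'k)"
      by (simp add: E_def unit_vec_def eq_commute[of "lab (Suc q) (J0 q i)"] lab_eq_J0 wordsD(1))
    moreover have "mset (zip (J0 q i) J') = mset (zip (J0 q i) J) \<longleftrightarrow> lab (Suc q) J' = lab (Suc q) J"
      by (rule zip_J0_eq_iff) (use wordsD(1)[OF J] wordsD(1)[OF J'(1)] in simp_all)
    ultimately show "(if mset (zip I J') = mset (zip (J0 q i) J) then E (Suc q) I (lab (Suc q) (J0 q i)) else 0) =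
      (if I = J0 q i then (if lab (Suc q) J' = lab (Suc q) J then 1 else 0) else 0 :: 'k)"
      by (cases "I = J0 q i") simp_all
  qed
  also have "\<dots> = x (lab (Suc q) J)"
    using J0_words J'(2) by (auto simp: E_def unit_vec_def)
  finally show "coef (symf (Suc q) i) n (Suc i) (mm (mset (zip (J0 q i) J))) x (lab (Suc q) (J0 q i)) = x (lab (Suc q) J)" .
qed

lemma K_J0:
  assumes "length b = q"
  shows "K q [0..<Suc i] b (lab (Suc q) (J0 q i)) = (if b = replicate q 0 then 1 else 0 :: 'k::field)"
proof -
  have "K q [0..<Suc i] b (lab (Suc q) (J0 q i)) =
    (\<Sum>I\<in>perms (Suc i). if I = [0..<Suc i] then (if b = replicate q 0 then 1 else 0) else 0 :: 'k)"
    unfolding K_def altsum_def fscale_sum_apply length_upt diff_zero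
  proof (intro sum.cong refl)
    fix I assume I: "I \<in> perms (Suc i)"
    have p: "place [0..<Suc i] I = I"
      using permsD[OF I] unfolding place_def by (intro map_idI) (metis add_0 lessThan_iff nth_upt)
    obtain x I' where xI: "I = x # I'" using permsD[OF I] by (metis length_Suc_conv)
    then have len: "length I' = i" using permsD[OF I] by simp
    have "lab (Suc q) (hd I # b @ tl I) = lab (Suc q) (J0 q i) \<longleftrightarrow> hd I # b @ tl I = J0 q i"
      by (rule lab_eq_J0) (simp add: assms xI len)
    also have "\<dots> \<longleftrightarrow> x = 0 \<and> b = replicate q 0 \<and> I' = [1..<Suc i]"
      using assms by (simp add: J0_def xI del: upt_Suc)
    also have "\<dots> \<longleftrightarrow> I = [0..<Suc i] \<and> b = replicate q 0"
      by (auto simp: xI upt_rec[of 0 "Suc i"] simp del: upt_Suc)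
    finally have eq: "lab (Suc q) (hd I # b @ tl I) = lab (Suc q) (J0 q i) \<longleftrightarrow> I = [0..<Suc i] \<and> b = replicate q 0" .
    have E: "E (Suc q) (hd I # b @ tl I) (lab (Suc q) (J0 q i)) = (if I = [0..<Suc i] \<and> b = replicate q 0 then 1 else 0 :: 'k)"
      unfolding E_def unit_vec_def eq_commute[of "lab (Suc q) (J0 q i)"] eq ..
    have "word_sign [0..<Suc i] = (1 :: 'k)" by (rule word_sign_sorted) (simp del: upt_Suc)
    then show "(word_sign I *\<^sub>f E (Suc q) (hd (place [0..<Suc i] I) # b @ tl (place [0..<Suc i] I))) (lab (Suc q) (J0 q i)) =
      (if I = [0..<Suc i] then (if b = replicate q 0 then 1 else 0) else 0 :: 'k)"
      unfolding p fscale_apply E by (cases "I = [0..<Suc i]") (simp_all del: upt_Suc)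
  qed
  also have "\<dots> = (if b = replicate q 0 then 1 else 0)"
    using upt_perms[of "Suc i"] by simp
  finally show ?thesis .
qed

lemma v0_J0: "v0 q i (lab (Suc q) (J0 q i)) = 1"
  by (simp add: v0_def K_J0 del: upt_Suc)

lemma v0_nonzero: "v0 q i \<noteq> 0"
  using v0_J0[of q i] by (metis zero_fun_apply zero_neq_one)

text \<open>In dimension \<open>Suc i\<close> the alternating set must be the full one, and by
  \<open>K_J0\<close> all remaining terms except that of \<open>v0\<close> have coordinate
  0.\<close>

lemma theta_eps_J0: "theta q i (Suc i) (eps q i (Suc i) (lab (Suc q) (J0 q i))) = (v0 q i :: _ \<Rightarrow> 'k::field)"
proof -
  let ?b = "replicate q (0 :: nat)" and ?f = "eps q i (Suc i) (lab (Suc q) (J0 q i)) :: _ \<Rightarrow> 'k"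
  have A: "A = {..<Suc i}" if "A \<subseteq> {..<Suc i}" "card A = Suc i" for A
    using that by (intro card_subset_eq) auto
  have sl: "sorted_list_of_set {..<Suc i} = [0..<Suc i]"
    by (metis atLeast_upt sorted_list_of_set_sort_remdups distinct_remdups_id distinct_upt sorted_sort_id sorted_upt)
  have mem: "({..<Suc i}, ?b) \<in> KI q i (Suc i)" by (auto simp: KI_def words_def)
  have "theta q i (Suc i) ?f = (\<Sum>x\<in>KI q i (Suc i). if x = ({..<Suc i}, ?b) then v0 q i else 0)"
    unfolding theta_def
  proof (intro sum.cong refl)
    fix x assume x: "x \<in> KI q i (Suc i)"
    then obtain b where b: "x = ({..<Suc i}, b)" "length b = q" using A by (auto simp: KI_def wordsD)
    have "?f (KB q x) = KB q x (lab (Suc q) (J0 q i))" by (simp add: eps_def KB_in_SV[OF x])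
    also have kb: "KB q x = (K q [0..<Suc i] b :: _ \<Rightarrow> 'k)" by (simp only: b(1) fst_conv snd_conv sl)
    also have "K q [0..<Suc i] b (lab (Suc q) (J0 q i)) = (if b = ?b then 1 else 0 :: 'k)" by (rule K_J0[OF b(2)])
    finally show "?f (KB q x) *\<^sub>f KB q x = (if x = ({..<Suc i}, ?b) then v0 q i else 0)"
      unfolding kb unfolding v0_def b(1) by (simp del: upt_Suc lessThan_Suc)
  qed
  then show ?thesis using mem by simp
qed

lemma v0_in_FV: "v0 q i \<in> FV q i (Suc i)"
  unfolding FV_def theta_eps_J0[symmetric] by (intro imageI eps_dual)

text \<open>This holds because the weight space of \<open>v0\<close> is one-dimensional.\<close>

lemma coef_J0:
  assumes J: "J \<in> words (Suc q + i) n" and v: "v \<in> SV q i n"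
  shows "coef (symf (Suc q) i) n (Suc i) (mm (mset (zip (J0 q i) J))) v = v (lab (Suc q) J) *\<^sub>f (v0 q i :: _ \<Rightarrow> 'k::field)"
proof -
  let ?c = "coef (symf (Suc q) i) n (Suc i) (mm (mset (zip (J0 q i) J))) :: (_ \<Rightarrow> 'k) \<Rightarrow> _"
  let ?U = "fun_space.span {v0 q i :: _ \<Rightarrow> 'k}"
  \<comment> \<open>A distinct alternating part uses each of the \<open>Suc i\<close> letters once.
    In the weight of \<open>J0\<close> this leaves only zeros for the rest, so the vector is
    \<open>v0\<close> up to sign.\<close>
  have Kv: "K q (take (Suc i) I) (drop (Suc i) I) \<in> ?U" if I: "I \<in> words (Suc i + q) (Suc i)" "mset I = mset (J0 q i)" for I
  proof (cases "distinct (take (Suc i) I)")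
    case True
    let ?a = "take (Suc i) I" and ?b = "drop (Suc i) I"
    have len: "length ?a = Suc i" "length ?b = q" using wordsD(1)[OF I(1)] by simp_all
    have "set ?a \<subseteq> {..<Suc i}" using take_words[OF I(1)] by (auto simp: words_def)
    then have sa: "set ?a = {..<Suc i}"
      using True len(1) by (intro card_subset_eq) (simp_all add: distinct_card)
    then have P: "?a \<in> perms (Suc i)" using True by (simp add: perms_iff)
    have "place [0..<Suc i] ?a = ?a"
      unfolding place_def by (intro map_idI) (metis add_0 lessThan_iff nth_upt sa)
    then have K: "(K q ?a ?b :: _ \<Rightarrow> 'k) = word_sign ?a *\<^sub>f K q [0..<Suc i] ?b"
      unfolding K_def using altsum_place[of ?a "[0..<Suc i]"] P by simp
    have "mset ?a = mset [0..<Suc i]"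
      using True sa by (intro iffD1[OF set_eq_iff_mset_eq_distinct]) (simp_all only: distinct_upt atLeast_upt)
    moreover have "mset ?a + mset ?b = mset (J0 q i)"
      unfolding I(2)[symmetric] by (metis append_take_drop_id mset_append)
    moreover have "mset (J0 q i) = mset [0..<Suc i] + mset (replicate q 0)"
      by (simp add: J0_def upt_rec[of 0 "Suc i"] del: upt_Suc)
    ultimately have mb: "mset ?b = mset (replicate q 0)" by (metis add_left_cancel)
    have "set ?b \<subseteq> {0}" using mset_eq_setD[OF mb] by (auto simp: set_replicate_conv_if)
    then have "?b = replicate q 0" using len(2) by (intro replicate_eqI) auto
    then have "(K q ?a ?b :: _ \<Rightarrow> 'k) = word_sign ?a *\<^sub>f v0 q i" unfolding K v0_def by (rule arg_cong)
    then show ?thesis by (simp add: fun_space.span_base fun_space.span_scale)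
  qed (simp add: K_not_distinct fun_space.span_zero)
  have "SV q i n \<subseteq> ?c -` ?U"
    unfolding SV_span_words
  proof (rule fun_space.span_minimal)
    show "fun_space.subspace (?c -` ?U)"
      by (rule module_hom.subspace_vimage[OF flinear_coef_symf]) simp
    have "?c (K q a b) \<in> ?U" if ab: "a \<in> words (Suc i) n" "b \<in> words q n" for a b
      unfolding coef_K[OF ab]
    proof (intro fun_space.span_sum Kv)
      fix I assume I: "I \<in> {I \<in> words (Suc i + q) (Suc i). mset (zip I (a @ b)) = mset (zip (J0 q i) J)}"
      then have "image_mset fst (mset (zip I (a @ b))) = image_mset fst (mset (zip (J0 q i) J))" by simp
      then show "mset I = mset (J0 q i)"
      proof -
        have "length I = length (a @ b)"
          using wordsD(1)[of I "Suc i + q" "Suc i"] I wordsD(1)[OF ab(1)] wordsD(1)[OF ab(2)] by simp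
        moreover have "length (J0 q i) = length J" using wordsD(1)[OF J] wordsD(1)[OF J0_words] by simp
        moreover note \<open>image_mset fst (mset (zip I (a @ b))) = image_mset fst (mset (zip (J0 q i) J))\<close>
        ultimately show ?thesis by (simp only: map_fst_zip flip: mset_map)
      qed
      show "I \<in> words (Suc i + q) (Suc i)" using I by simp
    qed
    then show "{K q a b |a b. a \<in> words (Suc i) n \<and> b \<in> words q n} \<subseteq> ?c -` ?U" by auto
  qed
  then have "?c v \<in> ?U" using v by blast
  then obtain c where c: "?c v = c *\<^sub>f v0 q i" by (auto simp: fun_space.span_singleton)
  have "c = v (lab (Suc q) J)"
    using coef_J0_coordinate[OF J v] by (simp add: c fscale_def v0_J0)
  then show ?thesis using c by simp
qed

text \<open>The dual reading of \<open>coef_J0_coordinate\<close>: every coordinate form arises from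
  the one at \<open>J0\<close>, which therefore generates the Weyl functor.\<close>

lemma eps_generated:
  assumes J: "J \<in> words (Suc q + i) n"
  shows "eps q i n (lab (Suc q) J) = coef (Wf q i) (Suc i) n (mono_transpose (mm (mset (zip (J0 q i) J))))
    (eps q i (Suc i) (lab (Suc q) (J0 q i)))"
proof (rule ext)
  fix v
  show "eps q i n (lab (Suc q) J) v = coef (Wf q i) (Suc i) n (mono_transpose (mm (mset (zip (J0 q i) J))))
    (eps q i (Suc i) (lab (Suc q) (J0 q i))) v"
  proof (cases "v \<in> SV q i n")
    case True
    then have "coef (symf (Suc q) i) n (Suc i) (mm (mset (zip (J0 q i) J))) v \<in> SV q i (Suc i)"
      by (rule coef_SV)
    then show ?thesis
      unfolding coef_Wf mono_transpose_twice using True coef_J0_coordinate[OF J True] by (simp add: eps_def)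
  qed (simp add: coef_Wf eps_def)
qed

section \<open>Generation by the highest weight, and its consequences for socle and head\<close>

interpretation scalar_pair: vector_space_pair
  "fscale :: 'k::field \<Rightarrow> ('x \<Rightarrow> 'k) \<Rightarrow> 'x \<Rightarrow> 'k" "(*) :: 'k \<Rightarrow> 'k \<Rightarrow> 'k"
  by unfold_locales (auto simp: algebra_simps)

text \<open>The form is prescribed on a basis of \<open>V\<close> and extended linearly to the
  ambient space; the coefficients \<open>g\<close> are its values on the finitely many unit
  vectors.\<close>

lemma dual_space_extend:
  fixes f :: "('x \<Rightarrow> 'k::field) \<Rightarrow> 'k"
  assumes f: "f \<in> dual_space V" and V: "fun_space.subspace V" "V \<subseteq> supported X" and X: "finite X"
  obtains g where "\<And>v. v \<in> V \<Longrightarrow> f v = (\<Sum>L\<in>X. g L * v L)"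
proof -
  obtain B where B: "B \<subseteq> V" "fun_space.independent B" "V \<subseteq> fun_space.span B"
    using fun_space.maximal_independent_subset[of V] by blast
  obtain h where h: "Vector_Spaces.linear (*\<^sub>f) (*) h" "\<And>x. x \<in> B \<Longrightarrow> h x = f x"
    using scalar_pair.linear_independent_extend[OF B(2)] by blast
  interpret h: Vector_Spaces.linear "(*\<^sub>f)" "(*)" h by (rule h(1))
  have "v \<in> V \<and> f v = h v" if "v \<in> fun_space.span B" for v
    using that
  proof (induction rule: fun_space.span_induct_alt)
    case base
    show ?case using V(1) dual_space_zero[OF f V(1)] h.zero fun_space.subspace_0 by metis
  next
    case (step c x y)
    have x: "x \<in> V" using step B by blast
    then have cx: "c *\<^sub>f x \<in> V" using V(1) fun_space.subspace_scale by blast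
    have "f (c *\<^sub>f x + y) = f (c *\<^sub>f x) + f y" "f (c *\<^sub>f x) = c * f x"
      using f x cx step unfolding dual_space_iff by blast+
    then have "f (c *\<^sub>f x + y) = h (c *\<^sub>f x + y)"
      using step h(2) by (simp only: h.add h.scale)
    then show ?case using cx step V(1) fun_space.subspace_add by blast
  qed
  then have fh: "f v = h v" if "v \<in> V" for v using that B by blast
  show ?thesis
  proof (rule that)
    fix v assume v: "v \<in> V"
    then have "h v = h (\<Sum>L\<in>X. v L *\<^sub>f unit_vec L)"
      using supported_expand[OF X] V(2) by (metis subsetD)
    also have "\<dots> = (\<Sum>L\<in>X. h (unit_vec L) * v L)" by (simp only: h.sum h.scale mult.commute)
    finally show "f v = (\<Sum>L\<in>X. h (unit_vec L) * v L)" using fh[OF v] by simp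
  qed
qed

lemma dual_SV_eps:
  fixes f :: "(nat multiset list \<Rightarrow> 'k::field) \<Rightarrow> 'k"
  assumes f: "f \<in> dual_space (SV q i n)"
  obtains g where "f = (\<Sum>L\<in>lab (Suc q) ` words (Suc q + i) n. g L *\<^sub>f eps q i n L)"
proof -
  let ?X = "lab (Suc q) ` words (Suc q + i) n"
  have "SV q i n \<subseteq> (supported ?X :: (_ \<Rightarrow> 'k) set)"
    using SV_subset_val unfolding val_symf idx_symb .
  then obtain g where g: "\<And>v. v \<in> SV q i n \<Longrightarrow> f v = (\<Sum>L\<in>?X. g L * v L)"
    using dual_space_extend[OF f subspace_SV, of ?X] by auto
  have "f = (\<Sum>L\<in>?X. g L *\<^sub>f eps q i n L)"
  proof (rule ext)
    fix v
    show "f v = (\<Sum>L\<in>?X. g L *\<^sub>f eps q i n L) v"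
      by (cases "v \<in> SV q i n")
        (simp_all add: fscale_sum_apply fscale_def eps_def g dual_space_outside[OF f])
  qed
  then show ?thesis by (rule that)
qed

lemma dual_SV_generated:
  fixes U :: "((nat multiset list \<Rightarrow> 'k::field) \<Rightarrow> 'k) set"
  assumes U: "fun_space.subspace U"
    and gen: "\<And>\<alpha>. coef (Wf q i) (Suc i) n \<alpha> (eps q i (Suc i) (lab (Suc q) (J0 q i))) \<in> U"
  shows "dual_space (SV q i n) \<subseteq> U"
proof
  fix f :: "(nat multiset list \<Rightarrow> 'k) \<Rightarrow> 'k" assume "f \<in> dual_space (SV q i n)"
  then obtain g where f: "f = (\<Sum>L\<in>lab (Suc q) ` words (Suc q + i) n. g L *\<^sub>f eps q i n L)"
    by (rule dual_SV_eps)
  show "f \<in> U" unfolding f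
    by (intro fun_space.subspace_sum U fun_space.subspace_scale) (auto simp: eps_generated gen)
qed

lemma FV_generated:
  fixes U :: "(nat multiset list \<Rightarrow> 'k::field) set"
  assumes U: "fun_space.subspace U" and gen: "\<And>\<alpha>. coef (symf (Suc q) i) (Suc i) n \<alpha> (v0 q i) \<in> U"
  shows "FV q i n \<subseteq> U"
proof -
  have "dual_space (SV q i n) \<subseteq> theta q i n -` U"
  proof (rule dual_SV_generated)
    show "fun_space.subspace (theta q i n -` U)"
      by (rule module_hom.subspace_vimage[OF flinear_theta U])
    show "coef (Wf q i) (Suc i) n \<alpha> (eps q i (Suc i) (lab (Suc q) (J0 q i))) \<in> theta q i n -` U" for \<alpha>
      using gen[of \<alpha>] theta_natural[OF eps_dual] theta_eps_J0 by (metis vimageI)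
  qed
  then show ?thesis by (auto simp: FV_def)
qed

lemma SV_highest:
  assumes v: "v \<in> SV q i n" "v \<noteq> 0"
  obtains \<alpha> c where "c \<noteq> 0" "coef (symf (Suc q) i) n (Suc i) \<alpha> v = c *\<^sub>f v0 q i"
proof -
  obtain L where L: "v L \<noteq> 0" using v(2) by (metis ext zero_fun_apply)
  then have "L \<in> lab (Suc q) ` words (Suc q + i) n"
    using v(1) SV_subset_val unfolding val_symf idx_symb supported_def by blast
  then obtain J where J: "J \<in> words (Suc q + i) n" "L = lab (Suc q) J" by blast
  show ?thesis by (rule that[OF _ coef_J0[OF J(1) v(1)]]) (use L J in simp)
qed

text \<open>A nonzero vector has a nonzero coordinate. By \<open>coef_J0\<close> a suitable
  coefficient of the action turns it into a nonzero multiple of \<open>v0\<close>, which generates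
  \<open>FV\<close>.\<close>

lemma FV_socle:
  fixes U :: "nat \<Rightarrow> (nat multiset list \<Rightarrow> 'k::field) set"
  assumes sub: "\<And>n. fun_space.subspace (U n)" "\<And>n. U n \<subseteq> SV q i n"
    and cl: "\<And>m n \<alpha> v. v \<in> U m \<Longrightarrow> coef (symf (Suc q) i) m n \<alpha> v \<in> U n"
    and v: "v \<in> U m" "v \<noteq> 0"
  shows "FV q i n \<subseteq> U n"
proof (rule FV_generated[OF sub(1)], rule cl)
  obtain \<alpha> c where c: "c \<noteq> 0" "coef (symf (Suc q) i) m (Suc i) \<alpha> v = c *\<^sub>f v0 q i"
  proof (rule SV_highest)
    show "v \<in> SV q i m" using v(1) sub(2) by blast
  qed (use v(2) in auto)
  then have "inverse c *\<^sub>f c *\<^sub>f v0 q i \<in> U (Suc i)"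
    using cl[OF v(1), of "Suc i" \<alpha>] fun_space.subspace_scale[OF sub(1)] by metis
  then show "v0 q i \<in> U (Suc i)" using c(1) by simp
qed

text \<open>A coefficient of the action moves \<open>theta u\<close> to \<open>c\<close> times
  \<open>v0\<close>. By symmetry of the form the element \<open>u1\<close> obtained from
  \<open>u\<close> in the same way has the value \<open>c\<close> at \<open>v0\<close>, and its
  component in the weight of \<open>v0\<close> is a nonzero multiple of the generator
  \<open>?e\<close>.\<close>

lemma dual_SV_head:
  fixes U :: "nat \<Rightarrow> ((nat multiset list \<Rightarrow> 'k::field) \<Rightarrow> 'k) set"
  assumes sub: "\<And>n. fun_space.subspace (U n)" "\<And>n. U n \<subseteq> dual_space (SV q i n)"
    and cl: "\<And>m n \<alpha> f. f \<in> U m \<Longrightarrow> coef (Wf q i) m n \<alpha> f \<in> U n"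
    and u: "u \<in> U m" "theta q i m u \<noteq> 0"
  shows "U n = dual_space (SV q i n)"
proof
  let ?e = "eps q i (Suc i) (lab (Suc q) (J0 q i)) :: (_ \<Rightarrow> 'k) \<Rightarrow> 'k"
  obtain \<alpha> c where c: "c \<noteq> 0" "coef (symf (Suc q) i) m (Suc i) \<alpha> (theta q i m u) = c *\<^sub>f v0 q i"
    using SV_highest[OF theta_in_SV u(2)] by blast
  define u1 where "u1 = coef (Wf q i) m (Suc i) \<alpha> u"
  have u1: "u1 \<in> U (Suc i)" unfolding u1_def by (rule cl[OF u(1)])
  then have u1d: "u1 \<in> dual_space (SV q i (Suc i))" using sub(2) by blast
  have "theta q i (Suc i) u1 = c *\<^sub>f v0 q i"
    unfolding u1_def using theta_natural[of u q i m "Suc i" \<alpha>] u(1) sub(2) c(2) by (metis subsetD)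
  then have "u1 (v0 q i) = ?e (c *\<^sub>f v0 q i)"
    using theta_symmetric[OF u1d eps_dual] theta_eps_J0 by metis
  also have "\<dots> = c"
    by (simp add: eps_def fun_space.subspace_scale v0_in_SV v0_J0 fscale_apply)
  finally have cu: "u1 (v0 q i) = c" .
  \<comment> \<open>The diagonal monomial of \<open>J0\<close> projects to the weight of
    \<open>v0\<close>, where a form is determined by its value at \<open>v0\<close>.\<close>
  define u2 where "u2 = coef (Wf q i) (Suc i) (Suc i) (mono_transpose (mm (mset (zip (J0 q i) (J0 q i))))) u1"
  have u2: "u2 \<in> U (Suc i)" unfolding u2_def by (rule cl[OF u1])
  have "u2 = c *\<^sub>f ?e"
  proof (rule ext)
    fix v
    show "u2 v = (c *\<^sub>f ?e) v"
    proof (cases "v \<in> SV q i (Suc i)")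
      case True
      have "u2 v = u1 (v (lab (Suc q) (J0 q i)) *\<^sub>f v0 q i)"
        unfolding u2_def coef_Wf mono_transpose_twice if_P[OF True] coef_J0[OF J0_words True] ..
      also have "\<dots> = v (lab (Suc q) (J0 q i)) * u1 (v0 q i)"
        using u1d v0_in_SV unfolding dual_space_iff by blast
      finally show ?thesis using True cu by (simp add: fscale_def eps_def)
    qed (simp add: u2_def coef_Wf fscale_def eps_def)
  qed
  then have "inverse c *\<^sub>f c *\<^sub>f ?e \<in> U (Suc i)"
    using u2 fun_space.subspace_scale[OF sub(1)] by metis
  then have e: "?e \<in> U (Suc i)" using c(1) by simp
  show "dual_space (SV q i n) \<subseteq> U n" by (rule dual_SV_generated[OF sub(1) cl[OF e]])
qed (rule sub(2))

section \<open>The de Rham differential\<close>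

definition rem :: "nat \<Rightarrow> 'a list \<Rightarrow> 'a list"
  where "rem t a = take t a @ drop (Suc t) a"

lemma length_rem: "t < length a \<Longrightarrow> length (rem t a) = length a - 1"
  by (simp add: rem_def)

lemma mset_rem: "t < length a \<Longrightarrow> add_mset (a ! t) (mset (rem t a)) = mset a"
  by (metis id_take_nth_drop mset.simps(2) mset_append rem_def union_mset_add_mset_right)

lemma rem_0 [simp]: "rem 0 (x # a) = a"
  and rem_Suc [simp]: "rem (Suc t) (x # a) = x # rem t a"
  by (simp_all add: rem_def)

lemma rem_words: "a \<in> words (Suc l) n \<Longrightarrow> t < Suc l \<Longrightarrow> rem t a \<in> words l n"
  by (auto simp: rem_def words_def dest: in_set_takeD in_set_dropD)

lemma nth_words: "a \<in> words l n \<Longrightarrow> t < l \<Longrightarrow> a ! t < n"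
  by (metis nth_mem wordsD)

lemma altsum_rem: "t < length a \<Longrightarrow> altsum G (a ! t # rem t a) = (-1) ^ t *\<^sub>f altsum G a"
proof -
  assume t: "t < length a"
  have "altsum G ([] @ take t a @ a ! t # drop (Suc t) a) = (-1) ^ length (take t a) *\<^sub>f altsum G ([] @ a ! t # take t a @ drop (Suc t) a)"
    by (rule altsum_move)
  then have "altsum G a = (-1) ^ t *\<^sub>f altsum G (a ! t # rem t a)"
    using t by (simp add: rem_def id_take_nth_drop[symmetric])
  then have "(-1) ^ t *\<^sub>f altsum G a = (-1) ^ t *\<^sub>f (-1) ^ t *\<^sub>f altsum G (a ! t # rem t a)"
    by (rule arg_cong)
  then show ?thesis by (simp flip: power_mult_distrib)
qed

lemma altsum_place_tail:
  fixes G :: "'a list \<Rightarrow> 'x \<Rightarrow> 'k::field"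
  assumes I: "I \<in> perms (length c)"
  shows "altsum G (x # place c I) = word_sign I *\<^sub>f altsum G (x # c)"
proof -
  let ?I = "0 # map Suc I"
  have s: "set I = {..<length c}" "distinct I" using permsD[OF I] by simp_all
  have "set ?I = insert 0 (Suc ` {..<length c})" using s by simp
  also have "\<dots> = {..<length (x # c)}" by (simp add: lessThan_Suc_eq_insert_0)
  finally have "?I \<in> perms (length (x # c))" using s(2) by (simp add: perms_iff distinct_map)
  then have "altsum G (place (x # c) ?I) = word_sign ?I *\<^sub>f altsum G (x # c)" by (rule altsum_place)
  moreover have "word_sign ?I = (word_sign I :: 'k)"
    using s(2) by (subst word_sign_Cons_distinct) (simp_all add: distinct_map word_sign_map_mono)
  moreover have "place (x # c) ?I = x # place c I" by (simp add: place_def)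
  ultimately show ?thesis by simp
qed

lemma K_rem:
  "a \<noteq> [] \<Longrightarrow> K q a b = (\<Sum>t<length a. (-1) ^ t *\<^sub>f omega (Suc q) (a ! t # b) (rem t a))"
  by (simp add: K_omega rem_def)

lemma omega_rem: "t < length c \<Longrightarrow> omega r b (c ! t # rem t c) = (-1) ^ t *\<^sub>f omega r b c"
  unfolding omega_def by (rule altsum_rem)

lemma K_rem_front: "t < length a \<Longrightarrow> K q (a ! t # rem t a) b = (-1) ^ t *\<^sub>f K q a b"
  unfolding K_def by (rule altsum_rem)

text \<open>
  On \<open>x\<^sup>b e\<^sub>c\<close> the map \<open>D\<close> is the de Rham differential, multiplied by a factorial (lemma \<open>D_omega\<close>)
  because it antisymmetrizes once more.
\<close>

definition DX :: "nat \<Rightarrow> nat list \<Rightarrow> nat multiset list \<Rightarrow> 'k::field"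
  where "DX q J = (\<Sum>u<Suc q. omega q (rem u (take (Suc q) J)) (J ! u # drop (Suc q) J))"

text \<open>\<open>D\<close> is defined on coordinates, so a word has to be chosen for each label;
  \<open>DX_cong\<close> shows that the choice does not matter.\<close>

definition rep :: "nat \<Rightarrow> nat \<Rightarrow> nat multiset list \<Rightarrow> nat list"
  where "rep r e L = (SOME J. length J = e \<and> lab r J = L)"

definition D :: "nat \<Rightarrow> nat \<Rightarrow> nat \<Rightarrow> (nat multiset list \<Rightarrow> 'k::field) \<Rightarrow> nat multiset list \<Rightarrow> 'k"
  where "D q j n v = (\<Sum>L\<in>lab (Suc q) ` words (Suc q + j) n. v L *\<^sub>f DX q (rep (Suc q) (Suc q + j) L))"

lemma flinear_D: "flinear (D q j n)"
  unfolding D_def by (rule flinear_combination)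

text \<open>Rewrites \<open>DX\<close> through the multiset of the first \<open>Suc q\<close>
  letters, which makes it visible that only the label enters.\<close>

lemma DX_sum_mset:
  assumes "length J = Suc q + j"
  shows "DX q J = (\<Sum>x\<in>#mset (take (Suc q) J). omega q (sorted_list_of_multiset (mset (take (Suc q) J) - {#x#})) (x # drop (Suc q) J))"
proof -
  let ?b = "take (Suc q) J"
  have len: "length ?b = Suc q" using assms by simp
  have "DX q J = (\<Sum>u<Suc q. omega q (sorted_list_of_multiset (mset ?b - {#?b ! u#})) (?b ! u # drop (Suc q) J))"
    unfolding DX_def
  proof (intro sum.cong refl)
    fix u assume u: "u \<in> {..<Suc q}"
    have "mset (rem u ?b) = mset ?b - {#?b ! u#}"
      using mset_rem[of u ?b] u len by (metis add_mset_remove_trivial lessThan_iff)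
    then have "omega q (rem u ?b) c = omega q (sorted_list_of_multiset (mset ?b - {#?b ! u#})) c" for c
      using u len by (intro omega_cong) (simp_all add: length_rem)
    then show "omega q (rem u ?b) (J ! u # drop (Suc q) J) =
      omega q (sorted_list_of_multiset (mset ?b - {#?b ! u#})) (?b ! u # drop (Suc q) J)"
      using u by simp
  qed
  also have "\<dots> = sum_list (map (\<lambda>x. omega q (sorted_list_of_multiset (mset ?b - {#x#})) (x # drop (Suc q) J)) ?b)"
    by (simp only: sum_list_sum_nth length_map len atLeast0LessThan)
      (intro sum.cong refl nth_map[symmetric], simp only: len lessThan_iff)
  finally show ?thesis by (simp only: sum_mset_sum_list[symmetric] mset_map)
qed

lemma DX_cong:
  assumes "length J = Suc q + j" "length J' = Suc q + j" "lab (Suc q) J = lab (Suc q) J'"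
  shows "DX q J = DX q J'"
  using assms(3) unfolding DX_sum_mset[OF assms(1)] DX_sum_mset[OF assms(2)] lab_eq_iff by simp

lemma D_E:
  assumes J: "J \<in> words (Suc q + j) n"
  shows "D q j n (E (Suc q) J) = DX q J"
proof -
  let ?e = "Suc q + j" and ?S = "lab (Suc q) ` words (Suc q + j) n"
  have "D q j n (E (Suc q) J) = (\<Sum>L\<in>?S. if L = lab (Suc q) J then DX q (rep (Suc q) ?e L) else 0)"
    unfolding D_def by (intro sum.cong refl) (auto simp: E_def unit_vec_def)
  also have "\<dots> = DX q (rep (Suc q) ?e (lab (Suc q) J))" using J by simp
  also have "\<dots> = DX q J"
  proof -
    have "length (rep (Suc q) ?e (lab (Suc q) J)) = ?e \<and> lab (Suc q) (rep (Suc q) ?e (lab (Suc q) J)) = lab (Suc q) J"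
      unfolding rep_def by (rule someI[of _ J]) (simp add: wordsD[OF J])
    then show ?thesis using wordsD(1)[OF J] by (intro DX_cong) auto
  qed
  finally show ?thesis .
qed

lemma natural_DX: "natural q (Suc j) (DX q :: _ \<Rightarrow> _ \<Rightarrow> 'k::field)"
proof -
  \<comment> \<open>The differentiated position \<open>u\<close> is moved from the symmetric part to
    the front of the alternating part.\<close>
  define P where "P = (\<lambda>u. [0..<u] @ [Suc u..<Suc q] @ [u] @ [Suc q..<Suc q + j])"
  have P: "P u \<in> perms (q + Suc j)" if "u < Suc q" for u
  proof -
    have "{..<q + Suc j} = {0..<u} \<union> {Suc u..<Suc q} \<union> {u} \<union> {Suc q..<Suc q + j}" using that by auto
    then have "set (P u) = {..<q + Suc j}" by (simp add: P_def Un_assoc del: upt_Suc)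
    moreover have "distinct (P u)" using that by (auto simp: P_def simp del: upt_Suc)
    ultimately show ?thesis by (simp add: perms_iff)
  qed
  have "natural q (Suc j) (\<lambda>J. \<Sum>u<Suc q. 1 *\<^sub>f omega q (take q (place J (P u))) (drop q (place J (P u))) :: _ \<Rightarrow> 'k)"
    by (intro natural_scaled_sum natural_place[OF natural_omega] P) simp
  then show ?thesis
  proof (rule natural_cong)
    fix J :: "nat list" assume J: "length J = q + Suc j"
    have *: "place J [k..<l] = take (l - k) (drop k J)" if "l \<le> length J" for k l
      using that by (intro nth_equalityI) (auto simp: place_def)
    show "(\<Sum>u<Suc q. 1 *\<^sub>f omega q (take q (place J (P u))) (drop q (place J (P u))) :: _ \<Rightarrow> 'k) = DX q J"
      unfolding DX_def
    proof (intro sum.cong refl)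
      fix u assume "u \<in> {..<Suc q}"
      then have u: "u < Suc q" by simp
      have "place J (P u) = place J [0..<u] @ place J [Suc u..<Suc q] @ [J ! u] @ place J [Suc q..<Suc q + j]"
        by (simp add: P_def place_def del: upt_Suc)
      also have "place J [0..<u] = take u J" using u J by (subst *) auto
      also have "place J [Suc u..<Suc q] = drop (Suc u) (take (Suc q) J)"
        using u J by (subst *) (auto simp: drop_take)
      also have "place J [Suc q..<Suc q + j] = drop (Suc q) J" using J by (subst *) auto
      finally have p: "place J (P u) = rem u (take (Suc q) J) @ J ! u # drop (Suc q) J"
        using u by (simp add: rem_def min_absorb1)
      have "length (rem u (take (Suc q) J)) = q" using u J by (simp add: length_rem)
      then show "1 *\<^sub>f omega q (take q (place J (P u))) (drop q (place J (P u))) =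
        (omega q (rem u (take (Suc q) J)) (J ! u # drop (Suc q) J) :: _ \<Rightarrow> 'k)"
        by (simp add: p)
    qed
  qed
qed

lemma D_natural:
  assumes v: "v \<in> val (symf (Suc q) j) m"
  shows "D q j n (coef (symf (Suc q) j) m n \<alpha> v) = coef (symf q (Suc j)) m n \<alpha> (D q j m v)"
proof (rule symf_eqI[OF flinear_compose[OF flinear_coef_symf flinear_D] flinear_compose[OF flinear_D flinear_coef_symf] _ v])
  fix J assume J: "J \<in> words (Suc q + j) m"
  then have J': "J \<in> words (q + Suc j) m" by simp
  obtain Z where Z: "\<alpha> = mm Z" using ex_mm by blast
  have "D q j n (coef (symf (Suc q) j) m n \<alpha> (E (Suc q) J)) =
    (\<Sum>I | I \<in> words (Suc q + j) n \<and> mset (zip I J) = Z. DX q I)"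
    unfolding Z coef_symf_E[OF J] flinear_sum[OF flinear_D] by (intro sum.cong refl) (simp add: D_E)
  also have "\<dots> = (\<Sum>I | I \<in> words (q + Suc j) n \<and> mset (zip I J) = Z. DX q I)" by simp
  also have "\<dots> = coef (symf q (Suc j)) m n \<alpha> (DX q J)"
    unfolding Z by (rule naturalD[OF natural_DX J', symmetric])
  finally show "D q j n (coef (symf (Suc q) j) m n \<alpha> (E (Suc q) J)) = coef (symf q (Suc j)) m n \<alpha> (D q j m (E (Suc q) J))"
    by (simp only: D_E[OF J])
qed

lemma card_perms: "card (perms m) = fact m"
  by (simp add: perms_def)

text \<open>Each of the \<open>fact j\<close> arrangements of \<open>c\<close> gives the same form:
  its sign is cancelled by the sign that the second antisymmetrization produces.\<close>

lemma D_omega: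
  assumes b: "b \<in> words (Suc q) n" and c: "c \<in> words j n"
  shows "D q j n (omega (Suc q) b c) = of_nat (fact j) *\<^sub>f (\<Sum>u<Suc q. omega q (rem u b) (b ! u # c) :: _ \<Rightarrow> 'k::field)"
proof -
  have len: "length b = Suc q" "length c = j" using b c by (simp_all add: wordsD)
  have "D q j n (omega (Suc q) b c) = (\<Sum>I\<in>perms j. word_sign I *\<^sub>f D q j n (E (Suc q) (b @ place c I)) :: _ \<Rightarrow> 'k)"
    unfolding omega_def altsum_def len by (simp only: flinear_sum[OF flinear_D] flinear_scale[OF flinear_D])
  also have "\<dots> = (\<Sum>I\<in>perms j. \<Sum>u<Suc q. omega q (rem u b) (b ! u # c))"
  proof (intro sum.cong refl)
    fix I assume I: "I \<in> perms j"
    have "b @ place c I \<in> words (Suc q + j) n"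
      by (intro append_words b place_words I c)
    then have "D q j n (E (Suc q) (b @ place c I)) = (\<Sum>u<Suc q. omega q (rem u b) (b ! u # place c I) :: _ \<Rightarrow> 'k)"
      by (subst D_E) (auto simp: DX_def len nth_append intro!: sum.cong)
    also have "\<dots> = (\<Sum>u<Suc q. word_sign I *\<^sub>f omega q (rem u b) (b ! u # c))"
      unfolding omega_def using I len by (intro sum.cong refl altsum_place_tail) simp
    finally show "word_sign I *\<^sub>f D q j n (E (Suc q) (b @ place c I)) = (\<Sum>u<Suc q. omega q (rem u b) (b ! u # c) :: _ \<Rightarrow> 'k)"
      by (simp only: fun_space.scale_sum_right word_sign_square_scale)
  qed
  also have "\<dots> = of_nat (fact j) *\<^sub>f (\<Sum>u<Suc q. omega q (rem u b) (b ! u # c))"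
    by (simp only: fun_space.sum_constant_scale card_perms)
  finally show ?thesis .
qed

text \<open>In characteristic \<open>p\<close>, the Koszul and the de Rham differential anticommute in degree \<open>p\<close>.\<close>

lemma D_K:
  assumes p: "of_nat (Suc q + j) = (0 :: 'k::field)" and a: "a \<in> words (Suc j) n" and b: "b \<in> words q n"
  shows "D q j n (K q a b :: _ \<Rightarrow> 'k) = - (of_nat (fact j) *\<^sub>f (\<Sum>w<q. K (q - 1) (b ! w # a) (rem w b)))"
proof -
  have len: "length a = Suc j" "length b = q" using a b by (simp_all add: wordsD)
  then have ne: "a \<noteq> []" by auto
  \<comment> \<open>The form with symmetric part \<open>b\<close> and alternating part
    \<open>a\<close>. It arises \<open>Suc j\<close> times from differentiating the letter just
    moved by the Koszul map, and \<open>q\<close> times from completing the inner sums to Koszul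
    vectors; the total \<open>Suc j + q\<close> is zero in the field.\<close>
  let ?o = "omega q b a :: _ \<Rightarrow> 'k"
  let ?R = "\<lambda>w. \<Sum>t<Suc j. (-1) ^ t *\<^sub>f omega q (a ! t # rem w b) (b ! w # rem t a) :: _ \<Rightarrow> 'k"
  have 1: "D q j n (omega (Suc q) (a ! t # b) (rem t a)) = of_nat (fact j) *\<^sub>f
    ((-1) ^ t *\<^sub>f ?o + (\<Sum>w<q. omega q (a ! t # rem w b) (b ! w # rem t a)))" if t: "t < Suc j" for t
  proof -
    have "a ! t # b \<in> words (Suc q) n" using nth_words[OF a t] b by (auto simp: words_def)
    then have "D q j n (omega (Suc q) (a ! t # b) (rem t a)) =
      of_nat (fact j) *\<^sub>f (\<Sum>u<Suc q. omega q (rem u (a ! t # b)) ((a ! t # b) ! u # rem t a) :: _ \<Rightarrow> 'k)"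
      by (rule D_omega[OF _ rem_words[OF a t]])
    also have "(\<Sum>u<Suc q. omega q (rem u (a ! t # b)) ((a ! t # b) ! u # rem t a) :: _ \<Rightarrow> 'k) =
      omega q b (a ! t # rem t a) + (\<Sum>w<q. omega q (a ! t # rem w b) (b ! w # rem t a))"
      by (simp only: sum.lessThan_Suc_shift rem_0 rem_Suc nth_Cons_0 nth_Cons_Suc)
    also have "omega q b (a ! t # rem t a) = (-1) ^ t *\<^sub>f ?o" using t len by (intro omega_rem) simp
    finally show ?thesis .
  qed
  have 2: "?R w = ?o - K (q - 1) (b ! w # a) (rem w b)" if w: "w < q" for w
  proof -
    have q: "Suc (q - 1) = q" using w by simp
    have "K (q - 1) (b ! w # a) (rem w b) =
      (\<Sum>t<Suc (Suc j). (-1) ^ t *\<^sub>f omega q ((b ! w # a) ! t # rem w b) (rem t (b ! w # a)) :: _ \<Rightarrow> 'k)"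
      by (subst K_rem) (simp_all only: q len length_Cons list.distinct(2) not_False_eq_True)
    also have "\<dots> = omega q (b ! w # rem w b) a + (\<Sum>t<Suc j. (-1) ^ Suc t *\<^sub>f omega q (a ! t # rem w b) (b ! w # rem t a))"
      by (subst sum.lessThan_Suc_shift) (simp only: rem_0 rem_Suc nth_Cons_0 nth_Cons_Suc power_0 fun_space.scale_one)
    also have "omega q (b ! w # rem w b) a = ?o"
      by (rule omega_cong) (use w len in \<open>simp_all add: mset_rem length_rem\<close>)
    also have "(\<Sum>t<Suc j. (-1) ^ Suc t *\<^sub>f omega q (a ! t # rem w b) (b ! w # rem t a)) = - ?R w"
      by (simp only: power_Suc mult_minus_left mult_1_left fun_space.scale_minus_left sum_negf)
    finally show ?thesis by (simp only: diff_minus_eq_add add_uminus_conv_diff diff_diff_eq2 add_diff_cancel_left' diff_add_cancel)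
  qed
  have "D q j n (K q a b) = (\<Sum>t<Suc j. (-1) ^ t *\<^sub>f D q j n (omega (Suc q) (a ! t # b) (rem t a)))"
    unfolding K_rem[OF ne] len(1) by (simp only: flinear_sum[OF flinear_D] flinear_scale[OF flinear_D])
  also have "\<dots> = (\<Sum>t<Suc j. of_nat (fact j) *\<^sub>f (?o + (\<Sum>w<q. (-1) ^ t *\<^sub>f omega q (a ! t # rem w b) (b ! w # rem t a))))"
  proof (intro sum.cong refl)
    fix t assume "t \<in> {..<Suc j}"
    then have t: "t < Suc j" by simp
    have s: "(-1) ^ t *\<^sub>f (-1) ^ t *\<^sub>f v = v" for v :: "nat multiset list \<Rightarrow> 'k"
      by (simp flip: power_mult_distrib)
    show "(-1) ^ t *\<^sub>f D q j n (omega (Suc q) (a ! t # b) (rem t a)) =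
      of_nat (fact j) *\<^sub>f (?o + (\<Sum>w<q. (-1) ^ t *\<^sub>f omega q (a ! t # rem w b) (b ! w # rem t a)))"
      unfolding 1[OF t] fun_space.scale_left_commute[of "(-1) ^ t"]
      by (rule arg_cong[where f = "(*\<^sub>f) _"]) (simp only: fun_space.scale_right_distrib fun_space.scale_sum_right s)
  qed
  also have "\<dots> = of_nat (fact j) *\<^sub>f (of_nat (Suc j) *\<^sub>f ?o + (\<Sum>t<Suc j. \<Sum>w<q. (-1) ^ t *\<^sub>f omega q (a ! t # rem w b) (b ! w # rem t a)))"
    by (simp only: fun_space.scale_sum_right[symmetric] sum.distrib fun_space.sum_constant_scale card_lessThan)
  also have "(\<Sum>t<Suc j. \<Sum>w<q. (-1) ^ t *\<^sub>f omega q (a ! t # rem w b) (b ! w # rem t a)) = (\<Sum>w<q. ?R w)"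
    by (rule sum.swap)
  also have "\<dots> = (\<Sum>w<q. ?o - K (q - 1) (b ! w # a) (rem w b))"
    by (intro sum.cong refl 2) simp
  also have "\<dots> = of_nat q *\<^sub>f ?o - (\<Sum>w<q. K (q - 1) (b ! w # a) (rem w b))"
    by (simp only: sum_subtractf fun_space.sum_constant_scale card_lessThan)
  also have "of_nat (Suc j) *\<^sub>f ?o + (of_nat q *\<^sub>f ?o - (\<Sum>w<q. K (q - 1) (b ! w # a) (rem w b))) =
    (of_nat (Suc j) + of_nat q) *\<^sub>f ?o - (\<Sum>w<q. K (q - 1) (b ! w # a) (rem w b))"
    by (simp only: fun_space.scale_left_distrib add_diff_eq)
  also have "of_nat (Suc j) + of_nat q = (0 :: 'k)" using p by (simp add: algebra_simps)
  finally show ?thesis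
    by (simp only: fun_space.scale_zero_left fun_space.scale_right_diff_distrib fun_space.scale_zero_right diff_0 fun_space.scale_minus_right)
qed

lemma D_SV:
  assumes p: "of_nat (Suc (Suc q) + j) = (0 :: 'k::field)" and v: "v \<in> SV (Suc q) j n"
  shows "D (Suc q) j n (v :: _ \<Rightarrow> 'k) \<in> SV q (Suc j) n"
proof -
  have "SV (Suc q) j n \<subseteq> D (Suc q) j n -` (SV q (Suc j) n :: (_ \<Rightarrow> 'k) set)"
    unfolding SV_span_words[of "Suc q"]
  proof (rule fun_space.span_minimal)
    show "fun_space.subspace (D (Suc q) j n -` (SV q (Suc j) n :: (_ \<Rightarrow> 'k) set))"
      by (rule module_hom.subspace_vimage[OF flinear_D]) simp
    have "D (Suc q) j n (K (Suc q) a b) \<in> (SV q (Suc j) n :: (_ \<Rightarrow> 'k) set)"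
      if ab: "a \<in> words (Suc j) n" "b \<in> words (Suc q) n" for a b
    proof -
      have "b ! w # a \<in> words (Suc (Suc j)) n" if "w < Suc q" for w
        using nth_words[OF ab(2) that] ab(1) by (auto simp: words_def)
      then show ?thesis
        unfolding D_K[OF p ab]
        by (intro fun_space.subspace_neg fun_space.subspace_scale fun_space.subspace_sum subspace_SV)
          (simp add: K_in_SV rem_words[OF ab(2)])
    qed
    then show "{K (Suc q) a b |a b. a \<in> words (Suc j) n \<and> b \<in> words (Suc q) n}
      \<subseteq> D (Suc q) j n -` (SV q (Suc j) n :: (_ \<Rightarrow> 'k) set)" by auto
  qed
  then show ?thesis using v by blast
qed

text \<open>\<open>D\<close> kills the highest weight vector, because there is no room for a longer alternating word.\<close>

lemma D_FV:
  assumes p: "of_nat (Suc q + j) = (0 :: 'k::field)" and v: "v \<in> FV q j n"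
  shows "D q j n (v :: _ \<Rightarrow> 'k) = 0"
proof -
  have w: "[0..<Suc j] \<in> words (Suc j) (Suc j)" "replicate q 0 \<in> words q (Suc j)"
    by (auto simp: words_def)
  have "K (q - 1) (replicate q 0 ! w # [0..<Suc j]) (rem w (replicate q 0)) = (0 :: _ \<Rightarrow> 'k)" if "w < q" for w
    using that by (intro K_not_distinct) auto
  then have z: "D q j (Suc j) (v0 q j :: _ \<Rightarrow> 'k) = 0"
    unfolding v0_def D_K[OF p w] by (simp only: sum.neutral[of "{..<q}"] lessThan_iff
      fun_space.scale_zero_right neg_equal_0_iff_equal) simp
  have "FV q j n \<subseteq> D q j n -` {0 :: _ \<Rightarrow> 'k}"
  proof (rule FV_generated)
    show "fun_space.subspace (D q j n -` {0 :: _ \<Rightarrow> 'k})"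
      by (rule module_hom.subspace_vimage[OF flinear_D]) simp
    have "(v0 q j :: _ \<Rightarrow> 'k) \<in> val (symf (Suc q) j) (Suc j)" using v0_in_SV SV_subset_val by blast
    then show "coef (symf (Suc q) j) (Suc j) n \<alpha> (v0 q j) \<in> D q j n -` {0 :: _ \<Rightarrow> 'k}" for \<alpha>
      by (simp add: D_natural z flinear_zero[OF flinear_coef_symf])
  qed
  then show ?thesis using v by blast
qed

section \<open>The image of the differential\<close>

definition a0 :: "nat \<Rightarrow> nat list"
  where "a0 j = [0..<Suc j]"

definition b0 :: "nat \<Rightarrow> nat \<Rightarrow> nat list"
  where "b0 q j = [Suc j..<Suc j + q]"

lemma a0_words: "a0 j \<in> words (Suc j) (Suc q + j)"
  by (auto simp: a0_def words_def)

lemma b0_words: "b0 q j \<in> words q (Suc q + j)"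
  by (auto simp: b0_def words_def)

text \<open>All letters of \<open>a0 j @ b0 q j\<close> are distinct, so the monomial formed with
  \<open>a @ b\<close> determines the substituted word uniquely. One multilinear vector thus
  generates the Schur functor.\<close>

lemma SV_multilinear:
  assumes a: "a \<in> words (Suc j) n" and b: "b \<in> words q n"
  shows "K q a b = coef (symf (Suc q) j) (Suc q + j) n (mm (mset (zip (a @ b) (a0 j @ b0 q j)))) (K q (a0 j) (b0 q j))"
proof -
  let ?J = "a0 j @ b0 q j"
  have J: "?J = [0..<Suc j + q]"
    unfolding a0_def b0_def by (simp only: upt_add_eq_append[of 0 "Suc j" q] zero_le)
  have len: "length (a @ b) = Suc j + q" using a b by (simp add: wordsD)
  have inj: "I = a @ b" if "length I = Suc j + q" "mset (zip I ?J) = mset (zip (a @ b) ?J)" for I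
  proof (rule nth_equalityI)
    fix k assume k: "k < length I"
    have "(I ! k, k) \<in> set (zip I ?J)" using k that(1) unfolding J by (auto simp: set_zip intro!: exI[of _ k] simp del: upt_Suc)
    then have "(I ! k, k) \<in> set (zip (a @ b) ?J)" using mset_eq_setD[OF that(2)] by simp
    then show "I ! k = (a @ b) ! k" unfolding J by (auto simp: set_zip simp del: upt_Suc)
  qed (use that len in simp)
  have "{I \<in> words (Suc j + q) n. mset (zip I ?J) = mset (zip (a @ b) ?J)} = {a @ b}"
    using inj append_words[OF a b] by (auto simp: wordsD)
  then show ?thesis
    unfolding coef_K[OF a0_words b0_words] using wordsD(1)[OF a] by simp
qed

text \<open>The basis elements whose Koszul image meets the multilinear coordinate with symmetric
  part \<open>b0 (Suc q) j\<close> and alternating part \<open>a0 j\<close>: one letter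
  \<open>x\<close> of the former joins the alternating set, and the others follow in any
  order.\<close>

definition TI :: "nat \<Rightarrow> nat \<Rightarrow> (nat set \<times> nat list) set"
  where "TI q j = (\<lambda>(x, b). (insert x {..<Suc j}, b)) ` (SIGMA x:set (b0 (Suc q) j). permutations_of_set (set (b0 (Suc q) j) - {x}))"

lemma sorted_insert: "Suc j \<le> x \<Longrightarrow> sorted_list_of_set (insert x {..<Suc j}) = a0 j @ [x]"
proof -
  assume x: "Suc j \<le> x"
  have "insert x {..<Suc j} = set (a0 j @ [x])" by (auto simp: a0_def)
  moreover have "sorted (a0 j @ [x])" "distinct (a0 j @ [x])"
    using x by (auto simp: a0_def sorted_append simp del: upt_Suc)
  ultimately show ?thesis using sorted_list_of_set.idem_if_sorted_distinct by metis
qed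

lemma set_b0: "set (b0 q j) = {Suc j..<Suc j + q}" "distinct (b0 q j)"
  by (simp_all add: b0_def del: upt_Suc)

lemma mset_b0_iff:
  assumes "x \<in> set (b0 q j)"
  shows "mset (x # b) = mset (b0 q j) \<longleftrightarrow> b \<in> permutations_of_set (set (b0 q j) - {x})"
proof
  assume eq: "mset (x # b) = mset (b0 q j)"
  then have "distinct (x # b)" "set (x # b) = set (b0 q j)"
    using set_b0(2) mset_eq_imp_distinct_iff mset_eq_setD by blast+
  then show "b \<in> permutations_of_set (set (b0 q j) - {x})" by (auto intro!: permutations_of_setI)
next
  assume "b \<in> permutations_of_set (set (b0 q j) - {x})"
  then have "set b = set (b0 q j) - {x}" "distinct b" by (auto dest: permutations_of_setD)
  then have "set (x # b) = set (b0 q j)" "distinct (x # b)" using assms by auto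
  then show "mset (x # b) = mset (b0 q j)"
    using set_b0(2) by (metis set_eq_iff_mset_eq_distinct)
qed

lemma TI_subset: "TI q j \<subseteq> KI q (Suc j) (Suc (Suc q) + j)"
proof
  fix y assume "y \<in> TI q j"
  then obtain x b where y: "y = (insert x {..<Suc j}, b)" "x \<in> set (b0 (Suc q) j)"
    "b \<in> permutations_of_set (set (b0 (Suc q) j) - {x})" by (auto simp: TI_def)
  have x: "Suc j \<le> x" "x < Suc (Suc q) + j" using y(2) by (auto simp: set_b0)
  have "length b = q"
    using length_finite_permutations_of_set[OF y(3)] y(2) by (simp add: set_b0)
  moreover have "set b \<subseteq> {..<Suc (Suc q) + j}"
    unfolding permutations_of_setD(1)[OF y(3)] set_b0 by auto
  ultimately show "y \<in> KI q (Suc j) (Suc (Suc q) + j)"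
    using x by (auto simp: y(1) KI_def words_def)
qed

text \<open>Both alternating words are sorted and \<open>a\<close> is distinct, so only the identity
  arrangement can reach this coordinate.\<close>

lemma omega_coordinate:
  assumes "length b = q" "length c = length a" "sorted c" "sorted a" "distinct a" "length d = q"
  shows "omega q b c (lab q (d @ a)) = (if mset b = mset d \<and> c = a then 1 else 0 :: 'k::field)"
proof -
  have "omega q b c (lab q (d @ a)) =
    (\<Sum>I\<in>perms (length a). if I = [0..<length a] then (if mset b = mset d \<and> c = a then 1 else 0) else 0 :: 'k)"
    unfolding omega_def altsum_def fscale_sum_apply assms(2)
  proof (intro sum.cong refl)
    fix I assume I: "I \<in> perms (length a)"
    have "lab q (b @ place c I) = lab q (d @ a) \<longleftrightarrow> mset b = mset d \<and> place c I = a"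
      using assms by (simp add: lab_eq_iff)
    also have "place c I = a \<longleftrightarrow> c = a \<and> I = [0..<length a]"
    proof
      assume eq: "place c I = a"
      then have "mset c = mset a" using mset_place[of I c] I assms(2) by simp
      then have ca: "c = a" using assms(3,4) by (metis properties_for_sort sorted_sort_id)
      have "I = [0..<length a]"
      proof (rule nth_equalityI)
        show "length I = length [0..<length a]" using permsD[OF I] by simp
        fix k assume "k < length I"
        then have k: "k < length a" "I ! k < length a"
          using permsD[OF I] nth_mem[of k I] by auto
        have "a ! (I ! k) = a ! k" using eq ca k permsD[OF I] by (metis length_place nth_map place_def)
        then show "I ! k = [0..<length a] ! k" using k assms(5) by (simp add: nth_eq_iff_index_eq)
      qed
      then show "c = a \<and> I = [0..<length a]" using ca by simp
    qed auto
    finally have eq: "lab q (b @ place c I) = lab q (d @ a) \<longleftrightarrow> mset b = mset d \<and> c = a \<and> I = [0..<length a]" .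
    have E: "E q (b @ place c I) (lab q (d @ a)) = (if mset b = mset d \<and> c = a \<and> I = [0..<length a] then 1 else 0 :: 'k)"
      unfolding E_def unit_vec_def eq_commute[of "lab q (d @ a)"] eq ..
    have "word_sign [0..<length a] = (1 :: 'k)" by (rule word_sign_sorted) simp
    then show "(word_sign I *\<^sub>f E q (b @ place c I)) (lab q (d @ a)) =
      (if I = [0..<length a] then (if mset b = mset d \<and> c = a then 1 else 0) else 0 :: 'k)"
      unfolding fscale_apply E by (cases "I = [0..<length a]") simp_all
  qed
  then show ?thesis using upt_perms[of "length a"] by simp
qed

text \<open>The letter that the Koszul map takes out has to be the one outside \<open>a0 j\<close>.
  It exceeds all letters of \<open>a0 j\<close>, hence stands last in the sorted list, at position
  \<open>Suc j\<close>; this gives the sign.\<close>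

lemma KB_multilinear_coordinate:
  assumes y: "y \<in> KI q (Suc j) (Suc (Suc q) + j)"
  shows "KB q y (lab (Suc q) (b0 (Suc q) j @ a0 j)) = (if y \<in> TI q j then (-1) ^ Suc j else 0 :: 'k::field)"
proof -
  let ?b = "b0 (Suc q) j" and ?L = "lab (Suc q) (b0 (Suc q) j @ a0 j)"
  obtain A b where Ab: "y = (A, b)" by (cases y)
  let ?s = "sorted_list_of_set A"
  have A: "finite A" "card A = Suc (Suc j)" and b: "length b = q"
    using y by (auto simp: Ab KI_def wordsD intro: finite_subset)
  have s: "length ?s = Suc (Suc j)" "sorted ?s" "distinct ?s" "set ?s = A" using A by simp_all
  have cond: "mset (?s ! t # b) = mset ?b \<and> rem t ?s = a0 j \<longleftrightarrow> t = Suc j \<and> y \<in> TI q j" if t: "t < Suc (Suc j)" for t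
  proof
    assume l: "mset (?s ! t # b) = mset ?b \<and> rem t ?s = a0 j"
    let ?x = "?s ! t"
    have "?x \<in> set ?b" using l by (metis list.set_intros(1) mset_eq_setD)
    then have x: "?x \<in> set ?b" "Suc j \<le> ?x" by (simp_all add: set_b0)
    have "A = insert ?x (set (rem t ?s))"
      using mset_rem[of t ?s] t s by (metis set_mset_add_mset_insert set_mset_mset)
    also have "set (rem t ?s) = {..<Suc j}" using l by (auto simp: a0_def)
    finally have A': "A = insert ?x {..<Suc j}" .
    then have se: "?s = a0 j @ [?x]" using sorted_insert[OF x(2)] by simp
    have "?s ! Suc j = ?x" by (subst se) (simp add: a0_def nth_append del: upt_Suc)
    then have "t = Suc j" using s(1,3) t by (simp add: nth_eq_iff_index_eq)
    moreover have "b \<in> permutations_of_set (set ?b - {?x})" using l mset_b0_iff[OF x(1)] by blast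
    then have "y \<in> TI q j" unfolding TI_def using x(1) A' Ab by (intro image_eqI[of _ _ "(?x, b)"]) auto
    ultimately show "t = Suc j \<and> y \<in> TI q j" ..
  next
    assume r: "t = Suc j \<and> y \<in> TI q j"
    then obtain x where x: "A = insert x {..<Suc j}" "x \<in> set ?b" "b \<in> permutations_of_set (set ?b - {x})"
      unfolding TI_def Ab by auto
    have "Suc j \<le> x" using x(2) by (simp add: set_b0)
    then have se: "?s = a0 j @ [x]" unfolding x(1) by (rule sorted_insert)
    have "length (a0 j) = Suc j" by (simp add: a0_def)
    then have "?s ! Suc j = x" "rem (Suc j) ?s = a0 j" unfolding se by (simp_all add: nth_append rem_def)
    then show "mset (?s ! t # b) = mset ?b \<and> rem t ?s = a0 j" using r x mset_b0_iff[OF x(2)] by simp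
  qed
  have "KB q y ?L = (\<Sum>t<Suc (Suc j). ((-1) ^ t *\<^sub>f omega (Suc q) (?s ! t # b) (rem t ?s)) ?L :: 'k)"
  proof -
    have "?s \<noteq> []" using s(1) by (metis list.size(3) nat.distinct(1))
    then show ?thesis unfolding Ab fst_conv snd_conv by (subst K_rem) (simp_all only: s(1) fscale_sum_apply not_False_eq_True)
  qed
  also have "\<dots> = (\<Sum>t<Suc (Suc j). if t = Suc j then (if y \<in> TI q j then (-1) ^ Suc j else 0) else 0)"
  proof (intro sum.cong refl)
    fix t assume "t \<in> {..<Suc (Suc j)}"
    then have t: "t < Suc (Suc j)" by simp
    have sr: "sorted (rem t ?s)"
    proof -
      have "sorted (take t ?s @ ?s ! t # drop (Suc t) ?s)"
        unfolding id_take_nth_drop[symmetric, OF t[folded s(1)]] by (rule s(2))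
      then show ?thesis unfolding rem_def by (simp add: sorted_append)
    qed
    have "omega (Suc q) (?s ! t # b) (rem t ?s) ?L = (if mset (?s ! t # b) = mset ?b \<and> rem t ?s = a0 j then 1 else 0 :: 'k)"
    proof (rule omega_coordinate)
      show "length (rem t ?s) = length (a0 j)" using t s(1) by (simp add: length_rem a0_def)
    qed (use b sr in \<open>simp_all add: a0_def b0_def del: upt_Suc\<close>)
    also have "\<dots> = (if t = Suc j \<and> y \<in> TI q j then 1 else 0)" unfolding cond[OF t] ..
    finally show "((-1) ^ t *\<^sub>f omega (Suc q) (?s ! t # b) (rem t ?s)) ?L =
      (if t = Suc j then (if y \<in> TI q j then (-1) ^ Suc j else 0) else 0 :: 'k)"
      by (simp add: fscale_def)
  qed
  also have "\<dots> = (if y \<in> TI q j then (-1) ^ Suc j else 0)" by simp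
  finally show ?thesis .
qed

lemma sum_TI:
  fixes f :: "nat set \<times> nat list \<Rightarrow> 'a::comm_monoid_add"
  shows "(\<Sum>y\<in>TI q j. f y) = (\<Sum>x\<in>set (b0 (Suc q) j). \<Sum>b\<in>permutations_of_set (set (b0 (Suc q) j) - {x}). f (insert x {..<Suc j}, b))"
proof -
  have "inj_on (\<lambda>(x, b). (insert x {..<Suc j}, b)) (SIGMA x:set (b0 (Suc q) j). permutations_of_set (set (b0 (Suc q) j) - {x}))"
  proof (rule inj_onI)
    fix y y' :: "nat \<times> nat list"
    assume y: "y \<in> (SIGMA x:set (b0 (Suc q) j). permutations_of_set (set (b0 (Suc q) j) - {x}))"
      and y': "y' \<in> (SIGMA x:set (b0 (Suc q) j). permutations_of_set (set (b0 (Suc q) j) - {x}))"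
      and eq: "(\<lambda>(x, b). (insert x {..<Suc j}, b)) y = (\<lambda>(x, b). (insert x {..<Suc j}, b)) y'"
    have "fst y \<notin> {..<Suc j}" "fst y' \<notin> {..<Suc j}" using y y' by (auto simp: set_b0)
    moreover have "insert (fst y) {..<Suc j} = insert (fst y') {..<Suc j}" "snd y = snd y'"
      using eq by (simp_all add: case_prod_unfold)
    ultimately have "fst y = fst y'" by blast
    then show "y = y'" using \<open>snd y = snd y'\<close> by (rule prod_eqI)
  qed
  then show ?thesis unfolding TI_def by (subst sum.reindex) (simp_all add: sum.Sigma case_prod_unfold)
qed

text \<open>The factor counts the orders of the \<open>q\<close> remaining letters, which commute in
  the symmetric part. By \<open>D_K\<close> the sum on the right is, up to sign and an invertible
  factor, \<open>D\<close> of the multilinear Koszul vector, so that this vector is mapped into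
  \<open>FV\<close>.\<close>

lemma theta_multilinear:
  defines "n \<equiv> \<lambda>q j. Suc (Suc q) + j"
  shows "theta q (Suc j) (n q j) (eps q (Suc j) (n q j) (lab (Suc q) (b0 (Suc q) j @ a0 j))) =
    of_nat (fact q) *\<^sub>f (\<Sum>w<Suc q. K q (b0 (Suc q) j ! w # a0 j) (rem w (b0 (Suc q) j)) :: _ \<Rightarrow> 'k::field)"
proof -
  let ?b = "b0 (Suc q) j" and ?L = "lab (Suc q) (b0 (Suc q) j @ a0 j)"
  have lb: "length ?b = Suc q" by (simp add: b0_def)
  have "theta q (Suc j) (n q j) (eps q (Suc j) (n q j) ?L) =
    (\<Sum>y\<in>KI q (Suc j) (n q j). if y \<in> TI q j then (-1) ^ Suc j *\<^sub>f KB q y else 0 :: _ \<Rightarrow> 'k)"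
    unfolding theta_def n_def
    by (intro sum.cong refl) (simp add: eps_def KB_in_SV KB_multilinear_coordinate)
  also have "\<dots> = (\<Sum>y\<in>TI q j. (-1) ^ Suc j *\<^sub>f KB q y)"
    using TI_subset[of q j] by (simp only: sum.inter_restrict[symmetric] finite_KI n_def Int_absorb1)
  also have "\<dots> = (\<Sum>x\<in>set ?b. \<Sum>b\<in>permutations_of_set (set ?b - {x}). K q (x # a0 j) (remove1 x ?b))"
    unfolding sum_TI
  proof (intro sum.cong refl)
    fix x b assume x: "x \<in> set ?b" and b: "b \<in> permutations_of_set (set ?b - {x})"
    have xj: "Suc j \<le> x" using x by (simp add: set_b0)
    have m: "mset (x # b) = mset ?b" using mset_b0_iff[OF x] b by blast
    then have "mset b = mset (remove1 x ?b)" by (metis mset.simps(2) mset_remove1 add_mset_remove_trivial)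
    moreover have "length b = q" using m lb by (metis length_Cons nat.inject mset_eq_length)
    ultimately have c: "K q (x # a0 j) b = K q (x # a0 j) (remove1 x ?b)" by (rule K_cong)
    have "K q (a0 j @ [x]) b = (-1) ^ Suc j *\<^sub>f (K q (x # a0 j) b :: _ \<Rightarrow> 'k)"
      unfolding K_def using altsum_move[of _ "[]" "a0 j" x "[]"] by (simp add: a0_def del: upt_Suc power_Suc)
    then have "(-1) ^ Suc j *\<^sub>f K q (a0 j @ [x]) b = (-1) ^ Suc j *\<^sub>f (-1) ^ Suc j *\<^sub>f (K q (x # a0 j) b :: _ \<Rightarrow> 'k)"
      by (rule arg_cong)
    also have "\<dots> = K q (x # a0 j) b"
      by (simp del: power_Suc flip: power_mult_distrib)
    finally show "(-1) ^ Suc j *\<^sub>f KB q (insert x {..<Suc j}, b) = (K q (x # a0 j) (remove1 x ?b) :: _ \<Rightarrow> 'k)"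
      unfolding fst_conv snd_conv sorted_insert[OF xj] c .
  qed
  also have "\<dots> = (\<Sum>x\<in>set ?b. of_nat (fact q) *\<^sub>f K q (x # a0 j) (remove1 x ?b))"
  proof (intro sum.cong refl)
    fix x assume "x \<in> set ?b"
    then have "card (permutations_of_set (set ?b - {x})) = fact q" by (simp add: set_b0)
    then show "(\<Sum>b\<in>permutations_of_set (set ?b - {x}). K q (x # a0 j) (remove1 x ?b)) =
      of_nat (fact q) *\<^sub>f (K q (x # a0 j) (remove1 x ?b) :: _ \<Rightarrow> 'k)"
      by (simp only: fun_space.sum_constant_scale)
  qed
  also have "\<dots> = (\<Sum>w<Suc q. of_nat (fact q) *\<^sub>f K q (?b ! w # a0 j) (remove1 (?b ! w) ?b))"
  proof (rule sum.reindex_bij_betw[symmetric])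
    show "bij_betw ((!) ?b) {..<Suc q} (set ?b)"
      by (rule bij_betw_nth) (simp_all add: set_b0 lb)
  qed
  also have "\<dots> = (\<Sum>w<Suc q. of_nat (fact q) *\<^sub>f K q (?b ! w # a0 j) (rem w ?b))"
  proof (intro sum.cong refl arg_cong[where f = "(*\<^sub>f) _"] K_cong)
    fix w assume "w \<in> {..<Suc q}"
    then have w: "w < length ?b" using lb by simp
    show "mset (remove1 (?b ! w) ?b) = mset (rem w ?b)"
      using mset_rem[OF w] by (metis add_mset_remove_trivial mset_remove1)
    then show "length (remove1 (?b ! w) ?b) = q"
      using w lb by (simp add: length_remove1)
  qed
  finally show ?thesis by (simp only: fun_space.scale_sum_right)
qed

lemma of_nat_fact_nonzero:
  assumes "CHAR('k::field) = p" "m < p"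
  shows "of_nat (fact m) \<noteq> (0 :: 'k)"
  using assms(2)
proof (induction m)
  case (Suc m)
  have "of_nat (Suc m) \<noteq> (0 :: 'k)"
    using Suc.prems assms(1) unfolding of_nat_eq_0_iff_char_dvd by (auto dest: dvd_imp_le)
  moreover have "of_nat (fact (Suc m)) = of_nat (Suc m) * (of_nat (fact m) :: 'k)"
    by (simp only: fact_Suc of_nat_mult of_nat_id)
  ultimately show ?case using Suc by (simp only: mult_eq_0_iff) simp
qed simp

lemma D_multilinear:
  assumes p: "CHAR('k::field) = Suc (Suc q) + j"
  defines "n \<equiv> Suc (Suc q) + j"
  shows D_multilinear_FV: "D (Suc q) j n (K (Suc q) (a0 j) (b0 (Suc q) j) :: _ \<Rightarrow> 'k) \<in> FV q (Suc j) n"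
    and D_multilinear_nonzero: "D (Suc q) j n (K (Suc q) (a0 j) (b0 (Suc q) j) :: _ \<Rightarrow> 'k) \<noteq> 0"
proof -
  let ?L = "lab (Suc q) (b0 (Suc q) j @ a0 j)"
  let ?e = "eps q (Suc j) n ?L :: _ \<Rightarrow> 'k"
  let ?z = "\<Sum>w<Suc q. K q (b0 (Suc q) j ! w # a0 j) (rem w (b0 (Suc q) j)) :: _ \<Rightarrow> 'k"
  have p0: "of_nat (Suc (Suc q) + j) = (0 :: 'k)" unfolding p[symmetric] by (rule of_nat_CHAR)
  have DK: "D (Suc q) j n (K (Suc q) (a0 j) (b0 (Suc q) j)) = - (of_nat (fact j) *\<^sub>f ?z)"
    unfolding n_def D_K[OF p0 a0_words b0_words] by simp
  have th: "theta q (Suc j) n ?e = of_nat (fact q) *\<^sub>f ?z" unfolding n_def by (rule theta_multilinear)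
  have fq: "of_nat (fact q) \<noteq> (0 :: 'k)" and fq': "of_nat (fact (Suc q)) \<noteq> (0 :: 'k)" and fj: "of_nat (fact j) \<noteq> (0 :: 'k)"
    by (rule of_nat_fact_nonzero[OF p]; simp)+
  have thF: "theta q (Suc j) n ?e \<in> FV q (Suc j) n" unfolding FV_def by (intro imageI eps_dual)
  have "?z = inverse (of_nat (fact q)) *\<^sub>f theta q (Suc j) n ?e" unfolding th using fq by simp
  then have "?z \<in> FV q (Suc j) n" using thF by (metis fun_space.subspace_scale subspace_FV)
  then show "D (Suc q) j n (K (Suc q) (a0 j) (b0 (Suc q) j) :: _ \<Rightarrow> 'k) \<in> FV q (Suc j) n"
    unfolding DK by (intro fun_space.subspace_neg fun_space.subspace_scale subspace_FV)
  \<comment> \<open>Nonvanishing is seen by pairing with \<open>?e\<close> itself: the value is the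
    cardinality of \<open>TI\<close>, namely \<open>fact (Suc q)\<close>, which is invertible since
    \<open>Suc q\<close> is below the characteristic.\<close>
  have "?e (theta q (Suc j) n ?e) = (\<Sum>y\<in>KI q (Suc j) n. ?e (KB q y) * ?e (KB q y))"
    unfolding theta_def by (rule dual_space_sum[OF eps_dual]) (simp_all add: KB_in_SV)
  also have "\<dots> = (\<Sum>y\<in>KI q (Suc j) n. if y \<in> TI q j then 1 else 0)"
    unfolding n_def
    by (intro sum.cong refl) (simp add: eps_def KB_in_SV KB_multilinear_coordinate flip: power_mult_distrib)
  also have "\<dots> = (\<Sum>y\<in>TI q j. 1)"
    using TI_subset[of q j] by (simp only: sum.inter_restrict[symmetric] finite_KI n_def Int_absorb1)
  also have "\<dots> = (\<Sum>x\<in>set (b0 (Suc q) j). of_nat (fact q))"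
    unfolding sum_TI by (intro sum.cong refl) (simp add: set_b0)
  also have "\<dots> = of_nat (fact (Suc q))" by (simp add: set_b0 distrib_right)
  finally have "theta q (Suc j) n ?e \<noteq> 0" using fq' dual_space_zero[OF eps_dual subspace_SV] by metis
  then have "?z \<noteq> 0" unfolding th by auto
  then have "of_nat (fact j) *\<^sub>f ?z \<noteq> 0" using fj by (metis fun_space.scale_eq_0_iff)
  then show "D (Suc q) j n (K (Suc q) (a0 j) (b0 (Suc q) j) :: _ \<Rightarrow> 'k) \<noteq> 0"
    unfolding DK neg_equal_0_iff_equal .
qed

text \<open>One inclusion needs only the multilinear vector, since it generates the source. For the
  other, the image is a nonzero subfunctor of the next Schur functor and so contains its
  socle.\<close>

lemma D_image:
  assumes p: "CHAR('k::field) = Suc (Suc q) + j"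
  shows "D (Suc q) j n ` SV (Suc q) j n = (FV q (Suc j) n :: (_ \<Rightarrow> 'k) set)"
proof
  let ?p = "Suc (Suc q) + j"
  let ?k0 = "K (Suc q) (a0 j) (b0 (Suc q) j) :: _ \<Rightarrow> 'k"
  have p0: "of_nat (Suc (Suc q) + j) = (0 :: 'k)" unfolding p[symmetric] by (rule of_nat_CHAR)
  have k0: "?k0 \<in> SV (Suc q) j ?p"
    using K_in_SV[OF a0_words b0_words, of "Suc q" j] by simp
  have "SV (Suc q) j n \<subseteq> D (Suc q) j n -` (FV q (Suc j) n :: (_ \<Rightarrow> 'k) set)"
    unfolding SV_span_words
  proof (rule fun_space.span_minimal)
    show "fun_space.subspace (D (Suc q) j n -` (FV q (Suc j) n :: (_ \<Rightarrow> 'k) set))"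
      by (rule module_hom.subspace_vimage[OF flinear_D]) simp
    have "D (Suc q) j n (K (Suc q) a b) \<in> (FV q (Suc j) n :: (_ \<Rightarrow> 'k) set)"
      if ab: "a \<in> words (Suc j) n" "b \<in> words (Suc q) n" for a b
    proof -
      have "?k0 \<in> val (symf (Suc (Suc q)) j) ?p" using k0 SV_subset_val by blast
      then show ?thesis
        unfolding SV_multilinear[OF ab] by (simp only: D_natural) (intro coef_FV D_multilinear_FV[OF p])
    qed
    then show "{K (Suc q) a b |a b. a \<in> words (Suc j) n \<and> b \<in> words (Suc q) n}
      \<subseteq> D (Suc q) j n -` (FV q (Suc j) n :: (_ \<Rightarrow> 'k) set)" by auto
  qed
  then show "D (Suc q) j n ` SV (Suc q) j n \<subseteq> (FV q (Suc j) n :: (_ \<Rightarrow> 'k) set)" by blast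
  show "FV q (Suc j) n \<subseteq> D (Suc q) j n ` (SV (Suc q) j n :: (_ \<Rightarrow> 'k) set)"
  proof (rule FV_socle[where U = "\<lambda>n. D (Suc q) j n ` SV (Suc q) j n"])
    show "fun_space.subspace (D (Suc q) j n ` (SV (Suc q) j n :: (_ \<Rightarrow> 'k) set))" for n
      by (rule module_hom.subspace_image[OF flinear_D subspace_SV])
    show "D (Suc q) j n ` SV (Suc q) j n \<subseteq> (SV q (Suc j) n :: (_ \<Rightarrow> 'k) set)" for n
      using D_SV[OF p0] by blast
    show "D (Suc q) j ?p ?k0 \<in> D (Suc q) j ?p ` SV (Suc q) j ?p" using k0 by (rule imageI)
    show "D (Suc q) j ?p ?k0 \<noteq> 0" by (rule D_multilinear_nonzero[OF p])
    fix m n \<alpha> and v :: "nat multiset list \<Rightarrow> 'k" assume "v \<in> D (Suc q) j m ` SV (Suc q) j m"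
    then obtain u where u: "u \<in> SV (Suc q) j m" "v = D (Suc q) j m u" by blast
    then have "coef (symf (Suc q) (Suc j)) m n \<alpha> v = D (Suc q) j n (coef (symf (Suc (Suc q)) j) m n \<alpha> u)"
      using SV_subset_val by (metis D_natural subsetD)
    then show "coef (symf (Suc q) (Suc j)) m n \<alpha> v \<in> D (Suc q) j n ` SV (Suc q) j n"
      using coef_SV[OF u(1)] by blast
  qed
qed

section \<open>The kernel of the differential\<close>

text \<open>Contraction with the Euler vector field of the variable \<open>x\<close>: by Cartan's formula it is, up to
  exact forms, inverse to \<open>D\<close> on the weight spaces in which the multiplicity of \<open>x\<close> is invertible.\<close>

definition contr :: "nat \<Rightarrow> (nat multiset list \<Rightarrow> 'k::field) \<Rightarrow> nat multiset list \<Rightarrow> 'k"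
  where "contr x v L = (case L of [] \<Rightarrow> 0 | M # cs \<Rightarrow> if x \<in># M then v ((M - {#x#}) # {#x#} # cs) else 0)"

lemma flinear_contr: "flinear (contr x)"
  by (rule flinearI) (auto simp: contr_def fun_eq_iff fscale_def split: list.split)

lemma contr_E:
  assumes "length b = q"
  shows "contr x (E q (b @ y # c)) = (if y = x then E (Suc q) (x # b @ c) else 0)"
proof (rule ext)
  fix L
  show "contr x (E q (b @ y # c)) L = (if y = x then E (Suc q) (x # b @ c) else 0) L"
  proof (cases L)
    case (Cons M cs)
    have "x \<in># M \<and> M - {#x#} = mset b \<longleftrightarrow> M = add_mset x (mset b)" by (auto dest!: multi_member_split)
    then show ?thesis using assms
      by (auto simp: Cons contr_def E_def unit_vec_def lab_def)
  qed (simp add: contr_def E_def unit_vec_def lab_def)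
qed

text \<open>\<open>contr\<close> looks at the first alternating slot, which in \<open>K\<close>
  holds the second letter of the rearranged word, the first being the one moved by the Koszul map.
  Exchanging the two gives the minus sign, and expansion along the first letter leaves Koszul
  vectors.\<close>

lemma contr_K:
  assumes "length a = Suc (Suc j)" "length b = q"
  shows "contr x (K q a b :: _ \<Rightarrow> 'k::field) = - (\<Sum>t<Suc (Suc j). (-1) ^ t *\<^sub>f (if a ! t = x then K (Suc q) (rem t a) (x # b) else 0))"
proof -
  let ?G = "\<lambda>u. if hd u = x then E (Suc (Suc q)) (x # hd (tl u) # b @ tl (tl u)) else 0 :: _ \<Rightarrow> 'k"
  have "contr x (K q a b) = altsum (\<lambda>u. contr x (E (Suc q) (hd u # b @ tl u) :: _ \<Rightarrow> 'k)) a"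
    unfolding K_def altsum_def by (simp only: flinear_sum[OF flinear_contr] flinear_scale[OF flinear_contr])
  also have "\<dots> = altsum (\<lambda>u. if hd (tl u) = x then E (Suc (Suc q)) (x # hd u # b @ tl (tl u)) else 0) a"
  proof (rule altsum_cong)
    fix u assume "mset u = mset a"
    then have "length u = Suc (Suc j)" using assms(1) mset_eq_length by metis
    then obtain y z u' where u: "u = y # z # u'" by (metis length_Suc_conv)
    show "contr x (E (Suc q) (hd u # b @ tl u) :: _ \<Rightarrow> 'k) =
      (if hd (tl u) = x then E (Suc (Suc q)) (x # hd u # b @ tl (tl u)) else 0)"
      using contr_E[where ?'a = 'k, of "y # b" "Suc q" x z u'] assms(2) by (simp add: u)
  qed
  also have "\<dots> = - altsum ?G a"
    by (rule altsum_swap_first) (use assms in simp_all)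
  also have "altsum ?G a = (\<Sum>t<Suc (Suc j). (-1) ^ t *\<^sub>f altsum (\<lambda>u. ?G (a ! t # u)) (rem t a))"
    using assms(1) by (subst altsum_laplace) (auto simp: rem_def)
  also have "\<dots> = (\<Sum>t<Suc (Suc j). (-1) ^ t *\<^sub>f (if a ! t = x then K (Suc q) (rem t a) (x # b) else 0))"
  proof (intro sum.cong refl arg_cong[where f = "(*\<^sub>f) _"])
    fix t
    have "E (Suc (Suc q)) (x # hd u # b @ tl u) = (E (Suc (Suc q)) (hd u # (x # b) @ tl u) :: _ \<Rightarrow> 'k)" for u :: "nat list"
      using E_cong[of "x # hd u # b" "hd u # x # b" "Suc (Suc q)" "tl u"] assms(2) by simp
    then show "altsum (\<lambda>u. ?G (a ! t # u)) (rem t a) = (if a ! t = x then K (Suc q) (rem t a) (x # b) else 0)"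
      by (simp add: K_def)
  qed
  finally show ?thesis .
qed

lemma count_sum_nth: "count (mset a) x = (\<Sum>t<length a. if a ! t = x then 1 else 0)"
proof (induction a)
  case (Cons y a)
  then show ?case by (simp add: sum.lessThan_Suc_shift del: sum.lessThan_Suc)
qed simp

lemma contr_D_K:
  assumes p: "of_nat (Suc q + j) = (0 :: 'k::field)" and a: "a \<in> words (Suc j) n" and b: "b \<in> words q n"
  shows "contr x (D q j n (K q a b :: _ \<Rightarrow> 'k)) = of_nat (fact j) *\<^sub>f (of_nat (count (mset b) x) *\<^sub>f K q a b
    - (\<Sum>t<Suc j. (-1) ^ t *\<^sub>f (if a ! t = x then \<Sum>w<q. K q (b ! w # rem t a) (x # rem w b) else 0)))"
proof -
  have len: "length a = Suc j" "length b = q" using a b by (simp_all add: wordsD)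
  have 1: "contr x (K (q - 1) (b ! w # a) (rem w b)) = - ((if b ! w = x then K q a b else 0)
    - (\<Sum>t<Suc j. (-1) ^ t *\<^sub>f (if a ! t = x then K q (b ! w # rem t a) (x # rem w b) else 0)) :: _ \<Rightarrow> 'k)" if w: "w < q" for w
  proof -
    have q: "Suc (q - 1) = q" using w by simp
    have "contr x (K (q - 1) (b ! w # a) (rem w b)) = - (\<Sum>t<Suc (Suc j). (-1) ^ t *\<^sub>f
      (if (b ! w # a) ! t = x then K q (rem t (b ! w # a)) (x # rem w b) else 0) :: _ \<Rightarrow> 'k)"
      using w len by (subst contr_K[of _ j]) (simp_all only: q length_Cons length_rem)
    also have "(\<Sum>t<Suc (Suc j). (-1) ^ t *\<^sub>f
      (if (b ! w # a) ! t = x then K q (rem t (b ! w # a)) (x # rem w b) else 0) :: _ \<Rightarrow> 'k) =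
      (if b ! w = x then K q a (x # rem w b) else 0)
      + (\<Sum>t<Suc j. (-1) ^ Suc t *\<^sub>f (if a ! t = x then K q (b ! w # rem t a) (x # rem w b) else 0))"
      by (subst sum.lessThan_Suc_shift) (simp only: rem_0 rem_Suc nth_Cons_0 nth_Cons_Suc power_0 fun_space.scale_one)
    also have "(\<Sum>t<Suc j. (-1) ^ Suc t *\<^sub>f (if a ! t = x then K q (b ! w # rem t a) (x # rem w b) else 0)) =
      - (\<Sum>t<Suc j. (-1) ^ t *\<^sub>f (if a ! t = x then K q (b ! w # rem t a) (x # rem w b) else 0) :: _ \<Rightarrow> 'k)"
      by (simp only: power_Suc mult_minus_left mult_1_left fun_space.scale_minus_left sum_negf)
    also have "(if b ! w = x then K q a (x # rem w b) else 0) = (if b ! w = x then K q a b else 0 :: _ \<Rightarrow> 'k)"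
    proof (cases "b ! w = x")
      case True
      have "K q a (b ! w # rem w b) = K q a b"
        by (rule K_cong) (use w len in \<open>simp_all add: mset_rem length_rem\<close>)
      then show ?thesis using True by simp
    qed simp
    finally show ?thesis by (simp only: diff_conv_add_uminus)
  qed
  have "contr x (D q j n (K q a b)) = - (of_nat (fact j) *\<^sub>f (\<Sum>w<q. contr x (K (q - 1) (b ! w # a) (rem w b)) :: _ \<Rightarrow> 'k))"
    unfolding D_K[OF p a b]
    by (simp only: flinear_neg[OF flinear_contr] flinear_scale[OF flinear_contr] flinear_sum[OF flinear_contr])
  also have "(\<Sum>w<q. contr x (K (q - 1) (b ! w # a) (rem w b)) :: _ \<Rightarrow> 'k) =
    (\<Sum>w<q. - ((if b ! w = x then K q a b else 0)
    - (\<Sum>t<Suc j. (-1) ^ t *\<^sub>f (if a ! t = x then K q (b ! w # rem t a) (x # rem w b) else 0))))"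
    by (intro sum.cong refl 1) simp
  also have "\<dots> = - ((\<Sum>w<q. if b ! w = x then K q a b else 0)
    - (\<Sum>w<q. \<Sum>t<Suc j. (-1) ^ t *\<^sub>f (if a ! t = x then K q (b ! w # rem t a) (x # rem w b) else 0)))"
    by (simp only: sum_negf sum_subtractf)
  also have "(\<Sum>w<q. if b ! w = x then K q a b else 0) = of_nat (count (mset b) x) *\<^sub>f (K q a b :: _ \<Rightarrow> 'k)"
    unfolding count_sum_nth len of_nat_sum fun_space.scale_sum_left by (intro sum.cong refl) simp
  also have "(\<Sum>w<q. \<Sum>t<Suc j. (-1) ^ t *\<^sub>f (if a ! t = x then K q (b ! w # rem t a) (x # rem w b) else 0)) =
    (\<Sum>t<Suc j. (-1) ^ t *\<^sub>f (if a ! t = x then \<Sum>w<q. K q (b ! w # rem t a) (x # rem w b) else 0) :: _ \<Rightarrow> 'k)"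
    by (subst sum.swap) (intro sum.cong refl, simp add: fun_space.scale_sum_right)
  finally show ?thesis by (simp only: fun_space.scale_minus_right minus_minus)
qed

text \<open>The Lie derivative along the Euler field of \<open>x\<close> multiplies a form by the
  multiplicity of \<open>x\<close> among all its letters. Subtracting the contraction of
  \<open>D\<close> leaves an exact form, which lies in \<open>FV\<close> by \<open>D_image\<close>;
  the factorial comes from the normalization of \<open>D\<close>.\<close>

lemma cartan:
  assumes p: "CHAR('k::field) = Suc q + j" and a: "a \<in> words (Suc j) n" and b: "b \<in> words q n"
  shows "of_nat (fact j * count (mset (a @ b)) x) *\<^sub>f K q a b - contr x (D q j n (K q a b)) \<in> (FV q j n :: (_ \<Rightarrow> 'k) set)"
proof -
  have len: "length a = Suc j" "length b = q" using a b by (simp_all add: wordsD)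
  have p0: "of_nat (Suc q + j) = (0 :: 'k)" unfolding p[symmetric] by (rule of_nat_CHAR)
  let ?K = "K q a b :: _ \<Rightarrow> 'k"
  let ?S = "\<Sum>t<Suc j. (-1) ^ t *\<^sub>f (if a ! t = x then \<Sum>w<q. K q (b ! w # rem t a) (x # rem w b) else 0) :: _ \<Rightarrow> 'k"
  have eq: "of_nat (fact j * count (mset (a @ b)) x) *\<^sub>f ?K - contr x (D q j n ?K) =
    of_nat (fact j) *\<^sub>f (of_nat (count (mset a) x) *\<^sub>f ?K + ?S)"
    unfolding contr_D_K[OF p0 a b]
    by (simp add: fun_space.scale_right_distrib fun_space.scale_right_diff_distrib fun_space.scale_left_distrib distrib_left)
  show ?thesis
  proof (cases j)
    \<comment> \<open>Without a preceding differential nothing is exact; instead the difference is a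
      multiple of \<open>Suc q\<close>, which is the characteristic here.\<close>
    case 0
    then obtain y where y: "a = [y]" using len by (metis length_0_conv length_Suc_conv)
    have K1: "K q [z] d = (E (Suc q) (z # d) :: _ \<Rightarrow> 'k)" for z d
    proof -
      have "perms (Suc 0) = {[0]}" by (simp add: perms_def lessThan_Suc)
      then show ?thesis by (simp add: K_def altsum_def place_def word_sign_sorted)
    qed
    have "?S = (if y = x then \<Sum>w<q. E (Suc q) (b ! w # x # rem w b) else 0)"
      by (simp add: 0 y K1)
    also have "(\<Sum>w<q. E (Suc q) (b ! w # x # rem w b)) = (\<Sum>w<q. E (Suc q) (x # b) :: _ \<Rightarrow> 'k)"
    proof (intro sum.cong refl)
      fix w assume "w \<in> {..<q}"
      then show "E (Suc q) (b ! w # x # rem w b) = (E (Suc q) (x # b) :: _ \<Rightarrow> 'k)"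
        using E_cong[of "b ! w # x # rem w b" "x # b" "Suc q" "[]"] len
        by (simp add: length_rem mset_rem add_mset_commute)
    qed
    also have "\<dots> = of_nat q *\<^sub>f E (Suc q) (x # b)" by (simp only: fun_space.sum_constant_scale card_lessThan)
    finally have S: "?S = (if y = x then of_nat q *\<^sub>f E (Suc q) (x # b) else 0)" .
    have "of_nat (count (mset a) x) *\<^sub>f ?K + ?S = (if y = x then of_nat (Suc q) *\<^sub>f E (Suc q) (x # b) else 0)"
      unfolding S by (simp add: y K1 fun_space.scale_left_distrib)
    also have "\<dots> = 0" using p0 0 by simp
    finally show ?thesis unfolding eq by (simp add: fun_space.subspace_0)
  next
    case (Suc j')
    have p': "CHAR('k) = Suc (Suc q) + j'" using p Suc by simp
    have p0': "of_nat (Suc (Suc q) + j') = (0 :: 'k)" unfolding p'[symmetric] by (rule of_nat_CHAR)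
    \<comment> \<open>By \<open>contr_K\<close> this is minus the contraction of \<open>?K\<close>.
      Its image under \<open>D\<close> carries \<open>fact j'\<close>, which a further factor
      \<open>j\<close> completes to \<open>fact j\<close>.\<close>
    let ?H = "\<Sum>t<Suc j. (-1) ^ t *\<^sub>f (if a ! t = x then K (Suc q) (rem t a) (x # b) else 0) :: _ \<Rightarrow> 'k"
    have mem: "rem t a \<in> words (Suc j') n" "x # b \<in> words (Suc q) n" if "t < Suc j" "a ! t = x" for t
      using that rem_words[OF a] nth_words[OF a] b by (auto simp: Suc words_def)
    have "?H \<in> SV (Suc q) j' n"
      by (intro fun_space.subspace_sum fun_space.subspace_scale subspace_SV)
        (use mem in \<open>auto intro: K_in_SV fun_space.subspace_0\<close>)
    then have DH: "D (Suc q) j' n ?H \<in> FV q j n" using D_image[OF p', of n] Suc by blast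
    have 1: "D (Suc q) j' n (K (Suc q) (rem t a) (x # b)) =
      - (of_nat (fact j') *\<^sub>f ((-1) ^ t *\<^sub>f ?K + (\<Sum>w<q. K q (b ! w # rem t a) (x # rem w b))))" if t: "t < Suc j" "a ! t = x" for t
    proof -
      have "D (Suc q) j' n (K (Suc q) (rem t a) (x # b)) =
        - (of_nat (fact j') *\<^sub>f (\<Sum>w<Suc q. K q ((x # b) ! w # rem t a) (rem w (x # b)) :: _ \<Rightarrow> 'k))"
        using D_K[OF p0' mem[OF t]] by simp
      also have "(\<Sum>w<Suc q. K q ((x # b) ! w # rem t a) (rem w (x # b)) :: _ \<Rightarrow> 'k) =
        K q (x # rem t a) b + (\<Sum>w<q. K q (b ! w # rem t a) (x # rem w b))"
        by (subst sum.lessThan_Suc_shift) (simp only: rem_0 rem_Suc nth_Cons_0 nth_Cons_Suc)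
      also have "K q (x # rem t a) b = (-1) ^ t *\<^sub>f ?K"
        using K_rem_front[of t a q b] t len by simp
      finally show ?thesis .
    qed
    have "D (Suc q) j' n ?H = (\<Sum>t<Suc j. (-1) ^ t *\<^sub>f (if a ! t = x then D (Suc q) j' n (K (Suc q) (rem t a) (x # b)) else 0))"
      unfolding flinear_sum[OF flinear_D] flinear_scale[OF flinear_D]
      by (intro sum.cong refl) (simp add: flinear_zero[OF flinear_D])
    also have "\<dots> = (\<Sum>t<Suc j. - (of_nat (fact j') *\<^sub>f ((if a ! t = x then ?K else 0)
      + (-1) ^ t *\<^sub>f (if a ! t = x then \<Sum>w<q. K q (b ! w # rem t a) (x # rem w b) else 0))))"
    proof (intro sum.cong refl)
      fix t assume "t \<in> {..<Suc j}"
      then have t: "t < Suc j" by simp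
      have s: "(-1) ^ t *\<^sub>f (-1) ^ t *\<^sub>f v = v" for v :: "nat multiset list \<Rightarrow> 'k"
        by (simp flip: power_mult_distrib)
      show "(-1) ^ t *\<^sub>f (if a ! t = x then D (Suc q) j' n (K (Suc q) (rem t a) (x # b)) else 0) =
        - (of_nat (fact j') *\<^sub>f ((if a ! t = x then ?K else 0)
        + (-1) ^ t *\<^sub>f (if a ! t = x then \<Sum>w<q. K q (b ! w # rem t a) (x # rem w b) else 0)))"
      proof (cases "a ! t = x")
        case True
        show ?thesis
          unfolding if_P[OF True] 1[OF t True] fun_space.scale_minus_right fun_space.scale_right_distrib
          by (simp only: fun_space.scale_left_commute[of _ "of_nat (fact j')"] s)
      next
        case False
        then show ?thesis by (simp only: if_False fun_space.scale_zero_right add_0_right minus_zero)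
      qed
    qed
    also have "\<dots> = - (of_nat (fact j') *\<^sub>f ((\<Sum>t<Suc j. if a ! t = x then ?K else 0) + ?S))"
      by (simp only: sum_negf fun_space.scale_sum_right[symmetric] sum.distrib)
    also have "(\<Sum>t<Suc j. if a ! t = x then ?K else 0) = of_nat (count (mset a) x) *\<^sub>f ?K"
      unfolding count_sum_nth len of_nat_sum fun_space.scale_sum_left by (intro sum.cong refl) simp
    finally have "of_nat j *\<^sub>f D (Suc q) j' n ?H = - (of_nat (fact j) *\<^sub>f (of_nat (count (mset a) x) *\<^sub>f ?K + ?S))"
      by (simp only: Suc fact_Suc of_nat_mult fun_space.scale_scale[symmetric] fun_space.scale_minus_right of_nat_id)
    then have "of_nat (fact j) *\<^sub>f (of_nat (count (mset a) x) *\<^sub>f ?K + ?S) = - (of_nat j *\<^sub>f D (Suc q) j' n ?H)"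
      by (simp only: minus_minus)
    then show ?thesis unfolding eq using DH
      by (simp only:) (intro fun_space.subspace_neg fun_space.subspace_scale subspace_FV)
  qed
qed

lemma diagonal_zip_eq:
  assumes "length I = length J" "length J = length J'" "mset (zip I J) = mset (zip J' J')"
  shows "I = J"
proof -
  have "\<forall>x\<in>set (zip J' J'). fst x = snd x" by (simp add: zip_diagonal_iff)
  then have "\<forall>x\<in>set (zip I J). fst x = snd x" using mset_eq_setD[OF assms(3)] by simp
  then show ?thesis using zip_diagonal_iff[OF assms(1)] by simp
qed

text \<open>On the span of Koszul vectors of one weight, \<open>cartan\<close> multiplies by one and
  the same scalar. For \<open>w\<close> in the kernel of \<open>D\<close> it puts this multiple of
  \<open>w\<close> into \<open>FV\<close>, so only a vanishing scalar has to be treated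
  separately.\<close>

lemma kernel_weight:
  assumes p: "CHAR('k::field) = Suc q + j" and J: "J \<in> words (Suc q + j) n"
    and w: "w \<in> fun_space.span {K q a b | a b. a \<in> words (Suc j) n \<and> b \<in> words q n \<and> mset (a @ b) = mset J}"
    and Dw: "D q j n w = 0"
  shows "(w :: _ \<Rightarrow> 'k) \<in> FV q j n"
proof (cases "\<exists>x. of_nat (count (mset J) x) \<noteq> (0 :: 'k)")
  case True
  then obtain x where x: "of_nat (count (mset J) x) \<noteq> (0 :: 'k)" by blast
  let ?c = "of_nat (fact j * count (mset J) x) :: 'k"
  let ?L = "\<lambda>w :: _ \<Rightarrow> 'k. ?c *\<^sub>f w - contr x (D q j n w)"
  have "flinear ?L"
    by (rule flinearI) (simp_all add: flinear_add[OF flinear_D] flinear_add[OF flinear_contr]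
        flinear_scale[OF flinear_D] flinear_scale[OF flinear_contr] fun_space.scale_right_distrib
        fun_space.scale_right_diff_distrib mult.commute)
  then have "fun_space.subspace (?L -` FV q j n)"
    by (rule module_hom.subspace_vimage) simp
  moreover have "?L (K q a b) \<in> FV q j n" if "a \<in> words (Suc j) n" "b \<in> words q n" "mset (a @ b) = mset J" for a b
    using cartan[OF p that(1,2), of x] unfolding that(3) .
  ultimately have "?L w \<in> FV q j n"
    using fun_space.span_minimal[of "{K q a b | a b. a \<in> words (Suc j) n \<and> b \<in> words q n \<and> mset (a @ b) = mset J}" "?L -` FV q j n"] w
    by blast
  then have cw: "?c *\<^sub>f w \<in> FV q j n"
    by (simp only: Dw flinear_zero[OF flinear_contr] diff_zero)
  have "?c \<noteq> 0" using x of_nat_fact_nonzero[OF p, of j] by simp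
  then have "w = inverse ?c *\<^sub>f ?c *\<^sub>f w"
    by (simp only: fun_space.scale_scale left_inverse not_False_eq_True fun_space.scale_one)
  then show ?thesis using fun_space.subspace_scale[OF subspace_FV cw] by metis
next
  case False
  \<comment> \<open>All multiplicities are divisible by the length of \<open>J\<close>, hence a
    single letter fills \<open>J\<close>.\<close>
  then have dv: "Suc q + j dvd count (mset J) x" for x
    using p unfolding of_nat_eq_0_iff_char_dvd by simp
  define x where "x = J ! 0"
  have lenJ: "length J = Suc q + j" using J by (simp add: wordsD)
  have "x \<in> set J" unfolding x_def using lenJ by (intro nth_mem) simp
  then have "0 < count (mset J) x" by (simp add: count_greater_zero_iff)
  then have "Suc q + j \<le> count (mset J) x" using dv[of x] by (auto dest: dvd_imp_le)
  then have "count (mset J) x = size (mset J)" using lenJ count_le_size[of "mset J" x] by simp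
  then have Jx: "mset J = replicate_mset (Suc q + j) x"
  proof -
    obtain C where C: "mset J = replicate_mset (count (mset J) x) x + C"
      using count_le_replicate_mset_subset_eq[of "count (mset J) x" "mset J" x] mset_subset_eq_exists_conv by blast
    have "size (mset J) = count (mset J) x + size C" using arg_cong[OF C, of size] by simp
    then have "C = {#}" using \<open>count (mset J) x = size (mset J)\<close> by simp
    then show ?thesis using C lenJ \<open>count (mset J) x = size (mset J)\<close> by simp
  qed
  have xn: "x < n" using \<open>x \<in> set J\<close> J by (simp add: wordsD)
  have ab: "a = replicate (Suc j) x \<and> b = replicate q x"
    if "a \<in> words (Suc j) n" "b \<in> words q n" "mset (a @ b) = mset J" for a b
  proof -
    have "set (a @ b) \<subseteq> {x}" using that(3) unfolding Jx
      by (metis mset_replicate mset_eq_setD set_replicate_conv_if empty_subsetI order_refl)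
    then show ?thesis using wordsD(1)[OF that(1)] wordsD(1)[OF that(2)]
      by (auto intro!: replicate_eqI simp del: replicate_Suc)
  qed
  \<comment> \<open>For \<open>j = 0\<close> this is a pure power of \<open>x\<close>, obtained from
    \<open>v0\<close> by substituting \<open>x\<close> for 0; for larger \<open>j\<close> the
    alternating part has a repeated letter and the vector is zero.\<close>
  have "K q (replicate (Suc j) x) (replicate q x) \<in> (FV q j n :: (_ \<Rightarrow> 'k) set)"
  proof (cases j)
    case 0
    let ?a = "replicate (Suc 0) x" and ?b = "replicate q x"
    have w: "[0..<Suc 0] \<in> words (Suc 0) (Suc 0)" "replicate q 0 \<in> words q (Suc 0)"
      by (auto simp: words_def)
    let ?Z = "mset (zip (?a @ ?b) ([0..<Suc 0] @ replicate q 0))"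
    have "{I \<in> words (Suc 0 + q) n. mset (zip I ([0..<Suc 0] @ replicate q 0)) = ?Z} = {?a @ ?b}"
    proof (intro set_eqI iffI)
      fix I assume "I \<in> {I \<in> words (Suc 0 + q) n. mset (zip I ([0..<Suc 0] @ replicate q 0)) = ?Z}"
      then have I: "length I = Suc q" "mset (zip I ([0..<Suc 0] @ replicate q 0)) = ?Z"
        using wordsD(1)[of I "Suc 0 + q" n] by simp_all
      from I(2) have "mset (map fst (zip I ([0..<Suc 0] @ replicate q 0))) = mset (map fst (zip (?a @ ?b) ([0..<Suc 0] @ replicate q 0)))"
        unfolding mset_map by (rule arg_cong)
      then have "mset I = mset (?a @ ?b)" using I(1) by (simp add: map_fst_zip del: replicate_Suc upt_Suc)
      then have "set I = set (?a @ ?b)" by (rule mset_eq_setD)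
      then have "set I = {x}" by (auto simp: set_replicate_conv_if split: if_splits)
      then have "I = replicate (Suc q) x" using I(1) by (intro replicate_eqI) auto
      then show "I \<in> {?a @ ?b}" by simp
    qed (use xn in \<open>auto simp: words_def\<close>)
    then have "coef (symf (Suc q) 0) (Suc 0) n (mm ?Z) (v0 q 0) = (K q ?a ?b :: _ \<Rightarrow> 'k)"
      unfolding v0_def coef_K[OF w] by simp
    then show ?thesis unfolding 0 by (metis coef_FV v0_in_FV)
  next
    case (Suc j')
    then have "\<not> distinct (replicate (Suc j) x)" by simp
    then show ?thesis by (simp only: K_not_distinct fun_space.subspace_0[OF subspace_FV] not_False_eq_True)
  qed
  then have "{K q a b | a b. a \<in> words (Suc j) n \<and> b \<in> words q n \<and> mset (a @ b) = mset J} \<subseteq> (FV q j n :: (_ \<Rightarrow> 'k) set)"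
    using ab by blast
  then show ?thesis using w fun_space.span_minimal[OF _ subspace_FV] by blast
qed

text \<open>The axiom T(1) = 1 writes \<open>v\<close> as the sum of its weight components. By
  naturality \<open>D\<close> kills each of them, so \<open>kernel_weight\<close> applies to every
  one.\<close>

lemma D_kernel:
  assumes p: "CHAR('k::field) = Suc q + j" and v: "v \<in> SV q j n" and Dv: "D q j n v = 0"
  shows "(v :: _ \<Rightarrow> 'k) \<in> FV q j n"
proof -
  let ?e = "Suc q + j" and ?c = "\<lambda>\<alpha>. coef (symf (Suc q) j) n n \<alpha> v"
  let ?d = "\<lambda>\<alpha>. \<Prod>x\<in>Poly_Mapping.keys \<alpha>. (if fst x = snd x then 1 else 0 :: 'k) ^ Poly_Mapping.lookup \<alpha> x"
  have vv: "v \<in> val (symf (Suc q) j) n" using v SV_subset_val by blast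
  then have sum_v: "(\<Sum>\<alpha>\<in>monomials ?e n n. ?d \<alpha> *\<^sub>f ?c \<alpha>) = v"
    using strict_polynomial_symf[where ?'k = 'k, of "Suc q" j] unfolding strict_polynomial_def by blast
  have "?d \<alpha> *\<^sub>f ?c \<alpha> \<in> FV q j n" if \<alpha>: "\<alpha> \<in> monomials ?e n n" for \<alpha>
  proof (cases "\<forall>x\<in>Poly_Mapping.keys \<alpha>. fst x = snd x")
    case True
    obtain Z where Z: "\<alpha> = mm Z" "set_mset Z \<subseteq> {..<n} \<times> {..<n}" "size Z = ?e"
      using \<alpha> by (auto simp: monomials_eq)
    obtain I J where IJ: "I \<in> words ?e n" "J \<in> words ?e n" "Z = mset (zip I J)"
      using ex_words_zip[OF Z(2,3)] by blast
    have "I = J" using True unfolding Z(1) IJ(3) keys_mm set_mset_mset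
      using zip_diagonal_iff[of I J] IJ(1,2) by (simp add: wordsD)
    then have \<alpha>': "\<alpha> = mm (mset (zip J J))" using Z IJ by simp
    have "D q j n (?c \<alpha>) = 0"
      unfolding D_natural[OF vv] Dv by (rule flinear_zero[OF flinear_coef_symf])
    moreover have "?c \<alpha> \<in> fun_space.span {K q a b | a b. a \<in> words (Suc j) n \<and> b \<in> words q n \<and> mset (a @ b) = mset J}"
    proof -
      let ?U = "fun_space.span {K q a b :: _ \<Rightarrow> 'k | a b. a \<in> words (Suc j) n \<and> b \<in> words q n \<and> mset (a @ b) = mset J}"
      have "SV q j n \<subseteq> coef (symf (Suc q) j) n n \<alpha> -` ?U"
        unfolding SV_span_words
      proof (rule fun_space.span_minimal)
        show "fun_space.subspace (coef (symf (Suc q) j) n n \<alpha> -` ?U)"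
          by (rule module_hom.subspace_vimage[OF flinear_coef_symf]) simp
        have "coef (symf (Suc q) j) n n \<alpha> (K q a b) \<in> ?U" if ab: "a \<in> words (Suc j) n" "b \<in> words q n" for a b
          unfolding \<alpha>' coef_K[OF ab]
        proof (intro fun_space.span_sum fun_space.span_base)
          fix I assume I: "I \<in> {I \<in> words (Suc j + q) n. mset (zip I (a @ b)) = mset (zip J J)}"
          then have eq: "I = a @ b"
            using wordsD(1)[of I "Suc j + q" n] wordsD(1)[OF ab(1)] wordsD(1)[OF ab(2)] wordsD(1)[OF IJ(2)]
            by (intro diagonal_zip_eq[of I "a @ b" J]) simp_all
          have "map fst (zip I (a @ b)) = a @ b" "map fst (zip J J) = J" by (simp_all add: eq)
          then have "mset (a @ b) = mset J" using I by (metis (mono_tags, lifting) mem_Collect_eq mset_map)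
          then show "K q (take (Suc j) I) (drop (Suc j) I) \<in> {K q a b | a b. a \<in> words (Suc j) n \<and> b \<in> words q n \<and> mset (a @ b) = mset J}"
            using ab eq wordsD(1)[OF ab(1)] by auto
        qed
        then show "{K q a b |a b. a \<in> words (Suc j) n \<and> b \<in> words q n} \<subseteq> coef (symf (Suc q) j) n n \<alpha> -` ?U" by auto
      qed
      then show ?thesis using v by blast
    qed
    ultimately have "?c \<alpha> \<in> FV q j n" by (intro kernel_weight[OF p IJ(2)])
    then show ?thesis by (intro fun_space.subspace_scale subspace_FV)
  next
    case False
    then have "?d \<alpha> = 0" unfolding diagonal_power by (rule if_not_P)
    then show ?thesis by (simp only: fun_space.scale_zero_left fun_space.subspace_0[OF subspace_FV])
  qed
  then have "(\<Sum>\<alpha>\<in>monomials ?e n n. ?d \<alpha> *\<^sub>f ?c \<alpha>) \<in> FV q j n"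
    by (intro fun_space.subspace_sum subspace_FV)
  then show ?thesis by (simp only: sum_v)
qed

section \<open>The short exact sequences\<close>

lemma coef_W_dual: "coef (Wf q i) m n \<alpha> f v = (if v \<in> SV q i n then f (coef (symf (Suc q) i) n m (mono_transpose \<alpha>) v) else 0)"
  by (simp add: coef_Wf)

text \<open>The kernel of a symmetric form is the annihilator of its image. Consequently
  \<open>theta f\<close> carries the same information as the restriction of \<open>f\<close> to
  \<open>FV\<close>, which identifies the simple functor with its dual.\<close>

lemma theta_eq_0_iff:
  fixes f :: "(nat multiset list \<Rightarrow> 'k::field) \<Rightarrow> 'k"
  assumes f: "f \<in> dual_space (SV q i n)"
  shows "theta q i n f = 0 \<longleftrightarrow> (\<forall>v\<in>FV q i n. f v = 0)"
proof
  assume z: "theta q i n f = 0"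
  show "\<forall>v\<in>FV q i n. f v = 0"
  proof
    fix v :: "nat multiset list \<Rightarrow> 'k" assume "v \<in> FV q i n"
    then obtain g where g: "g \<in> dual_space (SV q i n)" "v = theta q i n g" by (auto simp: FV_def)
    then show "f v = 0" using theta_symmetric[OF g(1) f] z dual_space_zero[OF g(1) subspace_SV] by simp
  qed
next
  assume z: "\<forall>v\<in>FV q i n. f v = 0"
  show "theta q i n f = 0"
  proof (rule ext)
    fix L
    have "theta q i n f L = eps q i n L (theta q i n f)" by (simp add: eps_def theta_in_SV)
    also have "\<dots> = f (theta q i n (eps q i n L))" by (rule theta_symmetric[OF f eps_dual])
    also have "\<dots> = 0" using z by (simp add: FV_def eps_dual)
    finally show "theta q i n f L = 0 L" by simp
  qed
qed

lemma theta_eq_iff: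
  fixes f g :: "(nat multiset list \<Rightarrow> 'k::field) \<Rightarrow> 'k"
  assumes f: "f \<in> dual_space (SV q i n)" and g: "g \<in> dual_space (SV q i n)"
  shows "theta q i n f = theta q i n g \<longleftrightarrow> (\<forall>v\<in>FV q i n. f v = g v)"
proof -
  have "f - g \<in> dual_space (SV q i n)"
    by (rule fun_space.subspace_diff[OF subspace_dual_space f g])
  from theta_eq_0_iff[OF this] show ?thesis
    by (simp add: flinear_diff[OF flinear_theta])
qed

lemma strict_polynomial_zero: "strict_polynomial e (zero_spf :: ('x, 'k::field) spf)"
proof -
  have "fin_dim ({0} :: ('x \<Rightarrow> 'k) set)"
    using fin_dim_span[of "{}"] by simp
  then show ?thesis
    by (simp add: strict_polynomial_def zero_spf_def linear_between_def)
qed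

text \<open>For \<open>q = 0\<close> the sum in \<open>D_K\<close> is empty, so \<open>D\<close>
  vanishes on the whole Schur functor and \<open>D_kernel\<close> covers all of it.\<close>

lemma FV_0:
  assumes p: "CHAR('k::field) = Suc j"
  shows "FV 0 j n = (SV 0 j n :: (_ \<Rightarrow> 'k) set)"
proof
  show "FV 0 j n \<subseteq> (SV 0 j n :: (_ \<Rightarrow> 'k) set)" by (rule FV_subset_SV)
  have p': "CHAR('k) = Suc 0 + j" using p by simp
  have p0: "of_nat (Suc 0 + j) = (0 :: 'k)" unfolding p'[symmetric] by (rule of_nat_CHAR)
  have "SV 0 j n \<subseteq> D 0 j n -` {0 :: _ \<Rightarrow> 'k}"
    unfolding SV_span_words
  proof (rule fun_space.span_minimal)
    show "fun_space.subspace (D 0 j n -` {0 :: _ \<Rightarrow> 'k})"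
      by (rule module_hom.subspace_vimage[OF flinear_D]) simp
    have "D 0 j n (K 0 a b) = (0 :: _ \<Rightarrow> 'k)" if ab: "a \<in> words (Suc j) n" "b \<in> words 0 n" for a b
      unfolding D_K[OF p0 ab] by (simp only: lessThan_0 sum.empty fun_space.scale_zero_right neg_equal_0_iff_equal)
    then show "{K 0 a b |a b. a \<in> words (Suc j) n \<and> b \<in> words 0 n} \<subseteq> D 0 j n -` {0 :: _ \<Rightarrow> 'k}" by blast
  qed
  then show "SV 0 j n \<subseteq> (FV 0 j n :: (_ \<Rightarrow> 'k) set)"
    using D_kernel[OF p'] by blast
qed

section \<open>The sequence for the Schur functor\<close>

abbreviation Ff :: "nat \<Rightarrow> nat \<Rightarrow> (nat multiset list, 'k::field) spf"
  where "Ff q i \<equiv> simple_functor (hk q i)"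

lemma spf_hom_inclusion: "spf_hom (Ff q j) (Sf q j) (\<lambda>n v. v)"
  unfolding spf_hom_def val_simple val_Sf coef_simple coef_Sf linear_between_def
  using FV_subset_SV by auto

lemma short_exact_S:
  assumes p: "CHAR('k::field) = Suc (Suc q) + j"
  shows "short_exact (Suc (Suc q) + j) (Ff (Suc q) j) (\<lambda>n v. v) (Sf (Suc q) j) (D (Suc q) j) (Ff q (Suc j) :: (_, 'k) spf)"
proof -
  have p0: "of_nat (Suc (Suc q) + j) = (0 :: 'k)" unfolding p[symmetric] by (rule of_nat_CHAR)
  have "strict_polynomial (Suc (Suc q) + j) (Ff q (Suc j) :: (_, 'k) spf)"
    using strict_polynomial_simple[of q "Suc j"] by simp
  moreover have "strict_polynomial (Suc (Suc q) + j) (Ff (Suc q) j :: (_, 'k) spf)"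
    by (rule strict_polynomial_simple)
  moreover have "strict_polynomial (Suc (Suc q) + j) (Sf (Suc q) j :: (_, 'k) spf)"
    by (rule strict_polynomial_Sf)
  moreover have "spf_hom (Sf (Suc q) j) (Ff q (Suc j)) (D (Suc q) j :: _ \<Rightarrow> (_ \<Rightarrow> 'k) \<Rightarrow> _)"
    unfolding spf_hom_def val_simple val_Sf coef_simple coef_Sf
  proof (intro conjI allI ballI)
    show "linear_between (SV (Suc q) j n) (FV q (Suc j) n) (D (Suc q) j n :: (_ \<Rightarrow> 'k) \<Rightarrow> _)" for n
      by (rule linear_between_flinear[OF flinear_D]) (use D_image[OF p, of n] in blast)
    show "D (Suc q) j n (coef (symf (Suc (Suc q)) j) m n \<alpha> v) = coef (symf (Suc q) (Suc j)) m n \<alpha> (D (Suc q) j m v)"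
      if "v \<in> SV (Suc q) j m" for m n \<alpha> and v :: "_ \<Rightarrow> 'k"
      using that SV_subset_val by (intro D_natural) blast
  qed
  moreover have "FV (Suc q) j n = {v \<in> SV (Suc q) j n. D (Suc q) j n v = (0 :: _ \<Rightarrow> 'k)}" for n
    using FV_subset_SV D_FV[OF p0] D_kernel[OF p] by blast
  ultimately show ?thesis
    unfolding short_exact_def val_simple val_Sf
    using spf_hom_inclusion D_image[OF p] by auto
qed

lemma short_exact_S_last:
  assumes p: "CHAR('k::field) = Suc j"
  shows "short_exact (Suc j) (Ff 0 j) (\<lambda>n v. v) (Sf 0 j) (\<lambda>n v. 0) (zero_spf :: (nat multiset list, 'k) spf)"
proof -
  have s: "strict_polynomial (Suc j) (Ff 0 j :: (_, 'k) spf)" "strict_polynomial (Suc j) (Sf 0 j :: (_, 'k) spf)"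
    using strict_polynomial_simple[of 0 j] strict_polynomial_Sf[of 0 j] by simp_all
  have h: "spf_hom (Sf 0 j) (zero_spf :: (nat multiset list, 'k) spf) (\<lambda>n v. 0)"
    by (auto simp: spf_hom_def zero_spf_def linear_between_def)
  have im: "(\<lambda>v. 0) ` SV 0 j n = {0 :: nat multiset list \<Rightarrow> 'k}" for n
    using fun_space.subspace_0[OF subspace_SV] by auto
  have z: "val (zero_spf :: (nat multiset list, 'k) spf) n = {0}" for n by (simp add: zero_spf_def)
  show ?thesis
    unfolding short_exact_def val_simple val_Sf z im FV_0[OF p]
    using s strict_polynomial_zero spf_hom_inclusion h by auto
qed

section \<open>The sequence for the Weyl functor, obtained by transposing\<close>

lemma spf_hom_theta: "spf_hom (Wf q j) (Ff q j) (theta q j)"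
  unfolding spf_hom_def val_simple val_Wf coef_simple
proof (intro conjI allI ballI)
  show "linear_between (dual_space (SV q j n)) (FV q j n) (theta q j n)" for n
    by (rule linear_between_flinear[OF flinear_theta]) (simp add: FV_def)
qed (rule theta_natural)

definition pull :: "nat \<Rightarrow> nat \<Rightarrow> nat \<Rightarrow> ((nat multiset list \<Rightarrow> 'k::field) \<Rightarrow> 'k) \<Rightarrow> (nat multiset list \<Rightarrow> 'k) \<Rightarrow> 'k"
  where "pull q j n f = (\<lambda>u. if u \<in> SV (Suc q) j n then f (D (Suc q) j n u) else 0)"

text \<open>The transpose of \<open>D\<close>, with the simple functor identified with its dual by the form defined by \<open>theta\<close>.\<close>

definition D_dual :: "nat \<Rightarrow> nat \<Rightarrow> nat \<Rightarrow> (nat multiset list \<Rightarrow> 'k::field) \<Rightarrow> (nat multiset list \<Rightarrow> 'k) \<Rightarrow> 'k"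
  where "D_dual q j n v = pull q j n (SOME f. f \<in> dual_space (SV q (Suc j) n) \<and> theta q (Suc j) n f = v)"

text \<open>A form that vanishes on the kernel of \<open>L\<close> factors through \<open>L\<close>;
  the induced form on the image is then extended to all coordinates.\<close>

lemma dual_factor:
  fixes g :: "('x \<Rightarrow> 'k::field) \<Rightarrow> 'k" and L :: "('x \<Rightarrow> 'k) \<Rightarrow> 'y \<Rightarrow> 'k"
  assumes g: "g \<in> dual_space V" and V: "fun_space.subspace V" and L: "flinear L"
    and z: "\<And>v. v \<in> V \<Longrightarrow> L v = 0 \<Longrightarrow> g v = 0" and X: "finite X" "L ` V \<subseteq> supported X"
  obtains c where "\<And>v. v \<in> V \<Longrightarrow> g v = (\<Sum>M\<in>X. c M * L v M)"
proof -
  have well: "g u = g v" if "u \<in> V" "v \<in> V" "L u = L v" for u v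
  proof -
    have "u - v \<in> V" using that V by (intro fun_space.subspace_diff)
    moreover have "L (u - v) = 0" using that by (simp add: flinear_diff[OF L])
    ultimately have "g (u - v) = 0" by (rule z)
    moreover have "g (u - v + v) = g (u - v) + g v"
      using g that \<open>u - v \<in> V\<close> unfolding dual_space_iff by blast
    moreover have "u - v + v = u" by (rule diff_add_cancel)
    ultimately show ?thesis by simp
  qed
  define h where "h = (\<lambda>w. if w \<in> L ` V then g (SOME u. u \<in> V \<and> L u = w) else 0)"
  have h: "h (L v) = g v" if "v \<in> V" for v
  proof -
    have "(SOME u. u \<in> V \<and> L u = L v) \<in> V \<and> L (SOME u. u \<in> V \<and> L u = L v) = L v"
      by (rule someI[of _ v]) (simp add: that)
    then have "g (SOME u. u \<in> V \<and> L u = L v) = g v" using well that by blast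
    then show ?thesis unfolding h_def using that by simp
  qed
  have add: "h (L u + L v) = h (L u) + h (L v)" if "u \<in> V" "v \<in> V" for u v
  proof -
    have "h (L u + L v) = h (L (u + v))" by (simp only: flinear_add[OF L])
    also have "\<dots> = g (u + v)" using that V by (intro h fun_space.subspace_add)
    also have "\<dots> = g u + g v" using g that unfolding dual_space_iff by blast
    finally show ?thesis using h that by simp
  qed
  have sc: "h (c *\<^sub>f L v) = c * h (L v)" if "v \<in> V" for c v
  proof -
    have "h (c *\<^sub>f L v) = h (L (c *\<^sub>f v))" by (simp only: flinear_scale[OF L])
    also have "\<dots> = g (c *\<^sub>f v)" using that V by (intro h fun_space.subspace_scale)
    also have "\<dots> = c * g v" using g that unfolding dual_space_iff by blast
    finally show ?thesis using h that by simp
  qed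
  have "h \<in> dual_space (L ` V)"
    unfolding dual_space_iff using add sc by (auto simp: h_def)
  moreover have "fun_space.subspace (L ` V)" by (rule module_hom.subspace_image[OF L V])
  ultimately obtain c where c: "\<And>w. w \<in> L ` V \<Longrightarrow> h w = (\<Sum>M\<in>X. c M * w M)"
    using dual_space_extend[OF _ _ X(2,1)] by blast
  show ?thesis by (rule that[of c]) (use c h in force)
qed

locale hook_char =
  fixes q j :: nat and k :: "'k::field itself"
  assumes char: "CHAR('k) = Suc (Suc q) + j"
begin

lemma of_nat_p: "of_nat (Suc (Suc q) + j) = (0 :: 'k)"
  unfolding char[symmetric] by (rule of_nat_CHAR)

lemma D_in_FV: "u \<in> SV (Suc q) j n \<Longrightarrow> D (Suc q) j n u \<in> (FV q (Suc j) n :: (_ \<Rightarrow> 'k) set)"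
  using D_image[OF char, of n] by blast

lemma D_in_SV: "u \<in> SV (Suc q) j n \<Longrightarrow> D (Suc q) j n u \<in> (SV q (Suc j) n :: (_ \<Rightarrow> 'k) set)"
  using D_in_FV FV_subset_SV by blast

lemma pull_dual:
  fixes f :: "(nat multiset list \<Rightarrow> 'k) \<Rightarrow> 'k"
  assumes f: "f \<in> dual_space (SV q (Suc j) n)"
  shows "pull q j n f \<in> dual_space (SV (Suc q) j n)"
  unfolding dual_space_iff
proof (intro conjI ballI allI impI)
  fix u v :: "nat multiset list \<Rightarrow> 'k" assume uv: "u \<in> SV (Suc q) j n" "v \<in> SV (Suc q) j n"
  then have "u + v \<in> SV (Suc q) j n" by (intro fun_space.subspace_add subspace_SV)
  moreover have "f (D (Suc q) j n u + D (Suc q) j n v) = f (D (Suc q) j n u) + f (D (Suc q) j n v)"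
    using f D_in_SV[OF uv(1)] D_in_SV[OF uv(2)] unfolding dual_space_iff by blast
  ultimately show "pull q j n f (u + v) = pull q j n f u + pull q j n f v"
    using uv by (simp only: pull_def if_True flinear_add[OF flinear_D])
next
  fix c and v :: "nat multiset list \<Rightarrow> 'k" assume v: "v \<in> SV (Suc q) j n"
  then have "c *\<^sub>f v \<in> SV (Suc q) j n" by (intro fun_space.subspace_scale subspace_SV)
  moreover have "f (c *\<^sub>f D (Suc q) j n v) = c * f (D (Suc q) j n v)"
    using f D_in_SV[OF v] unfolding dual_space_iff by blast
  ultimately show "pull q j n f (c *\<^sub>f v) = c * pull q j n f v"
    using v by (simp only: pull_def if_True flinear_scale[OF flinear_D])
qed (simp add: pull_def)

text \<open>\<open>D\<close> maps onto \<open>FV\<close>, so the pullback of a form sees its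
  restriction to \<open>FV\<close> and nothing else, just as \<open>theta\<close> does. This makes
  the choice in \<open>D_dual\<close> harmless and \<open>D_dual\<close> injective.\<close>

lemma pull_eq_iff:
  fixes f g :: "(nat multiset list \<Rightarrow> 'k) \<Rightarrow> 'k"
  assumes f: "f \<in> dual_space (SV q (Suc j) n)" and g: "g \<in> dual_space (SV q (Suc j) n)"
  shows "pull q j n f = pull q j n g \<longleftrightarrow> theta q (Suc j) n f = theta q (Suc j) n g"
proof -
  have "pull q j n f = pull q j n g \<longleftrightarrow> (\<forall>u\<in>SV (Suc q) j n. f (D (Suc q) j n u) = g (D (Suc q) j n u))"
    by (auto simp: pull_def fun_eq_iff)
  also have "\<dots> \<longleftrightarrow> (\<forall>v\<in>FV q (Suc j) n. f v = g v)"
    unfolding D_image[OF char, symmetric] by blast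
  finally show ?thesis unfolding theta_eq_iff[OF f g] .
qed

lemma D_dual_theta:
  fixes f :: "(nat multiset list \<Rightarrow> 'k) \<Rightarrow> 'k"
  assumes f: "f \<in> dual_space (SV q (Suc j) n)"
  shows "D_dual q j n (theta q (Suc j) n f) = pull q j n f"
proof -
  let ?P = "\<lambda>g. g \<in> dual_space (SV q (Suc j) n) \<and> theta q (Suc j) n g = theta q (Suc j) n f"
  have "?P (Eps ?P)" by (rule someI[of ?P f]) (simp add: f)
  then show ?thesis unfolding D_dual_def using pull_eq_iff[OF _ f] by blast
qed

lemma spf_hom_D_dual: "spf_hom (Ff q (Suc j)) (Wf (Suc q) j) (D_dual q j :: _ \<Rightarrow> (_ \<Rightarrow> 'k) \<Rightarrow> _)"
  unfolding spf_hom_def val_simple val_Wf coef_simple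
proof (intro conjI allI ballI)
  fix n
  have pull_add: "pull q j n (f + g) = pull q j n f + pull q j n g"
    and pull_scale: "pull q j n (c *\<^sub>f f) = c *\<^sub>f pull q j n f"
    for f g :: "(nat multiset list \<Rightarrow> 'k) \<Rightarrow> 'k" and c
    by (auto simp: pull_def fun_eq_iff fscale_def)
  show "linear_between (FV q (Suc j) n) (dual_space (SV (Suc q) j n)) (D_dual q j n :: (_ \<Rightarrow> 'k) \<Rightarrow> _)"
    unfolding linear_between_def
  proof (intro conjI ballI allI)
    show "D_dual q j n ` FV q (Suc j) n \<subseteq> (dual_space (SV (Suc q) j n) :: ((_ \<Rightarrow> 'k) \<Rightarrow> 'k) set)"
      by (auto simp: FV_def D_dual_theta pull_dual)
    fix v :: "nat multiset list \<Rightarrow> 'k" assume "v \<in> FV q (Suc j) n"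
    then obtain f where f: "f \<in> dual_space (SV q (Suc j) n)" "v = theta q (Suc j) n f" by (auto simp: FV_def)
    show "D_dual q j n (c *\<^sub>f v) = c *\<^sub>f D_dual q j n v" for c
      using D_dual_theta[OF fun_space.subspace_scale[OF subspace_dual_space f(1)], of c] D_dual_theta[OF f(1)]
      by (simp only: f(2) flinear_scale[OF flinear_theta] pull_scale)
    fix w :: "nat multiset list \<Rightarrow> 'k" assume "w \<in> FV q (Suc j) n"
    then obtain g where g: "g \<in> dual_space (SV q (Suc j) n)" "w = theta q (Suc j) n g" by (auto simp: FV_def)
    show "D_dual q j n (v + w) = D_dual q j n v + D_dual q j n w"
      using D_dual_theta[OF fun_space.subspace_add[OF subspace_dual_space f(1) g(1)]] D_dual_theta[OF f(1)] D_dual_theta[OF g(1)]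
      by (simp only: f(2) g(2) flinear_add[OF flinear_theta] pull_add)
  qed
next
  fix m n \<alpha> and v :: "nat multiset list \<Rightarrow> 'k" assume "v \<in> FV q (Suc j) m"
  then obtain f where f: "f \<in> dual_space (SV q (Suc j) m)" "v = theta q (Suc j) m f" by (auto simp: FV_def)
  have "D_dual q j n (coef (symf (Suc q) (Suc j)) m n \<alpha> v) = pull q j n (coef (Wf q (Suc j)) m n \<alpha> f)"
    unfolding f(2) theta_natural[OF f(1), symmetric] by (rule D_dual_theta[OF coef_Wf_closed[OF f(1)]])
  also have "\<dots> = coef (Wf (Suc q) j) m n \<alpha> (pull q j m f)"
  proof (rule ext)
    fix u :: "nat multiset list \<Rightarrow> 'k"
    show "pull q j n (coef (Wf q (Suc j)) m n \<alpha> f) u = coef (Wf (Suc q) j) m n \<alpha> (pull q j m f) u"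
    proof (cases "u \<in> SV (Suc q) j n")
      case True
      then have "u \<in> val (symf (Suc (Suc q)) j) n" using SV_subset_val by blast
      from D_natural[OF this, of m "mono_transpose \<alpha>"] show ?thesis
        using True by (simp add: pull_def coef_W_dual D_in_SV coef_SV)
    qed (simp add: pull_def coef_W_dual)
  qed
  also have "pull q j m f = D_dual q j m v" using D_dual_theta[OF f(1)] f(2) by simp
  finally show "D_dual q j n (coef (symf (Suc q) (Suc j)) m n \<alpha> v) = coef (Wf (Suc q) j) m n \<alpha> (D_dual q j m v)" .
qed

lemma D_dual_inj: "inj_on (D_dual q j n :: (_ \<Rightarrow> 'k) \<Rightarrow> _) (FV q (Suc j) n)"
proof (rule inj_onI)
  fix v w :: "nat multiset list \<Rightarrow> 'k"
  assume "v \<in> FV q (Suc j) n" "w \<in> FV q (Suc j) n" and eq: "D_dual q j n v = D_dual q j n w"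
  then obtain f g where f: "f \<in> dual_space (SV q (Suc j) n)" "v = theta q (Suc j) n f"
    and g: "g \<in> dual_space (SV q (Suc j) n)" "w = theta q (Suc j) n g" by (auto simp: FV_def)
  have "pull q j n f = pull q j n g"
    using eq unfolding f(2) g(2) D_dual_theta[OF f(1)] D_dual_theta[OF g(1)] .
  then show "v = w" unfolding f(2) g(2) pull_eq_iff[OF f(1) g(1)] .
qed

text \<open>The kernel of \<open>theta\<close> consists of the forms that vanish on
  \<open>FV\<close>, which is the kernel of \<open>D\<close>; these are the forms that factor
  through \<open>D\<close>.\<close>

lemma D_dual_image:
  "D_dual q j n ` FV q (Suc j) n = {g \<in> dual_space (SV (Suc q) j n). theta (Suc q) j n g = (0 :: _ \<Rightarrow> 'k)}"
proof (intro set_eqI iffI)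
  fix g :: "(nat multiset list \<Rightarrow> 'k) \<Rightarrow> 'k" assume "g \<in> D_dual q j n ` FV q (Suc j) n"
  then obtain f where f: "f \<in> dual_space (SV q (Suc j) n)" "g = pull q j n f"
    by (auto simp: FV_def D_dual_theta)
  have g: "g \<in> dual_space (SV (Suc q) j n)" unfolding f(2) by (rule pull_dual[OF f(1)])
  have "g v = 0" if v: "v \<in> FV (Suc q) j n" for v
    using D_FV[OF of_nat_p v] dual_space_zero[OF f(1) subspace_SV] by (simp add: f(2) pull_def)
  then show "g \<in> {g \<in> dual_space (SV (Suc q) j n). theta (Suc q) j n g = 0}"
    using g theta_eq_0_iff[OF g] by blast
next
  fix g :: "(nat multiset list \<Rightarrow> 'k) \<Rightarrow> 'k"
  assume "g \<in> {g \<in> dual_space (SV (Suc q) j n). theta (Suc q) j n g = 0}"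
  then have g: "g \<in> dual_space (SV (Suc q) j n)" and gz: "\<forall>v\<in>FV (Suc q) j n. g v = 0"
    using theta_eq_0_iff by blast+
  let ?X = "lab (Suc q) ` words (Suc q + Suc j) n"
  have sup: "SV q (Suc j) n \<subseteq> (supported ?X :: (_ \<Rightarrow> 'k) set)"
    using SV_subset_val unfolding val_symf idx_symb .
  obtain c where c: "\<And>v. v \<in> SV (Suc q) j n \<Longrightarrow> g v = (\<Sum>M\<in>?X. c M * D (Suc q) j n v M)"
  proof (rule dual_factor[OF g subspace_SV flinear_D, of "Suc q" j n ?X])
    show "g v = 0" if "v \<in> SV (Suc q) j n" "D (Suc q) j n v = 0" for v
      using D_kernel[OF char that] gz by blast
    show "D (Suc q) j n ` SV (Suc q) j n \<subseteq> (supported ?X :: (_ \<Rightarrow> 'k) set)" using D_in_SV sup by blast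
  qed (simp_all)
  define f where "f = (\<Sum>M\<in>?X. c M *\<^sub>f eps q (Suc j) n M)"
  have f: "f \<in> dual_space (SV q (Suc j) n)"
    unfolding f_def by (intro fun_space.subspace_sum fun_space.subspace_scale subspace_dual_space eps_dual)
  have "pull q j n f = g"
  proof (rule ext)
    fix u
    show "pull q j n f u = g u"
      by (cases "u \<in> SV (Suc q) j n")
        (simp_all add: pull_def c f_def fscale_sum_apply fscale_def eps_def D_in_SV dual_space_outside[OF g])
  qed
  then have "g = D_dual q j n (theta q (Suc j) n f)" using D_dual_theta[OF f] by simp
  then show "g \<in> D_dual q j n ` FV q (Suc j) n" using f by (auto simp: FV_def)
qed

lemma short_exact_W: "short_exact (Suc (Suc q) + j) (Ff q (Suc j)) (D_dual q j) (Wf (Suc q) j) (theta (Suc q) j) (Ff (Suc q) j :: (_, 'k) spf)"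
proof -
  have "strict_polynomial (Suc (Suc q) + j) (Ff q (Suc j) :: (_, 'k) spf)"
    using strict_polynomial_simple[of q "Suc j"] by simp
  moreover have "strict_polynomial (Suc (Suc q) + j) (Ff (Suc q) j :: (_, 'k) spf)"
    by (rule strict_polynomial_simple)
  moreover have "strict_polynomial (Suc (Suc q) + j) (Wf (Suc q) j :: (_, 'k) spf)"
    by (rule strict_polynomial_Wf)
  ultimately show ?thesis
    unfolding short_exact_def val_simple val_Wf
    using spf_hom_D_dual spf_hom_theta D_dual_inj D_dual_image
    by (auto simp: FV_def)
qed

end

lemma theta_inj_last:
  fixes f :: "(nat multiset list \<Rightarrow> 'k::field) \<Rightarrow> 'k"
  assumes p: "CHAR('k) = Suc j" and f: "f \<in> dual_space (SV 0 j n)" and z: "theta 0 j n f = 0"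
  shows "f = 0"
proof (rule ext)
  fix v
  show "f v = 0 v"
    using z theta_eq_0_iff[OF f] FV_0[OF p] dual_space_outside[OF f] by (cases "v \<in> SV 0 j n") auto
qed

lemma short_exact_W_last:
  assumes p: "CHAR('k::field) = Suc j"
  shows "short_exact (Suc j) (zero_spf :: (nat multiset list, 'k) spf) (\<lambda>n v. 0) (Wf 0 j) (theta 0 j) (Ff 0 j :: (_, 'k) spf)"
proof -
  have s: "strict_polynomial (Suc j) (Ff 0 j :: (_, 'k) spf)" "strict_polynomial (Suc j) (Wf 0 j :: (_, 'k) spf)"
    using strict_polynomial_simple[of 0 j] strict_polynomial_Wf[of 0 j] by simp_all
  have z0: "(0 :: (_ \<Rightarrow> 'k) \<Rightarrow> 'k) \<in> dual_space (SV 0 j n)" for n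
    using subspace_dual_space by (rule fun_space.subspace_0)
  have coef0: "coef (Wf 0 j) m n \<alpha> (0 :: _ \<Rightarrow> 'k) = 0" for m n \<alpha>
    by (rule ext) (simp add: coef_W_dual)
  have h: "spf_hom (zero_spf :: (nat multiset list, 'k) spf) (Wf 0 j) (\<lambda>n v. 0)"
    using z0 by (simp add: spf_hom_def zero_spf_def linear_between_def val_Wf coef0)
  have ker: "{f \<in> dual_space (SV 0 j n). theta 0 j n f = (0 :: _ \<Rightarrow> 'k)} = {0}" for n
    using theta_inj_last[OF p] z0 flinear_zero[OF flinear_theta] by blast
  have z: "val (zero_spf :: (nat multiset list, 'k) spf) n = {0}" for n by (simp add: zero_spf_def)
  show ?thesis
    unfolding short_exact_def val_simple val_Wf z ker
    using s strict_polynomial_zero spf_hom_theta h by (auto simp: FV_def)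
qed

section \<open>Composition series of the Weyl functors\<close>

definition Wsub :: "nat \<Rightarrow> nat \<Rightarrow> (nat \<Rightarrow> ((nat multiset list \<Rightarrow> 'k) \<Rightarrow> 'k) set) \<Rightarrow> (nat multiset list \<Rightarrow> 'k, 'k::field) spf"
  where "Wsub q j V = \<lparr>val = V, coef = coef (Wf q j)\<rparr>"

definition Wrad :: "nat \<Rightarrow> nat \<Rightarrow> (nat multiset list \<Rightarrow> 'k, 'k::field) spf"
  where "Wrad q j = Wsub q j (\<lambda>n. {f \<in> dual_space (SV q j n). theta q j n f = 0})"

definition Wzero :: "nat \<Rightarrow> nat \<Rightarrow> (nat multiset list \<Rightarrow> 'k, 'k::field) spf"
  where "Wzero q j = Wsub q j (\<lambda>n. {0})"

lemma val_Wrad: "val (Wrad q j) n = {f \<in> dual_space (SV q j n). theta q j n f = 0}"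
  and coef_Wrad: "coef (Wrad q j) = coef (Wf q j)"
  and val_Wzero: "val (Wzero q j) n = {0}"
  and coef_Wzero: "coef (Wzero q j) = coef (Wf q j)"
  by (simp_all add: Wrad_def Wzero_def Wsub_def)

lemma spf_eqI: "val U = val V \<Longrightarrow> coef U = coef V \<Longrightarrow> U = V" for U V :: "('x, 'k) spf"
  by (rule spf.equality) simp_all

lemma subfunctor_trans: "subfunctor U V \<Longrightarrow> subfunctor V T \<Longrightarrow> subfunctor U T"
  unfolding subfunctor_def by force

lemma subfunctor_antisym: "subfunctor U V \<Longrightarrow> subfunctor V U \<Longrightarrow> U = V" for U V :: "('x, 'k::field) spf"
  by (rule spf_eqI) (auto simp: subfunctor_def fun_eq_iff)

lemma subfunctor_refl:
  assumes "strict_polynomial e T"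
  shows "subfunctor T T"
proof -
  have "fun_space.subspace (val T n)" "linear_between (val T m) (val T n) (coef T m n \<alpha>)" for m n \<alpha>
    using assms by (simp_all add: strict_polynomial_def)
  then show ?thesis unfolding subfunctor_def linear_between_def by blast
qed

lemma maximal_subfunctorD:
  "maximal_subfunctor U V \<Longrightarrow> subfunctor U X \<Longrightarrow> subfunctor X V \<Longrightarrow> X = U \<or> X = V"
  by (simp add: maximal_subfunctor_def)

lemma coef_Wf_zero: "coef (Wf q j) m n \<alpha> 0 = 0"
  by (rule ext) (simp add: coef_W_dual)

lemma subfunctor_Wrad: "subfunctor (Wrad q j) (Wf q j :: (_, 'k::field) spf)"
proof -
  have "{f \<in> dual_space (SV q j n). theta q j n f = (0 :: _ \<Rightarrow> 'k)} = dual_space (SV q j n) \<inter> theta q j n -` {0}" for n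
    by auto
  then have "fun_space.subspace {f \<in> dual_space (SV q j n). theta q j n f = (0 :: _ \<Rightarrow> 'k)}" for n
    by (simp add: fun_space.subspace_inter subspace_dual_space module_hom.subspace_vimage[OF flinear_theta])
  then show ?thesis
    unfolding subfunctor_def val_Wrad coef_Wrad val_Wf
    by (auto simp: coef_Wf_closed theta_natural flinear_zero[OF flinear_coef_symf])
qed

lemma subfunctor_Wzero:
  assumes "subfunctor U (Wf q j)"
  shows "subfunctor (Wzero q j) U"
  using assms unfolding subfunctor_def val_Wzero coef_Wzero
  by (auto simp: fun_space.subspace_0 coef_Wf_zero)

lemma Wrad_neq: "Wrad q j \<noteq> (Wf q j :: (_, 'k::field) spf)"
proof
  assume "Wrad q j = (Wf q j :: (_, 'k) spf)"
  then have "theta q j (Suc j) (eps q j (Suc j) (lab (Suc q) (J0 q j))) = (0 :: _ \<Rightarrow> 'k)"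
    using val_Wrad[of q j "Suc j"] val_Wf[of q j "Suc j"] eps_dual by fastforce
  then show False using theta_eps_J0[of q j] v0_nonzero by metis
qed

lemma subfunctor_Wf_cases:
  assumes U: "subfunctor U (Wf q j)"
  shows "U = Wf q j \<or> subfunctor U (Wrad q j)"
proof (cases "\<exists>n. \<exists>u\<in>val U n. theta q j n u \<noteq> 0")
  case True
  then obtain m u where u: "u \<in> val U m" "theta q j m u \<noteq> 0" by blast
  have "val U n = dual_space (SV q j n)" for n
    by (rule dual_SV_head[where U = "val U" and u = u and m = m])
      (use U u in \<open>auto simp: subfunctor_def val_Wf\<close>)
  then have "U = Wf q j"
    by (intro spf_eqI ext) (use U in \<open>simp_all add: val_Wf subfunctor_def\<close>)
  then show ?thesis ..
next
  case False
  then show ?thesis using U unfolding subfunctor_def val_Wrad coef_Wrad val_Wf by auto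
qed

text \<open>\<open>D_dual\<close> identifies the kernel of \<open>theta\<close> with the next simple
  functor. The preimage \<open>U'\<close> of \<open>U\<close> is a subfunctor there, and
  \<open>FV_socle\<close> makes it zero or everything.\<close>

lemma subfunctor_Wrad_cases:
  assumes p: "CHAR('k::field) = Suc (Suc q) + j" and U: "subfunctor U (Wrad (Suc q) j :: (_, 'k) spf)"
  shows "U = Wzero (Suc q) j \<or> U = Wrad (Suc q) j"
proof -
  interpret hook_char q j "TYPE('k)" by unfold_locales (rule p)
  have hom: "linear_between (FV q (Suc j) n) (dual_space (SV (Suc q) j n)) (D_dual q j n :: (_ \<Rightarrow> 'k) \<Rightarrow> _)"
    and nat: "v \<in> FV q (Suc j) m \<Longrightarrow> D_dual q j n (coef (symf (Suc q) (Suc j)) m n \<alpha> v) = coef (Wf (Suc q) j) m n \<alpha> (D_dual q j m v)"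
    for m n \<alpha> and v :: "_ \<Rightarrow> 'k"
    using spf_hom_D_dual unfolding spf_hom_def val_simple val_Wf coef_simple by blast+
  have z: "D_dual q j n (0 :: _ \<Rightarrow> 'k) = 0" for n
  proof -
    have "D_dual q j n (0 *\<^sub>f (0 :: _ \<Rightarrow> 'k)) = 0 *\<^sub>f D_dual q j n 0"
      using hom[of n] fun_space.subspace_0[OF subspace_FV] unfolding linear_between_def by blast
    then show ?thesis by simp
  qed
  have Uval: "fun_space.subspace (val U n)" "val U n \<subseteq> D_dual q j n ` FV q (Suc j) n"
    "f \<in> val U m \<Longrightarrow> coef (Wf (Suc q) j) m n \<alpha> f \<in> val U n" for m n \<alpha> f
    using U unfolding subfunctor_def val_Wrad coef_Wrad D_dual_image by auto
  define U' where "U' = (\<lambda>n. {v \<in> FV q (Suc j) n. D_dual q j n v \<in> val U n})"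
  have sub: "fun_space.subspace (U' n)" for n
    using hom[of n] Uval(1)[of n] subspace_FV[of q "Suc j" n]
    unfolding U'_def fun_space.subspace_def linear_between_def by (auto simp: z)
  show ?thesis
  proof (cases "\<exists>n. \<exists>v\<in>U' n. v \<noteq> 0")
    case True
    then obtain m v where v: "v \<in> U' m" "v \<noteq> 0" by blast
    have "FV q (Suc j) n \<subseteq> U' n" for n
    proof (rule FV_socle[where U = U' and v = v and m = m])
      show "fun_space.subspace (U' n)" for n by (rule sub)
      show "v \<in> U' m" "v \<noteq> 0" by (rule v)+
      show "U' n \<subseteq> SV q (Suc j) n" for n unfolding U'_def using FV_subset_SV by blast
      show "coef (symf (Suc q) (Suc j)) m n \<alpha> v \<in> U' n" if "v \<in> U' m" for m n \<alpha> v
        using that by (simp add: U'_def nat coef_FV Uval(3))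
    qed
    then have "val U n = val (Wrad (Suc q) j) n" for n
      using Uval(2)[of n] unfolding val_Wrad D_dual_image[symmetric] U'_def by blast
    then have "U = Wrad (Suc q) j"
      using U by (intro spf_eqI ext) (simp_all add: subfunctor_def)
    then show ?thesis ..
  next
    case False
    then have "val U n = {0}" for n
      using Uval(1)[of n] Uval(2)[of n] z[of n] fun_space.subspace_0 unfolding U'_def by fastforce
    then have "U = Wzero (Suc q) j"
      using U by (intro spf_eqI ext) (simp_all add: val_Wzero coef_Wzero subfunctor_def coef_Wrad)
    then show ?thesis ..
  qed
qed

lemma Wrad_last: "CHAR('k::field) = Suc j \<Longrightarrow> Wrad 0 j = (Wzero 0 j :: (_, 'k) spf)"
proof (rule spf_eqI)
  assume p: "CHAR('k) = Suc j"
  have "{f \<in> dual_space (SV 0 j n). theta 0 j n f = (0 :: _ \<Rightarrow> 'k)} = {0}" for n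
    using theta_inj_last[OF p] fun_space.subspace_0[OF subspace_dual_space] flinear_zero[OF flinear_theta] by blast
  then show "val (Wrad 0 j) = val (Wzero 0 j :: (_, 'k) spf)" by (intro ext) (simp add: val_Wrad val_Wzero)
qed (simp add: coef_Wrad coef_Wzero)

lemma Wzero_neq_Wrad:
  assumes p: "CHAR('k::field) = Suc (Suc q) + j"
  shows "Wzero (Suc q) j \<noteq> (Wrad (Suc q) j :: (_, 'k) spf)"
proof
  interpret hook_char q j "TYPE('k)" by unfold_locales (rule p)
  assume eq: "Wzero (Suc q) j = (Wrad (Suc q) j :: (_, 'k) spf)"
  have im: "D_dual q j (Suc (Suc j)) ` FV q (Suc j) (Suc (Suc j)) = {0 :: (_ \<Rightarrow> 'k) \<Rightarrow> 'k}"
    unfolding D_dual_image val_Wrad[symmetric] eq[symmetric] by (rule val_Wzero)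
  have "v0 q (Suc j) = (0 :: _ \<Rightarrow> 'k)"
  proof (rule inj_onD[OF D_dual_inj])
    have "0 \<in> FV q (Suc j) (Suc (Suc j))" by (rule fun_space.subspace_0[OF subspace_FV])
    then show "D_dual q j (Suc (Suc j)) (v0 q (Suc j) :: _ \<Rightarrow> 'k) = D_dual q j (Suc (Suc j)) 0"
      using im v0_in_FV by (metis image_eqI singletonD)
  qed (simp_all add: v0_in_FV fun_space.subspace_0)
  then show False using v0_nonzero by blast
qed

section \<open>Recognizing and distinguishing the simple quotients\<close>

lemma short_exact_vanish:
  assumes "short_exact e U (\<lambda>n v. v) V \<psi> F"
  shows "val F n = {0} \<longleftrightarrow> val U n = val V n"
proof -
  have ker: "val U n = {v \<in> val V n. \<psi> n v = 0}" and im: "\<psi> n ` val V n = val F n"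
    and V: "strict_polynomial e V"
    using assms by (simp_all add: short_exact_def)
  have zero: "0 \<in> val V n" by (rule fun_space.subspace_0) (use V in \<open>simp add: strict_polynomial_def\<close>)
  show ?thesis
  proof
    assume "val F n = {0}"
    then have "\<psi> n v = 0" if "v \<in> val V n" for v using im that by blast
    then show "val U n = val V n" unfolding ker by blast
  next
    assume "val U n = val V n"
    then have "\<psi> n v = 0" if "v \<in> val V n" for v using ker that by blast
    then have "\<psi> n ` val V n = (\<lambda>v. 0) ` val V n" by (intro image_cong refl)
    then show "val F n = {0}" unfolding im[symmetric] using zero by auto
  qed
qed

lemma FV_eq_0: "n \<le> i \<Longrightarrow> FV q i n = {0}"
proof -
  assume n: "n \<le> i"
  have "KI q i n = {}"
  proof -
    have "card A \<noteq> Suc i" if "A \<subseteq> {..<n}" for A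
      using card_mono[OF _ that] n by simp
    then show ?thesis by (auto simp: KI_def)
  qed
  then have "SV q i n = {0}" by (simp add: SV_def)
  then show ?thesis using FV_subset_SV fun_space.subspace_0[OF subspace_FV] by blast
qed

lemma FV_neq_0: "FV q i (Suc i) \<noteq> {0}"
  using v0_in_FV v0_nonzero by blast

text \<open>The dimension \<open>n\<close> at which the quotient first becomes nonzero depends on
  \<open>U\<close> and \<open>V\<close> alone, and for the simple functor of index \<open>i\<close>
  it is \<open>Suc i\<close>.\<close>

lemma quotient_iso_unique:
  fixes U V :: "('x, 'k::field) spf"
  assumes "quotient_iso e U V (Ff q i)" "quotient_iso e U V (Ff q' i')"
  shows "i = i'"
proof -
  have *: "FV q i n = {0 :: _ \<Rightarrow> 'k} \<longleftrightarrow> FV q' i' n = {0 :: _ \<Rightarrow> 'k}" for n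
  proof -
    obtain \<psi> \<psi>' where "short_exact e U (\<lambda>n v. v) V \<psi> (Ff q i)" "short_exact e U (\<lambda>n v. v) V \<psi>' (Ff q' i')"
      using assms by (auto simp: quotient_iso_def)
    from short_exact_vanish[OF this(1), of n] short_exact_vanish[OF this(2), of n] show ?thesis
      by (simp add: val_simple)
  qed
  show ?thesis
  proof (rule linorder_cases[of i i'])
    assume "i < i'"
    then show ?thesis using *[of "Suc i"] FV_eq_0[of "Suc i" i'] FV_neq_0 by auto
  next
    assume "i' < i"
    then show ?thesis using *[of "Suc i'"] FV_eq_0[of "Suc i'" i] FV_neq_0 by auto
  qed
qed

lemma quotient_iso_head: "quotient_iso (Suc q + j) (Wrad q j) (Wf q j) (Ff q j)"
proof -
  have "spf_hom (Wrad q j) (Wf q j) (\<lambda>n v. v)"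
    by (auto simp: spf_hom_def val_Wrad val_Wf coef_Wrad linear_between_def)
  then have "short_exact (Suc q + j) (Wrad q j) (\<lambda>n v. v) (Wf q j) (theta q j) (Ff q j)"
    unfolding short_exact_def
    using strict_polynomial_sub[OF strict_polynomial_Wf subfunctor_Wrad] strict_polynomial_Wf
      strict_polynomial_simple spf_hom_theta
    by (auto simp: val_Wrad val_Wf val_simple FV_def)
  then show ?thesis unfolding quotient_iso_def by blast
qed

text \<open>\<open>quotient_iso\<close> asks for a map from the filtration step to the simple
  functor, whereas \<open>D_dual\<close> runs the other way; hence the inverse.\<close>

lemma short_exact_isomorphism:
  assumes T: "strict_polynomial e T" and F: "strict_polynomial e F" and Z: "strict_polynomial e Z"
    and hom: "spf_hom F T \<phi>" and Zval: "\<And>n. val Z n = {0}" and Zcoef: "\<And>m n \<alpha>. coef Z m n \<alpha> 0 = 0"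
    and inj: "\<And>n. inj_on (\<phi> n) (val F n)" and im: "\<And>n. \<phi> n ` val F n = val T n"
    and Tcoef: "\<And>m n \<alpha>. coef T m n \<alpha> 0 = 0"
  shows "short_exact e Z (\<lambda>n v. v) T (\<lambda>n. inv_into (val F n) (\<phi> n)) F"
proof -
  let ?\<psi> = "\<lambda>n. inv_into (val F n) (\<phi> n)"
  have lin: "linear_between (val F n) (val T n) (\<phi> n)"
    and nat: "v \<in> val F m \<Longrightarrow> \<phi> n (coef F m n \<alpha> v) = coef T m n \<alpha> (\<phi> m v)" for m n \<alpha> v
    using hom by (auto simp: spf_hom_def)
  have subF: "fun_space.subspace (val F n)" and subT: "fun_space.subspace (val T n)" for n
    using F T by (simp_all add: strict_polynomial_def)
  have Fcl: "coef F m n \<alpha> v \<in> val F n" if "v \<in> val F m" for m n \<alpha> v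
  proof -
    have "linear_between (val F m) (val F n) (coef F m n \<alpha>)" using F by (simp add: strict_polynomial_def)
    then show ?thesis using that by (auto simp: linear_between_def)
  qed
  have \<phi>in: "\<phi> n v \<in> val T n" if "v \<in> val F n" for n v using im that by blast
  have \<psi>\<phi>: "?\<psi> n (\<phi> n v) = v" if "v \<in> val F n" for n v using inv_into_f_f[OF inj that] .
  have ex: "\<exists>v\<in>val F n. x = \<phi> n v" if "x \<in> val T n" for n x using im that by blast
  have add: "\<phi> n (u + v) = \<phi> n u + \<phi> n v" and sc: "\<phi> n (c *\<^sub>f v) = c *\<^sub>f \<phi> n v"
    if "u \<in> val F n" "v \<in> val F n" for n u v c
    using lin[of n] that by (auto simp: linear_between_def)
  have z: "\<phi> n 0 = 0" for n
    using sc[of 0 n 0 0] fun_space.subspace_0[OF subF] by simp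
  have hom\<psi>: "spf_hom T F ?\<psi>"
    unfolding spf_hom_def linear_between_def
  proof (intro conjI allI ballI)
    show "?\<psi> n ` val T n \<subseteq> val F n" for n using ex \<psi>\<phi> by fastforce
  next
    fix n x y assume "x \<in> val T n" "y \<in> val T n"
    then obtain u v where uv: "u \<in> val F n" "x = \<phi> n u" "v \<in> val F n" "y = \<phi> n v" using ex by metis
    have "?\<psi> n (\<phi> n (u + v)) = u + v" using uv by (intro \<psi>\<phi> fun_space.subspace_add subF)
    then show "?\<psi> n (x + y) = ?\<psi> n x + ?\<psi> n y" using uv \<psi>\<phi> by (simp only: add)
  next
    fix n c x assume "x \<in> val T n"
    then obtain u where u: "u \<in> val F n" "x = \<phi> n u" using ex by metis
    have "?\<psi> n (\<phi> n (c *\<^sub>f u)) = c *\<^sub>f u" using u by (intro \<psi>\<phi> fun_space.subspace_scale subF)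
    then show "?\<psi> n (c *\<^sub>f x) = c *\<^sub>f ?\<psi> n x" using u \<psi>\<phi> by (simp only: sc[OF u(1) u(1)])
  next
    fix m n \<alpha> x assume "x \<in> val T m"
    then obtain u where u: "u \<in> val F m" "x = \<phi> m u" using ex by metis
    show "?\<psi> n (coef T m n \<alpha> x) = coef F m n \<alpha> (?\<psi> m x)"
      unfolding u(2) nat[OF u(1), symmetric] \<psi>\<phi>[OF u(1)] by (rule \<psi>\<phi>[OF Fcl[OF u(1)]])
  qed
  have "spf_hom Z T (\<lambda>n v. v)"
    using fun_space.subspace_0[OF subT] by (simp add: spf_hom_def Zval linear_between_def Zcoef Tcoef)
  moreover have "{x \<in> val T n. ?\<psi> n x = 0} = {0}" for n
  proof -
    have "x = 0" if "x \<in> val T n" "?\<psi> n x = 0" for x using ex[OF that(1)] \<psi>\<phi> that(2) z by metis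
    moreover have "?\<psi> n 0 = 0" using \<psi>\<phi>[OF fun_space.subspace_0[OF subF], of n] z by simp
    ultimately show ?thesis using fun_space.subspace_0[OF subT] by blast
  qed
  moreover have "?\<psi> n ` val T n = val F n" for n
    unfolding im[symmetric] image_image using \<psi>\<phi> by force
  ultimately show ?thesis unfolding short_exact_def Zval using T F Z hom\<psi> by simp
qed

lemma quotient_iso_socle:
  assumes p: "CHAR('k::field) = Suc (Suc q) + j"
  shows "quotient_iso (Suc (Suc q) + j) (Wzero (Suc q) j) (Wrad (Suc q) j) (Ff q (Suc j) :: (_, 'k) spf)"
proof -
  interpret hook_char q j "TYPE('k)" by unfold_locales (rule p)
  let ?e = "Suc (Suc q) + j"
  have "short_exact ?e (Wzero (Suc q) j) (\<lambda>n v. v) (Wrad (Suc q) j)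
    (\<lambda>n. inv_into (val (Ff q (Suc j)) n) (D_dual q j n)) (Ff q (Suc j) :: (_, 'k) spf)"
  proof (rule short_exact_isomorphism)
    show "strict_polynomial ?e (Wrad (Suc q) j :: (_, 'k) spf)"
      by (rule strict_polynomial_sub[OF strict_polynomial_Wf subfunctor_Wrad])
    then show "strict_polynomial ?e (Wzero (Suc q) j :: (_, 'k) spf)"
      by (rule strict_polynomial_sub[OF _ subfunctor_Wzero[OF subfunctor_Wrad]])
    show "strict_polynomial ?e (Ff q (Suc j) :: (_, 'k) spf)"
      using strict_polynomial_simple[of q "Suc j"] by simp
    show "spf_hom (Ff q (Suc j)) (Wrad (Suc q) j) (D_dual q j :: _ \<Rightarrow> (_ \<Rightarrow> 'k) \<Rightarrow> _)"
      using spf_hom_D_dual unfolding spf_hom_def linear_between_def val_simple val_Wf val_Wrad coef_Wrad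
        D_dual_image[symmetric] by blast
  qed (simp_all add: val_Wzero coef_Wzero coef_Wrad coef_Wf_zero val_simple val_Wrad D_dual_inj D_dual_image)
  then show ?thesis unfolding quotient_iso_def by blast
qed

section \<open>All composition series of a Weyl functor\<close>

lemma chain_top:
  assumes "maximal_subfunctor T X" "subfunctor X T"
  shows False
  using assms subfunctor_antisym unfolding maximal_subfunctor_def by blast

text \<open>The subfunctors are three and form a chain, so each maximal step is forced. Uniqueness
  of the series settles the definite description in \<open>multiplicity_in\<close>.\<close>

lemma composition_series_Wf:
  assumes p: "CHAR('k::field) = Suc (Suc q) + j"
  shows "composition_series (Suc (Suc q) + j) (Wf (Suc q) j :: (_, 'k) spf) Ts \<longleftrightarrow> Ts = [Wzero (Suc q) j, Wrad (Suc q) j, Wf (Suc q) j]"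
proof -
  let ?Z = "Wzero (Suc q) j :: (_, 'k) spf" and ?R = "Wrad (Suc q) j :: (_, 'k) spf" and ?W = "Wf (Suc q) j :: (_, 'k) spf"
  let ?e = "Suc (Suc q) + j"
  have sp: "strict_polynomial ?e ?W" by (rule strict_polynomial_Wf)
  have RW: "subfunctor ?R ?W" by (rule subfunctor_Wrad)
  have ZR: "subfunctor ?Z ?R" by (rule subfunctor_Wzero[OF RW])
  have WW: "subfunctor ?W ?W" by (rule subfunctor_refl[OF sp])
  have ZW: "subfunctor ?Z ?W" by (rule subfunctor_trans[OF ZR RW])
  have neq: "?Z \<noteq> ?R" "?R \<noteq> ?W" using Wzero_neq_Wrad[OF p] Wrad_neq by blast+
  have ZnW: "?Z \<noteq> ?W" using neq ZR RW subfunctor_antisym by metis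
  have subR: "X = ?Z \<or> X = ?R" if "subfunctor X ?R" for X using subfunctor_Wrad_cases[OF p that] .
  have subW: "X = ?Z \<or> X = ?R \<or> X = ?W" if "subfunctor X ?W" for X
    using subfunctor_Wf_cases[OF that] subR by blast
  have mZR: "maximal_subfunctor ?Z ?R" unfolding maximal_subfunctor_def using ZR neq subR by blast
  have mRW: "maximal_subfunctor ?R ?W" unfolding maximal_subfunctor_def
    using RW neq subW ZR subfunctor_antisym by blast
  have nZW: "\<not> maximal_subfunctor ?Z ?W" using maximal_subfunctorD[OF _ ZR RW] neq by metis
  have nRX: "X = ?W" if "maximal_subfunctor ?R X" "subfunctor X ?W" for X
    using that subW[OF that(2)] neq ZR subfunctor_antisym unfolding maximal_subfunctor_def by blast
  have nZX: "X = ?R" if "maximal_subfunctor ?Z X" "subfunctor X ?W" for X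
    using that subW[OF that(2)] nZW unfolding maximal_subfunctor_def by blast
  show ?thesis
  proof
    assume cs: "composition_series ?e ?W Ts"
    then have ne: "Ts \<noteq> []" and hd: "val (hd Ts) = (\<lambda>n. {0})" and last: "last Ts = ?W"
      and sub: "\<And>U. U \<in> set Ts \<Longrightarrow> subfunctor U ?W"
      and mx: "\<And>i. Suc i < length Ts \<Longrightarrow> maximal_subfunctor (Ts ! i) (Ts ! Suc i)"
      unfolding composition_series_def by blast+
    \<comment> \<open>The definition prescribes only the values of the first member; its action is
      that of the Weyl functor because it is a subfunctor.\<close>
    have "hd Ts = ?Z"
    proof (rule spf_eqI)
      show "coef (hd Ts) = coef ?Z" using sub[of "hd Ts"] ne by (simp add: subfunctor_def coef_Wzero)
    qed (simp add: hd fun_eq_iff val_Wzero)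
    then obtain T1 where T1: "Ts = ?Z # T1" using ne by (cases Ts) auto
    then have "T1 \<noteq> []" using last ZnW by auto
    then obtain X T2 where X: "T1 = X # T2" by (cases T1) auto
    then have XR: "X = ?R" using nZX mx[of 0] sub[of X] T1 by auto
    then have "T2 \<noteq> []" using last neq X T1 by auto
    then obtain Y T3 where Y: "T2 = Y # T3" by (cases T2) auto
    then have YW: "Y = ?W" using nRX mx[of 1] sub[of Y] T1 X XR by auto
    have "T3 = []"
    proof (rule ccontr)
      assume "T3 \<noteq> []"
      then obtain V T4 where V: "T3 = V # T4" by (cases T3) auto
      then have "maximal_subfunctor ?W V" "subfunctor V ?W" using mx[of 2] sub[of V] T1 X Y YW by auto
      then show False by (rule chain_top)
    qed
    then show "Ts = [?Z, ?R, ?W]" using T1 X XR Y YW by simp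
  next
    assume Ts: "Ts = [?Z, ?R, ?W]"
    have "maximal_subfunctor (Ts ! i) (Ts ! Suc i)" if "Suc i < length Ts" for i
      using that mZR mRW by (cases i) (auto simp: Ts less_Suc_eq)
    then show "composition_series ?e ?W Ts"
      unfolding composition_series_def using sp WW RW ZW by (auto simp: Ts val_Wzero fun_eq_iff)
  qed
qed

text \<open>For \<open>q = 0\<close> the form is nondegenerate, so \<open>Wrad\<close> is already
  the zero subfunctor and the Weyl functor is simple.\<close>

lemma composition_series_Wf_last:
  assumes p: "CHAR('k::field) = Suc j"
  shows "composition_series (Suc j) (Wf 0 j :: (_, 'k) spf) Ts \<longleftrightarrow> Ts = [Wrad 0 j, Wf 0 j]"
proof -
  let ?Z = "Wrad 0 j :: (_, 'k) spf" and ?W = "Wf 0 j :: (_, 'k) spf"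
  have sp: "strict_polynomial (Suc j) ?W" using strict_polynomial_Wf[of 0 j] by simp
  have WW: "subfunctor ?W ?W" by (rule subfunctor_refl[OF sp])
  have ZW: "subfunctor ?Z ?W" by (rule subfunctor_Wrad)
  have neq: "?Z \<noteq> ?W" by (rule Wrad_neq)
  have val: "val ?Z = (\<lambda>n. {0})" by (simp add: Wrad_last[OF p] val_Wzero fun_eq_iff)
  have subZ: "X = ?Z" if "subfunctor X ?Z" for X
    using subfunctor_antisym[OF that] subfunctor_Wzero[OF subfunctor_trans[OF that ZW]] Wrad_last[OF p] by metis
  have subW: "X = ?Z \<or> X = ?W" if "subfunctor X ?W" for X
    using subfunctor_Wf_cases[OF that] subZ by blast
  have mZW: "maximal_subfunctor ?Z ?W" unfolding maximal_subfunctor_def using ZW neq subW by blast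
  show ?thesis
  proof
    assume cs: "composition_series (Suc j) ?W Ts"
    then have ne: "Ts \<noteq> []" and hd: "val (hd Ts) = (\<lambda>n. {0})" and last: "last Ts = ?W"
      and sub: "\<And>U. U \<in> set Ts \<Longrightarrow> subfunctor U ?W"
      and mx: "\<And>i. Suc i < length Ts \<Longrightarrow> maximal_subfunctor (Ts ! i) (Ts ! Suc i)"
      unfolding composition_series_def by blast+
    have "hd Ts = ?Z"
    proof (rule spf_eqI)
      show "coef (hd Ts) = coef ?Z" using sub[of "hd Ts"] ne by (simp add: subfunctor_def coef_Wrad)
    qed (simp add: hd val)
    then obtain T1 where T1: "Ts = ?Z # T1" using ne by (cases Ts) auto
    then have "T1 \<noteq> []" using last neq by auto
    then obtain X T2 where X: "T1 = X # T2" by (cases T1) auto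
    then have "maximal_subfunctor ?Z X" "subfunctor X ?W" using mx[of 0] sub[of X] T1 by auto
    then have XW: "X = ?W" using subW[of X] unfolding maximal_subfunctor_def by blast
    have "T2 = []"
    proof (rule ccontr)
      assume "T2 \<noteq> []"
      then obtain V T4 where V: "T2 = V # T4" by (cases T2) auto
      then have "maximal_subfunctor ?W V" "subfunctor V ?W" using mx[of 1] sub[of V] T1 X XW by auto
      then show False by (rule chain_top)
    qed
    then show "Ts = [?Z, ?W]" using T1 X XW by simp
  next
    assume Ts: "Ts = [?Z, ?W]"
    then show "composition_series (Suc j) ?W Ts"
      unfolding composition_series_def using sp WW ZW mZW val by (auto simp: less_Suc_eq)
  qed
qed

lemma multiplicity_Wf:
  assumes p: "CHAR('k::field) = Suc (Suc q) + j" and e: "Suc q' + i = Suc (Suc q) + j"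
  shows "multiplicity_in (Suc (Suc q) + j) (Wf (Suc q) j :: (_, 'k) spf) (Ff q' i) = (if i = j \<or> i = Suc j then 1 else 0)"
proof -
  let ?Z = "Wzero (Suc q) j :: (_, 'k) spf" and ?R = "Wrad (Suc q) j :: (_, 'k) spf" and ?W = "Wf (Suc q) j :: (_, 'k) spf"
  let ?e = "Suc (Suc q) + j" and ?F = "Ff q' i :: (_, 'k) spf"
  let ?Q = "\<lambda>Ts. {l. Suc l < length Ts \<and> quotient_iso ?e (Ts ! l) (Ts ! Suc l) ?F}"
  have R: "quotient_iso ?e ?R ?W ?F \<longleftrightarrow> i = j"
  proof
    show "i = j" if h: "quotient_iso ?e ?R ?W ?F"
      using quotient_iso_unique[OF h quotient_iso_head] .
    assume "i = j"
    then have "?F = Ff (Suc q) j" using e by simp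
    then show "quotient_iso ?e ?R ?W ?F" using quotient_iso_head by metis
  qed
  have Z: "quotient_iso ?e ?Z ?R ?F \<longleftrightarrow> i = Suc j"
  proof
    show "i = Suc j" if h: "quotient_iso ?e ?Z ?R ?F"
      using quotient_iso_unique[OF h quotient_iso_socle[OF p]] .
    assume "i = Suc j"
    then have "?F = Ff q (Suc j)" using e by simp
    then show "quotient_iso ?e ?Z ?R ?F" using quotient_iso_socle[OF p] by metis
  qed
  have "l \<in> ?Q [?Z, ?R, ?W] \<longleftrightarrow> l = 0 \<and> i = Suc j \<or> l = 1 \<and> i = j" for l
  proof (cases l)
    case (Suc l')
    then show ?thesis using R by (cases l') simp_all
  next
    case 0
    then show ?thesis using Z by simp
  qed
  then have "?Q [?Z, ?R, ?W] = (if i = Suc j then {0} else {}) \<union> (if i = j then {1} else {})"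
    by (auto split: if_splits)
  then have card: "card (?Q [?Z, ?R, ?W]) = (if i = j \<or> i = Suc j then 1 else 0)" by simp
  show ?thesis
    unfolding multiplicity_in_def composition_series_Wf[OF p] card[symmetric]
    by (rule the_equality) auto
qed

lemma multiplicity_Wf_last:
  assumes p: "CHAR('k::field) = Suc j" and q': "Suc q' + i = Suc j"
  shows "multiplicity_in (Suc j) (Wf 0 j :: (_, 'k) spf) (Ff q' i) = (if i = j then 1 else 0)"
proof -
  let ?Z = "Wrad 0 j :: (_, 'k) spf" and ?W = "Wf 0 j :: (_, 'k) spf" and ?F = "Ff q' i :: (_, 'k) spf"
  let ?Q = "\<lambda>Ts. {l. Suc l < length Ts \<and> quotient_iso (Suc j) (Ts ! l) (Ts ! Suc l) ?F}"
  have hd: "quotient_iso (Suc j) ?Z ?W (Ff 0 j)" using quotient_iso_head[of 0 j] by simp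
  have Z: "quotient_iso (Suc j) ?Z ?W ?F \<longleftrightarrow> i = j"
  proof
    show "i = j" if "quotient_iso (Suc j) ?Z ?W ?F"
      using quotient_iso_unique[OF that hd] .
    assume "i = j"
    then have "?F = Ff 0 j" using q' by simp
    then show "quotient_iso (Suc j) ?Z ?W ?F" using hd by metis
  qed
  have "?Q [?Z, ?W] = (if i = j then {0} else {})"
    using Z by (auto simp: less_Suc_eq)
  then have card: "card (?Q [?Z, ?W]) = (if i = j then 1 else 0)" by simp
  show ?thesis
    unfolding multiplicity_in_def composition_series_Wf_last[OF p] card[symmetric]
    by (rule the_equality) auto
qed

section \<open>Translation to the hooks of size p\<close>

lemma hook_eq: "hook p i = hk (p - i - 1) i"
  by (simp add: hook_def hk_def)

theorem corollary1p2:
  fixes p :: nat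
  assumes "CHAR('k::field) = p" and "p > 0"
  shows "(\<forall>l\<in>{1..p}. \<forall>m\<in>{1..p}.
            multiplicity_in p (hook_W p (l - 1) :: (nat multiset list \<Rightarrow> 'k, 'k) spf)
              (hook_F p (m - 1)) = (if m = l \<or> m = l + 1 then 1 else 0)) \<and>
         (\<forall>j\<in>{0..p - 1}.
            (\<exists>\<phi> \<psi>. short_exact p (hook_F p (j + 1)) \<phi>
               (hook_W p j :: (nat multiset list \<Rightarrow> 'k, 'k) spf) \<psi> (hook_F p j)) \<and>
            (\<exists>\<phi> \<psi>. short_exact p (hook_F p j) \<phi>
               (hook_S p j :: (nat multiset list, 'k) spf) \<psi> (hook_F p (j + 1))))"
proof (intro conjI ballI)
  fix l m assume l: "l \<in> {1..p}" and m: "m \<in> {1..p}"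
  obtain j where j: "l = Suc j" "j < p" using l by (cases l) auto
  obtain i where i: "m = Suc i" "i < p" using m by (cases m) auto
  obtain q where q: "p = Suc q + j" using j(2) less_imp_Suc_add[of j p] by (auto simp: add.commute)
  obtain q' where q': "p = Suc q' + i" using i(2) less_imp_Suc_add[of i p] by (auto simp: add.commute)
  have W: "hook_W p (l - 1) = (Wf q j :: (_, 'k) spf)" using q j by (simp add: hook_W_def hook_eq)
  have F: "hook_F p (m - 1) = (Ff q' i :: (_, 'k) spf)" using q' i by (simp add: hook_F_def hook_eq)
  show "multiplicity_in p (hook_W p (l - 1) :: (nat multiset list \<Rightarrow> 'k, 'k) spf)
    (hook_F p (m - 1)) = (if m = l \<or> m = l + 1 then 1 else 0)"
  proof (cases q)
    \<comment> \<open>Here \<open>l = p\<close>, so the case \<open>m = l + 1\<close> lies outside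
      the index range and the Weyl functor has only one factor.\<close>
    case 0
    have "i \<noteq> Suc j" using 0 q i by simp
    then show ?thesis
      using multiplicity_Wf_last[where ?'k = 'k, of j q' i] assms(1) q q' 0 unfolding W F by (simp add: i j)
  next
    case (Suc q'')
    then show ?thesis
      using multiplicity_Wf[where ?'k = 'k, of q'' j q' i] assms(1) q q' unfolding W F by (simp add: i j)
  qed
next
  fix j assume "j \<in> {0..p - 1}"
  then have j: "j < p" using assms(2) by auto
  obtain q where q: "p = Suc q + j" using j less_imp_Suc_add[of j p] by (auto simp: add.commute)
  have W: "hook_W p j = (Wf q j :: (_, 'k) spf)" and S: "hook_S p j = (Sf q j :: (_, 'k) spf)"
    and F: "hook_F p j = (Ff q j :: (_, 'k) spf)"
    using q j by (simp_all add: hook_W_def hook_S_def hook_F_def hook_eq)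
  show "\<exists>\<phi> \<psi>. short_exact p (hook_F p (j + 1)) \<phi>
      (hook_W p j :: (nat multiset list \<Rightarrow> 'k, 'k) spf) \<psi> (hook_F p j)"
    and "\<exists>\<phi> \<psi>. short_exact p (hook_F p j) \<phi>
      (hook_S p j :: (nat multiset list, 'k) spf) \<psi> (hook_F p (j + 1))"
  proof (atomize (full), cases q)
    \<comment> \<open>Here \<open>j + 1 = p\<close>, where the convention makes
      \<open>hook_F\<close> zero and both sequences become isomorphisms.\<close>
    case 0
    then have p: "p = Suc j" and F': "hook_F p (j + 1) = (zero_spf :: (nat multiset list, 'k) spf)"
      using q by (simp_all add: hook_F_def)
    show "(\<exists>\<phi> \<psi>. short_exact p (hook_F p (j + 1)) \<phi> (hook_W p j :: (_, 'k) spf) \<psi> (hook_F p j)) \<and>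
      (\<exists>\<phi> \<psi>. short_exact p (hook_F p j) \<phi> (hook_S p j :: (_, 'k) spf) \<psi> (hook_F p (j + 1)))"
      unfolding F' W S F 0 unfolding p
      using short_exact_W_last[where ?'k = 'k, of j] short_exact_S_last[where ?'k = 'k, of j] assms(1) p by blast
  next
    case (Suc q')
    then have p: "p = Suc (Suc q') + j" and F': "hook_F p (j + 1) = (Ff q' (Suc j) :: (nat multiset list, 'k) spf)"
      using q by (simp_all add: hook_F_def hook_eq)
    have c: "CHAR('k) = Suc (Suc q') + j" using assms(1) p by simp
    interpret hook_char q' j "TYPE('k)" by unfold_locales (rule c)
    show "(\<exists>\<phi> \<psi>. short_exact p (hook_F p (j + 1)) \<phi> (hook_W p j :: (_, 'k) spf) \<psi> (hook_F p j)) \<and>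
      (\<exists>\<phi> \<psi>. short_exact p (hook_F p j) \<phi> (hook_S p j :: (_, 'k) spf) \<psi> (hook_F p (j + 1)))"
      unfolding F' W S F Suc using short_exact_W short_exact_S[OF c] p by blast
  qed
qed

end
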